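(* There exists an infinite sequence of pairs $(q_j,x_j)$ of integers $q_j\ge 3$ and reals $x_j$, with $q_j<x_j$ and both $q_j\to\infty$ and $x_j\to\infty$, such that $$\lim_{j\to\infty}\frac{G(x_j;q_j)}{x_j\log q_j}=\infty.$$ The same holds with $V_\Lambda(x_j;q_j)$ in place of $G(x_j;q_j)$.
   Context: For $x>q\ge 3$ define $$G(x;q):=\sum_{\substack{a \bmod q\\ (a,q)=1}}\Big|\sum_{\substack{p\le x\\ p\equiv a \bmod q}}\log p-\frac{x}{\phi(q)}\Big|^2,\qquad V_\Lambda(x;q):=\sum_{\substack{a \bmod q\\ (a,q)=1}}\Big|\sum_{\substack{n\le x\\ n\equiv a\bmod q}}\Lambda(n)-\frac{1}{\phi(q)}\sum_{\substack{n\le x\\ (n,q)=1}}\Lambda(n)\Big|^2,$$ where $p$ runs over primes, $\Lambda$ is the von Mangoldt function and $\phi$ is Euler's totient function. *)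

theory Defs
  imports "HOL-Analysis.Analysis" "HOL-Number_Theory.Number_Theory"
begin

definition vonMangoldt :: "nat \<Rightarrow> real" where
  "vonMangoldt n = (if \<exists>p k. prime p \<and> k \<ge> 1 \<and> n = p ^ k
     then ln (real (THE p. prime p \<and> (\<exists>k\<ge>1. n = p ^ k))) else 0)"

definition G :: "real \<Rightarrow> nat \<Rightarrow> real" where
  "G x q = (\<Sum>a\<in>{a. a < q \<and> coprime a q}.
     ((\<Sum>p\<in>{p. prime p \<and> real p \<le> x \<and> p mod q = a}. ln (real p))
        - x / real (totient q))\<^sup>2)"

definition V_Lambda :: "real \<Rightarrow> nat \<Rightarrow> real" where
  "V_Lambda x q = (\<Sum>a\<in>{a. a < q \<and> coprime a q}.
     ((\<Sum>n\<in>{n. 1 \<le> n \<and> real n \<le> x \<and> n mod q = a}. vonMangoldt n)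
        - (1 / real (totient q)) *
          (\<Sum>n\<in>{n. 1 \<le> n \<and> real n \<le> x \<and> coprime n q}. vonMangoldt n))\<^sup>2)"

end

theory Submission
  imports Defs "HOL-Complex_Analysis.Complex_Analysis" "HOL-Real_Asymp.Real_Asymp"
begin

text \<open>
  Let \<open>\<chi>\<close> be the nonprincipal character modulo 4 and \<open>\<psi>(x, \<chi>) = \<Sum>\<^sub>n\<^sub>\<le>\<^sub>x \<chi>(n) \<Lambda>(n)\<close>.
  For \<open>q = 2\<^sup>j\<close> the character \<open>\<chi>\<close> is also a nonprincipal character modulo \<open>q\<close>, so Cauchy--Schwarz
  gives \<open>V\<^sub>\<Lambda>(x; q) \<ge> \<psi>(x, \<chi>)\<^sup>2 / q\<close>, and similarly for \<open>G\<close> with the prime sum \<open>\<theta>(x, \<chi>)\<close>, which by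
  Chebyshev differs from \<open>\<psi>(x, \<chi>)\<close> by \<open>O(\<surd>x)\<close>. Hence it is enough that \<open>\<psi>(x, \<chi>) / \<surd>x\<close> is unbounded:
  \<open>q\<close> may be fixed first and \<open>x\<close> taken large in terms of \<open>q\<close>.

  Suppose \<open>\<bar>\<psi>(n, \<chi>)\<bar> \<le> C \<surd>n\<close>. Partial summation continues \<open>-L'/L\<close> to \<open>Re s > 1/2\<close>, so all zeros
  \<open>1/2 + i\<gamma>\<close> of the completed L-function are on the critical line, and the bounded function
  \<open>\<psi>(e\<^sup>u, \<chi>) e\<^sup>-\<^sup>u\<^sup>/\<^sup>2\<close> has the mean values \<open>-m\<^sub>\<gamma> / (1/2 + i\<gamma>)\<close> against \<open>e\<^sup>i\<^sup>\<gamma>\<^sup>u\<close>. Testing it against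
  nonnegative trigonometric polynomials shows that the number of zeros up to height \<open>T\<close> is \<open>O(T)\<close>.
  But the functional equation and the argument principle give more than \<open>K T\<close> zeros for every \<open>K\<close>,
  because \<open>Re \<Gamma>'/\<Gamma>\<close> tends to infinity along vertical lines.
\<close>

section \<open>Estimates for complex powers\<close>

text \<open>Boundedness alone gives, by Bessel's inequality, that the sum of m_\<gamma>^2 / (1/4 +
  \<gamma>^2) is at most C^2. That only yields O(T^2) zeros up to height T, which does not
  contradict the true order T log T. The missing factor comes from signs: multiplicities are
  nonnegative. The primitive of a function bounded by C is Lipschitz; tested symmetrically against a
  nonnegative kernel, this bounds the sum of m_\<gamma> (1 - cos (\<gamma> d)) / (1/4 + \<gamma>^2)
  by 2 C d for every d \<ge> 0, and d = 1/T yields O(T). The kernel is built on a finite set of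
  frequencies almost invariant under translation by the chosen ordinates (a Folner set), whatever
  the linear relations between them. All means are Abel means over integers with weights n^(-1-x), x
  -> 0, so they are read off from Dirichlet series. For the lower bound, a weight vanishing at +-iR
  replaces control of the argument of the L-function on the horizontal sides, where zeros may be
  close.\<close>

lemma norm_powr_diff_le:
  fixes a b :: real and s :: complex
  assumes "0 < a" "a \<le> b" "-1 \<le> Re s"
  shows "norm (of_real a powr (-s) - of_real b powr (-s)) \<le> norm s * (b - a) * a powr (-Re s - 1)"
proof -
  let ?S = "closed_segment (complex_of_real a) (of_real b)"
  have seg: "\<exists>t. w = of_real t \<and> a \<le> t \<and> t \<le> b" if "w \<in> ?S" for w
    using that assms by (auto simp: closed_segment_of_real closed_segment_eq_real_ivl)
  have "norm (of_real a powr (-s) - of_real b powr (-s))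
        \<le> (norm s * a powr (-Re s - 1)) * norm (complex_of_real a - of_real b)"
  proof (rule field_differentiable_bound[where S = ?S and f' = "\<lambda>w. - s * w powr (-s-1)"])
    fix w assume "w \<in> ?S"
    then obtain t where t: "w = of_real t" "a \<le> t" "t \<le> b" using seg by blast
    hence tpos: "t > 0" using assms by linarith
    have nr: "w \<notin> \<real>\<^sub>\<le>\<^sub>0" using tpos t by (auto simp: complex_nonpos_Reals_iff)
    show "((\<lambda>w. w powr - s) has_field_derivative - s * w powr (- s - 1)) (at w within ?S)"
      by (rule derivative_eq_intros refl | use nr in simp)+
    have "norm (w powr (-s-1)) = t powr (-Re s - 1)"
      using tpos t by (simp add: norm_powr_real_powr)
    also have "\<dots> \<le> a powr (-Re s - 1)"
      using assms t by (intro powr_mono2') auto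
    finally show "norm (- s * w powr (-s-1)) \<le> norm s * a powr (-Re s - 1)"
      by (simp add: norm_mult mult_left_mono)
  qed auto
  also have "norm (complex_of_real a - of_real b) = b - a"
    using assms by (simp flip: of_real_diff)
  finally show ?thesis by (simp add: mult_ac)
qed

text \<open>Removing the derivative term gains one more power of \<open>a\<close>. This makes the
  comparison of n^(-s) - (n+1)^(-s) with s n^(-s-1) summable with room to spare, both for the pole
  of zeta and for replacing \<open>H4\<close> by \<open>D4\<close>.\<close>

lemma norm_powr_diff2_le:
  fixes a :: real and s :: complex
  assumes "0 < a" "-2 \<le> Re s"
  shows "norm (of_real a powr (-s) - of_real (a+1) powr (-s) - s * of_real a powr (-s-1))
           \<le> norm s * norm (s+1) * a powr (-Re s - 2)"
proof -
  let ?S = "closed_segment (complex_of_real a) (of_real (a+1))"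
  have seg: "\<exists>t. w = of_real t \<and> a \<le> t \<and> t \<le> a+1" if "w \<in> ?S" for w
    using that assms by (auto simp: closed_segment_of_real closed_segment_eq_real_ivl simp del: of_real_add)
  \<comment> \<open>The added linear term makes the derivative vanish at \<open>a\<close>, so the
    first-order bound can be applied to that derivative along the segment.\<close>
  let ?f = "\<lambda>w. w powr (-s) + s * of_real a powr (-s-1) * w"
  have "norm (?f (of_real a) - ?f (of_real (a+1)))
        \<le> (norm s * norm (s+1) * a powr (-Re s - 2)) * norm (complex_of_real a - of_real (a+1))"
  proof (rule field_differentiable_bound[where S = ?S and f' = "\<lambda>w. - s * w powr (-s-1) + s * of_real a powr (-s-1)"])
    fix w assume "w \<in> ?S"
    then obtain t where t: "w = of_real t" "a \<le> t" "t \<le> a+1" using seg by blast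
    hence tpos: "t > 0" using assms by linarith
    have nr: "w \<notin> \<real>\<^sub>\<le>\<^sub>0" using tpos t by (auto simp: complex_nonpos_Reals_iff)
    show "(?f has_field_derivative - s * w powr (-s-1) + s * of_real a powr (-s-1)) (at w within ?S)"
      by (rule derivative_eq_intros refl | use nr in simp)+
    have "norm (of_real a powr (-(s+1)) - w powr (-(s+1))) \<le> norm (s+1) * (t - a) * a powr (-Re (s+1) - 1)"
      unfolding t(1) by (rule norm_powr_diff_le) (use assms t in auto)
    also have "-Re (s+1) - 1 = -Re s - 2" by simp
    also have "norm (s+1) * (t - a) * a powr (-Re s - 2) \<le> norm (s+1) * 1 * a powr (-Re s - 2)"
      using t by (intro mult_mono) auto
    also have "-(s+1) = -s-1" by simp
    also have "norm (s+1) * 1 * a powr (-Re s - 2) = norm (s+1) * a powr (-Re s - 2)" by simp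
    finally have *: "norm (of_real a powr (-s-1) - w powr (-s-1)) \<le> norm (s+1) * a powr (-Re s - 2)"
      by simp
    have "norm (- s * w powr (-s-1) + s * of_real a powr (-s-1)) =
          norm s * norm (of_real a powr (-s-1) - w powr (-s-1))"
      by (simp add: norm_mult [symmetric] algebra_simps)
    also have "\<dots> \<le> norm s * (norm (s+1) * a powr (-Re s - 2))"
      by (intro mult_left_mono *) auto
    finally show "norm (- s * w powr (-s-1) + s * of_real a powr (-s-1)) \<le> norm s * norm (s+1) * a powr (-Re s - 2)"
      by (simp add: mult_ac)
  qed auto
  also have "norm (complex_of_real a - of_real (a+1)) = 1"
    by simp
  finally show ?thesis by (simp add: algebra_simps)
qed

section \<open>The zeta series near its pole at 1\<close>

lemma sums_powr_telescope:
  fixes z :: complex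
  assumes "Re z > 0"
  shows "(\<lambda>n. of_nat (Suc n) powr (-z) - of_nat (Suc (Suc n)) powr (-z)) sums 1"
proof -
  have "(\<lambda>n. complex_of_real (real (Suc n)) powr (-z)) \<longlonglongrightarrow> 0"
  proof (rule tendsto_norm_zero_cancel)
    have "(\<lambda>n. real (Suc n) powr (-Re z)) \<longlonglongrightarrow> 0"
      by (rule tendsto_neg_powr) (use assms filterlim_compose[OF filterlim_real_sequentially filterlim_Suc] in \<open>simp_all del: of_nat_Suc\<close>)
    thus "(\<lambda>n. norm (complex_of_real (real (Suc n)) powr (-z))) \<longlonglongrightarrow> 0"
      by (subst norm_powr_real_powr) auto
  qed
  from telescope_sums'[OF this] show ?thesis by simp
qed

text \<open>Integral test by telescoping: the mean value theorem bounds each later term by a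
  difference of values of t^(-x)/x. The explicit 1/x becomes the growth rate of \<open>H4\<close>
  near the critical line.\<close>

lemma real_powr_tail:
  fixes x :: real
  assumes "x > 0"
  shows "summable (\<lambda>n. real (Suc n) powr (-1-x))" "(\<Sum>n. real (Suc n) powr (-1-x)) \<le> 1 + 1/x"
proof -
  have lim: "(\<lambda>n. real (Suc n) powr (-x)) \<longlonglongrightarrow> 0"
      by (rule tendsto_neg_powr) (use assms filterlim_compose[OF filterlim_real_sequentially filterlim_Suc] in \<open>simp_all del: of_nat_Suc\<close>)
  have tel: "(\<lambda>n. (real (Suc n) powr (-x) - real (Suc (Suc n)) powr (-x)) / x) sums (1/x)"
    using sums_divide[OF telescope_sums'[OF lim], of x] by simp
  have le: "real (Suc (Suc n)) powr (-1-x) \<le> (real (Suc n) powr (-x) - real (Suc (Suc n)) powr (-x)) / x" for n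
  proof -
    have "\<exists>t. real (Suc n) < t \<and> t < real (Suc (Suc n)) \<and>
       real (Suc (Suc n)) powr (-x) - real (Suc n) powr (-x) = (real (Suc (Suc n)) - real (Suc n)) * (-x * t powr (-x-1))"
      by (intro MVT2) (auto intro!: derivative_eq_intros)
    then obtain t where t: "real (Suc n) < t" "t < real (Suc (Suc n))"
       "real (Suc (Suc n)) powr (-x) - real (Suc n) powr (-x) = -x * t powr (-x-1)" by auto
    have eq: "-x-1 = -1-x" by simp
    have "real (Suc (Suc n)) powr (-1-x) \<le> t powr (-1-x)"
      using t assms by (intro powr_mono2') auto
    also have "t powr (-1-x) = (real (Suc n) powr (-x) - real (Suc (Suc n)) powr (-x)) / x"
      using t(3) assms unfolding eq by (simp add: field_simps)
    finally show ?thesis .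
  qed
  have s2: "summable (\<lambda>n. real (Suc (Suc n)) powr (-1-x))"
    by (rule summable_comparison_test'[OF sums_summable[OF tel], of 0]) (use le in auto)
  show s: "summable (\<lambda>n. real (Suc n) powr (-1-x))"
    by (subst summable_Suc_iff[symmetric]) (rule s2)
  have "(\<Sum>n. real (Suc n) powr (-1-x)) = 1 + (\<Sum>n. real (Suc (Suc n)) powr (-1-x))"
    using suminf_split_head[OF s] by simp
  also have "(\<Sum>n. real (Suc (Suc n)) powr (-1-x)) \<le> (\<Sum>n. (real (Suc n) powr (-x) - real (Suc (Suc n)) powr (-x)) / x)"
    by (intro suminf_le le s2 sums_summable[OF tel])
  also have "\<dots> = 1/x" using tel by (simp add: sums_iff)
  finally show "(\<Sum>n. real (Suc n) powr (-1-x)) \<le> 1 + 1/x" by simp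
qed

lemma norm_of_nat_Suc_powr: "norm (of_nat (Suc n) powr z :: complex) = real (Suc n) powr (Re z)"
  using norm_powr_real_powr[of "of_nat (Suc n)" z] by (simp del: of_nat_Suc)

lemma summable_zeta_line:
  fixes z :: complex
  assumes "Re z > 0"
  shows "summable (\<lambda>n. norm (of_nat (Suc n) powr (-1-z) :: complex))"
  using real_powr_tail(1)[OF assms] by (simp only: norm_of_nat_Suc_powr) simp

text \<open>The series is zeta(1 + z). The differences of n^(-z) telescope to 1, so the second-order
  bound makes z zeta(1 + z) equal to 1 up to O(z): a simple pole with residue 1, with an error
  uniform up to the line Re z = 0 on bounded sets.\<close>

lemma norm_zeta_line_minus_pole_le:
  fixes z :: complex
  assumes "Re z > 0"
  shows "norm (z * (\<Sum>n. of_nat (Suc n) powr (-1-z)) - 1) \<le> 2 * norm z * norm (z+1)"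
proof -
  let ?A = "\<lambda>n. of_nat (Suc n) powr (-z) - of_nat (Suc (Suc n)) powr (-z) - z * of_nat (Suc n) powr (-1-z) :: complex"
  have su: "summable (\<lambda>n. z * of_nat (Suc n) powr (-1-z))"
    using summable_norm_cancel[OF summable_zeta_line[OF assms]] by (rule summable_mult)
  have le: "norm (?A n) \<le> norm z * norm (z+1) * real (Suc n) powr (-1-(1+Re z))" for n
  proof -
    have *: "complex_of_real (real (Suc n) + 1) = of_nat (Suc (Suc n))" "-z-1 = -1-z"
            "-1-(1+Re z) = -Re z - 2" by simp_all
    show ?thesis using norm_powr_diff2_le[of "real (Suc n)" z] assms
      unfolding * by (simp del: of_nat_Suc)
  qed
  have x: "1 + Re z > 0" using assms by simp
  have "norm (\<Sum>n. ?A n) \<le> (\<Sum>n. norm z * norm (z+1) * real (Suc n) powr (-1-(1+Re z)))"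
    by (rule norm_suminf_le[OF le summable_mult[OF real_powr_tail(1)[OF x]]])
  also have "\<dots> = norm z * norm (z+1) * (\<Sum>n. real (Suc n) powr (-1-(1+Re z)))"
    by (rule suminf_mult[OF real_powr_tail(1)[OF x]])
  also have "\<dots> \<le> norm z * norm (z+1) * 2"
  proof (intro mult_left_mono)
    have "1 / (1 + Re z) \<le> 1" using assms by simp
    thus "(\<Sum>n. real (Suc n) powr (-1-(1+Re z))) \<le> 2"
      using real_powr_tail(2)[OF x] by linarith
  qed auto
  also have "(\<Sum>n. ?A n) = 1 - z * (\<Sum>n. of_nat (Suc n) powr (-1-z))"
    using suminf_diff[OF sums_summable[OF sums_powr_telescope[OF assms]] su]
      suminf_mult[OF summable_norm_cancel[OF summable_zeta_line[OF assms]], of z] sums_unique[OF sums_powr_telescope[OF assms]]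
    by simp
  finally show ?thesis by (simp add: norm_minus_commute mult_ac)
qed

section \<open>The L-function of the nonprincipal character modulo 4\<close>

definition chi4 :: "nat \<Rightarrow> real" where
  "chi4 n = (if n mod 4 = 1 then 1 else if n mod 4 = 3 then -1 else 0)"

definition psi4 :: "nat \<Rightarrow> real" where
  "psi4 n = (\<Sum>k\<in>{1..n}. chi4 k * mangoldt k)"

text \<open>Pairing the terms 4j+1 and 4j+3 makes the series absolutely convergent for Re s > 0,
  where the plain Dirichlet series converges absolutely only for Re s > 1.\<close>

definition L4 :: "complex \<Rightarrow> complex" where
  "L4 s = (\<Sum>j. of_nat (4*j+1) powr (-s) - of_nat (4*j+3) powr (-s))"

text \<open>
  Abel summation turns the Dirichlet series of \<open>\<chi>\<Lambda>\<close>, i.e. \<open>-L'/L\<close>, into this series, which still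
  converges for \<open>Re s > 1/2\<close> when \<open>\<psi>(n, \<chi>) = O(\<surd>n)\<close>.
\<close>
definition H4 :: "complex \<Rightarrow> complex" where
  "H4 s = (\<Sum>n. of_real (psi4 (Suc n)) * (of_nat (Suc n) powr (-s) - of_nat (Suc (Suc n)) powr (-s)))"

lemma chi4_mult: "chi4 (m * n) = chi4 m * chi4 n"
proof -
  have *: "k mod 4 = 0 \<or> k mod 4 = 1 \<or> k mod 4 = 2 \<or> k mod 4 = 3" for k :: nat by linarith
  have "m * n mod 4 = (m mod 4) * (n mod 4) mod 4" by (rule mod_mult_eq [symmetric])
  thus ?thesis using *[of m] *[of n] unfolding chi4_def by (elim disjE) simp_all
qed

lemma abs_chi4_le: "\<bar>chi4 n\<bar> \<le> 1"
  by (simp add: chi4_def)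

lemma norm_chi4_le: "n > 0 \<Longrightarrow> norm (complex_of_real (chi4 n)) \<le> 1 + ln (real n)"
  using abs_chi4_le[of n] ln_ge_zero[of "real n"] unfolding norm_of_real by linarith

lemma norm_chi4_mangoldt_le: "n > 0 \<Longrightarrow> norm (complex_of_real (chi4 n * mangoldt n)) \<le> 1 + ln (real n)"
proof -
  assume "n > 0"
  hence "\<bar>chi4 n\<bar> * mangoldt n \<le> 1 * ln n"
    by (intro mult_mono mangoldt_le abs_chi4_le mangoldt_nonneg) auto
  thus ?thesis by (simp add: norm_mult)
qed

lemma powr_nat_mult: "(of_nat (a * b) powr s :: complex) = of_nat a powr s * of_nat b powr s"
  using powr_times_real[of "of_nat a" "of_nat b" s] by simp

text \<open>Fubini on pairs (d, m), regrouped by the product n = d m. The shifts by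
  \<open>Suc\<close> let series over n \<ge> 1 be summed with \<open>sums\<close>.\<close>

lemma dirichlet_product_sums:
  fixes a b c :: "nat \<Rightarrow> complex"
  assumes a: "summable (\<lambda>n. norm (a (Suc n)))" and b: "summable (\<lambda>n. norm (b (Suc n)))"
    and c: "\<And>n. n > 0 \<Longrightarrow> c n = (\<Sum>d | d dvd n. a d * b (n div d))"
  shows "(\<lambda>n. c (Suc n)) sums ((\<Sum>n. a (Suc n)) * (\<Sum>n. b (Suc n)))"
proof -
  define A B where "A = (\<Sum>n. a (Suc n))" and "B = (\<Sum>n. b (Suc n))"
  have bij: "bij_betw Suc UNIV {0<..}"
    by (rule bij_betwI[where g = "\<lambda>n. n - 1"]) auto
  have hs: "(f has_sum (\<Sum>n. f (Suc n))) {0<..}" if "summable (\<lambda>n. norm (f (Suc n)))" for f :: "nat \<Rightarrow> complex"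
    using norm_summable_imp_has_sum[OF that summable_sums[OF summable_norm_cancel[OF that]]]
    by (subst (asm) has_sum_reindex_bij_betw[OF bij])
  have nhs: "(\<lambda>n. norm (f n)) summable_on {0<..}" if "summable (\<lambda>n. norm (f (Suc n)))" for f :: "nat \<Rightarrow> complex"
    using norm_summable_imp_summable_on[of "\<lambda>n. norm (f (Suc n))"] that
    by (simp add: summable_on_reindex_bij_betw[OF bij, of "\<lambda>n. norm (f n)"])
  have hA: "(a has_sum A) {0<..}" and hB: "(b has_sum B) {0<..}" unfolding A_def B_def
    by (rule hs[OF a] hs[OF b])+
  have "(\<lambda>p. norm ((\<lambda>(d,m). a d * b m) p)) summable_on {0<..} \<times> {0<..}"
  proof (subst Infinite_Sum.abs_summable_on_Sigma_iff, intro conjI ballI)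
    fix d :: nat
    show "(\<lambda>m. norm (case (d, m) of (d, m) \<Rightarrow> a d * b m)) summable_on {0<..}"
      using summable_on_cmult_right[OF nhs[OF b], of "norm (a d)"] by (simp add: norm_mult)
  next
    have "(\<lambda>d. norm (a d) * (\<Sum>\<^sub>\<infinity>m\<in>{0<..}. norm (b m))) summable_on {0<..}"
      by (intro summable_on_cmult_left nhs[OF a])
    thus "(\<lambda>d. norm (\<Sum>\<^sub>\<infinity>m\<in>{0<..}. norm (case (d, m) of (d, m) \<Rightarrow> a d * b m))) summable_on {0<..}"
      by (simp add: norm_mult infsum_cmult_right' infsum_nonneg)
  qed
  hence su: "(\<lambda>(d,m). a d * b m) summable_on {0<..} \<times> {0<..}"
    by (rule Infinite_Sum.abs_summable_summable)
  have 1: "((\<lambda>(d,m). a d * b m) has_sum (A * B)) ({0<..} \<times> {0<..})"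
    by (rule has_sum_SigmaI[where g = "\<lambda>d. a d * B"])
       (use su hA hB in \<open>auto intro!: has_sum_cmult_right has_sum_cmult_left\<close>)
  have 2: "((\<lambda>(n,d). a d * b (n div d)) has_sum (A * B)) (SIGMA n:{0<..}. {d. d dvd n})"
    by (subst has_sum_reindex_bij_witness[where S = "SIGMA n:{0<..}. {d. d dvd n}" and T = "{0<..} \<times> {0<..}"
          and j = "\<lambda>(n,d). (d, n div d)" and i = "\<lambda>(d,m). (d * m, d)" and h = "\<lambda>(d,m). a d * b m" and s' = "A * B"])
       (use 1 in \<open>auto intro!: Nat.gr0I\<close>)
  have "(c has_sum (A * B)) {0<..}"
    by (rule has_sum_SigmaD[OF 2]) (auto simp: c intro!: has_sum_finiteI)
  hence "((\<lambda>n. c (Suc n)) has_sum (A * B)) UNIV"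
    by (subst has_sum_reindex_bij_betw[OF bij])
  thus ?thesis unfolding A_def B_def by (rule has_sum_imp_sums)
qed

lemma holomorphic_on_suminf:
  fixes f :: "nat \<Rightarrow> complex \<Rightarrow> complex"
  assumes S: "open S" and f: "\<And>n. f n holomorphic_on S"
    and bd: "\<And>x. x \<in> S \<Longrightarrow> \<exists>d h. 0 < d \<and> summable h \<and> (\<forall>n. \<forall>y\<in>ball x d \<inter> S. norm (f n y) \<le> h n)"
  shows "(\<lambda>x. \<Sum>n. f n x) holomorphic_on S"
    and "\<And>x. x \<in> S \<Longrightarrow> summable (\<lambda>n. f n x)"
    and "\<And>x. x \<in> S \<Longrightarrow> (\<lambda>n. deriv (f n) x) sums deriv (\<lambda>x. \<Sum>n. f n x) x"
proof -
  have "\<exists>g g'. \<forall>x \<in> S. ((\<lambda>n. f n x) sums g x) \<and> ((\<lambda>n. deriv (f n) x) sums g' x) \<and> (g has_field_derivative g' x) (at x)"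
  proof (rule series_and_derivative_comparison_local[OF S])
    show "(f n has_field_derivative deriv (f n) x) (at x)" if "x \<in> S" for n x
      using f[of n] S that by (rule holomorphic_derivI)
    show "\<exists>d h. 0 < d \<and> summable h \<and> (\<forall>\<^sub>F n in sequentially. \<forall>y\<in>ball x d \<inter> S. norm (f n y) \<le> h n)"
      if "x \<in> S" for x
    proof -
      obtain d h where "0 < d" "summable h" "\<forall>n. \<forall>y\<in>ball x d \<inter> S. norm (f n y) \<le> h n"
        using bd[OF \<open>x \<in> S\<close>] by blast
      thus ?thesis by (intro exI[of _ d] exI[of _ h]) auto
    qed
  qed
  then obtain g g' where g: "\<And>x. x \<in> S \<Longrightarrow> (\<lambda>n. f n x) sums g x"
     "\<And>x. x \<in> S \<Longrightarrow> (\<lambda>n. deriv (f n) x) sums g' x"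
     "\<And>x. x \<in> S \<Longrightarrow> (g has_field_derivative g' x) (at x)" by blast
  have eq: "(\<Sum>n. f n x) = g x" if "x \<in> S" for x using g(1)[OF that] by (simp add: sums_iff)
  have d: "((\<lambda>x. \<Sum>n. f n x) has_field_derivative g' x) (at x)" if "x \<in> S" for x
    by (rule has_field_derivative_transform_within_open[OF g(3)[OF that] S that]) (simp add: eq)
  show "(\<lambda>x. \<Sum>n. f n x) holomorphic_on S"
    using d S by (meson holomorphic_on_open)
  show "summable (\<lambda>n. f n x)" if "x \<in> S" for x using g(1)[OF that] by (simp add: sums_iff)
  show "(\<lambda>n. deriv (f n) x) sums deriv (\<lambda>x. \<Sum>n. f n x) x" if "x \<in> S" for x
    using g(2)[OF that] DERIV_imp_deriv[OF d[OF that]] by simp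
qed

section \<open>Analyticity of L4 and its logarithmic derivative\<close>

lemma holomorphic_nat_powr: "n > 0 \<Longrightarrow> (\<lambda>s. of_nat n powr (-s)) holomorphic_on A"
  by (auto intro!: holomorphic_intros)

lemma norm_nat_powr_diff_le:
  assumes "0 < m" "m \<le> n" "-1 \<le> Re s"
  shows "norm (of_nat m powr (-s) - of_nat n powr (-s) :: complex) \<le> norm s * real (n - m) * real m powr (-1 - Re s)"
proof -
  have *: "-1 - Re s = - Re s - 1" "real (n - m) = real n - real m" using assms by (auto simp: of_nat_diff)
  show ?thesis unfolding * using norm_powr_diff_le[of "real m" "real n" s] assms by simp
qed

lemma norm_L4_term_le:
  assumes "Re s > 0"
  shows "norm (of_nat (4*j+1) powr (-s) - of_nat (4*j+3) powr (-s) :: complex) \<le> 2 * norm s * real (Suc j) powr (-1 - Re s)"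
proof -
  have "norm (of_nat (4*j+1) powr (-s) - of_nat (4*j+3) powr (-s) :: complex)
     \<le> norm s * real (4*j+3 - (4*j+1)) * real (4*j+1) powr (-1 - Re s)"
    by (rule norm_nat_powr_diff_le) (use assms in auto)
  also have "\<dots> \<le> norm s * 2 * real (Suc j) powr (-1 - Re s)"
    using assms by (intro mult_mono powr_mono2') auto
  finally show ?thesis by (simp add: mult_ac)
qed

lemma L4_holomorphic: "L4 holomorphic_on {s. Re s > 0}"
  and L4_sums: "\<And>s. Re s > 0 \<Longrightarrow> (\<lambda>j. of_nat (4*j+1) powr (-s) - of_nat (4*j+3) powr (-s)) sums L4 s"
proof -
  let ?f = "\<lambda>j s. of_nat (4*j+1) powr (-s) - of_nat (4*j+3) powr (-s) :: complex"
  have hol: "?f n holomorphic_on {s. Re s > 0}" for n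
    by (intro holomorphic_on_diff holomorphic_nat_powr) auto
  have bd: "\<exists>d h. 0 < d \<and> summable h \<and> (\<forall>n. \<forall>y\<in>ball x d \<inter> {s. Re s > 0}. norm (?f n y) \<le> h n)"
    if x: "x \<in> {s. Re s > 0}" for x
  proof (intro exI conjI allI ballI)
    let ?a = "Re x / 2"
    show "?a > 0" using x by simp
    show "summable (\<lambda>n. 2 * (norm x + ?a) * real (Suc n) powr (-1 - ?a))"
      using x by (intro summable_mult real_powr_tail) auto
    fix n y assume y: "y \<in> ball x ?a \<inter> {s. Re s > 0}"
    have d: "norm (y - x) < ?a" using y by (simp add: dist_norm norm_minus_commute)
    have "Re y \<ge> ?a" using d abs_Re_le_cmod[of "y - x"] by (simp del: of_nat_Suc)
    have ny: "norm y \<le> norm x + ?a" using d norm_triangle_ineq2[of y x] by linarith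
    have "norm (?f n y) \<le> 2 * norm y * real (Suc n) powr (-1 - Re y)"
      using y by (intro norm_L4_term_le) auto
    also have "\<dots> \<le> 2 * (norm x + ?a) * real (Suc n) powr (-1 - ?a)"
      using ny \<open>Re y \<ge> ?a\<close> x by (intro mult_mono powr_mono) auto
    finally show "norm (?f n y) \<le> 2 * (norm x + ?a) * real (Suc n) powr (-1 - ?a)" .
  qed
  have op: "open {s. Re s > 0}" by (rule open_halfspace_Re_gt)
  show "L4 holomorphic_on {s. Re s > 0}" unfolding L4_def [abs_def]
    by (rule holomorphic_on_suminf[OF op hol bd])
  show "(\<lambda>j. of_nat (4*j+1) powr (-s) - of_nat (4*j+3) powr (-s)) sums L4 s" if "Re s > 0" for s
    unfolding L4_def using holomorphic_on_suminf(2)[OF op hol bd] that by (intro summable_sums) auto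
qed

text \<open>The growth condition covers both \<open>chi4\<close> and \<open>chi4 * mangoldt\<close>.
  Half of the excess of Re s over 1 absorbs the logarithm, the other half gives convergence.\<close>

lemma summable_dirichlet_norm:
  fixes s :: complex and a :: "nat \<Rightarrow> complex"
  assumes "Re s > 1" "\<And>n. n > 0 \<Longrightarrow> norm (a n) \<le> 1 + ln (real n)"
  shows "summable (\<lambda>n. norm (a (Suc n) * of_nat (Suc n) powr (-s)))"
proof -
  define e where "e = (Re s - 1) / 2"
  have e: "e > 0" using assms by (simp add: e_def)
  have "norm (a (Suc n) * of_nat (Suc n) powr (-s)) \<le> (1 + 1 / e) * real (Suc n) powr (-1 - e)" for n
  proof -
    have "norm (a (Suc n)) \<le> 1 + ln (real (Suc n))" using assms(2)[of "Suc n"] by simp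
    also have "ln (real (Suc n)) \<le> real (Suc n) powr e / e" by (rule ln_powr_bound) (use e in auto)
    also have "(1::real) \<le> real (Suc n) powr e" using e by (intro ge_one_powr_ge_zero) auto
    finally have 1: "norm (a (Suc n)) \<le> (1 + 1 / e) * real (Suc n) powr e"
      by (simp add: algebra_simps)
    have "norm (a (Suc n) * of_nat (Suc n) powr (-s)) = norm (a (Suc n)) * real (Suc n) powr (-Re s)"
      by (simp add: norm_mult norm_of_nat_Suc_powr del: of_nat_Suc)
    also have "\<dots> \<le> (1 + 1 / e) * real (Suc n) powr e * real (Suc n) powr (-Re s)"
      using 1 by (intro mult_right_mono) auto
    also have "\<dots> = (1 + 1 / e) * real (Suc n) powr (e - Re s)"
      by (simp add: powr_add [symmetric] del: of_nat_Suc)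
    also have "e - Re s = -1 - e" by (simp add: e_def field_simps)
    finally show ?thesis .
  qed
  thus ?thesis
    by (intro summable_comparison_test'[OF summable_mult[OF real_powr_tail(1)[OF e]], of 0]) auto
qed

lemma chi4_sums_L4:
  assumes "Re s > 1"
  shows "(\<lambda>n. of_real (chi4 (Suc n)) * of_nat (Suc n) powr (-s)) sums L4 s"
proof -
  have "summable (\<lambda>n. norm (of_real (chi4 (Suc n)) * of_nat (Suc n) powr (-s) :: complex))"
    by (rule summable_dirichlet_norm[OF assms, of "\<lambda>n. of_real (chi4 n)"])
       (rule norm_chi4_le)
  from summable_norm_cancel[OF this] obtain l where l:
    "(\<lambda>n. of_real (chi4 (Suc n)) * of_nat (Suc n) powr (-s) :: complex) sums l" by (auto simp: summable_def)
  from sums_group[OF l, of 4] have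
    "(\<lambda>j. \<Sum>n = j*4..<j*4+4. of_real (chi4 (Suc n)) * of_nat (Suc n) powr (-s) :: complex) sums l" by simp
  also have "(\<lambda>j. \<Sum>n = j*4..<j*4+4. of_real (chi4 (Suc n)) * of_nat (Suc n) powr (-s) :: complex) =
       (\<lambda>j. of_nat (4*j+1) powr (-s) - of_nat (4*j+3) powr (-s))"
  proof
    fix j :: nat
    have "{j*4..<j*4+4} = {j*4, j*4+1, j*4+2, j*4+3}" by auto
    moreover have "chi4 (Suc (j*4)) = 1" "chi4 (Suc (j*4+1)) = 0" "chi4 (Suc (j*4+2)) = -1" "chi4 (Suc (j*4+3)) = 0"
      by (simp_all add: chi4_def mod_Suc)
    ultimately show "(\<Sum>n = j*4..<j*4+4. of_real (chi4 (Suc n)) * of_nat (Suc n) powr (-s) :: complex) =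
        of_nat (4*j+1) powr (-s) - of_nat (4*j+3) powr (-s)"
      by (simp add: algebra_simps)
  qed
  finally have "l = L4 s" using L4_sums[of s] assms by (intro sums_unique2) auto
  with l show ?thesis by simp
qed

text \<open>Summing \<open>mangoldt\<close> over divisors gives the logarithm, and complete
  multiplicativity of \<open>chi4\<close> carries this over: the Dirichlet product of
  \<open>chi4 * mangoldt\<close> and \<open>chi4\<close> is \<open>chi4 * ln\<close>, whose series
  is the termwise derivative up to sign.\<close>

lemma deriv_L4:
  assumes s: "Re s > 1"
  shows "deriv L4 s = - (\<Sum>n. of_real (chi4 (Suc n) * mangoldt (Suc n)) * of_nat (Suc n) powr (-s)) * L4 s"
proof -
  let ?S = "{s. Re s > 1}"
  let ?f = "\<lambda>n s. of_real (chi4 (Suc n)) * of_nat (Suc n) powr (-s) :: complex"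
  have op: "open ?S" by (rule open_halfspace_Re_gt)
  have hol: "?f n holomorphic_on ?S" for n
    by (intro holomorphic_on_mult holomorphic_nat_powr) auto
  have bd: "\<exists>d h. 0 < d \<and> summable h \<and> (\<forall>n. \<forall>y\<in>ball x d \<inter> ?S. norm (?f n y) \<le> h n)"
    if x: "x \<in> ?S" for x
  proof (intro exI conjI allI ballI)
    let ?a = "(Re x - 1) / 2"
    show a: "?a > 0" using x by simp
    show "summable (\<lambda>n. real (Suc n) powr (-1 - ?a))"
      using a by (rule real_powr_tail)
    fix n y assume y: "y \<in> ball x ?a \<inter> ?S"
    have d: "norm (y - x) < ?a" using y by (simp add: dist_norm norm_minus_commute)
    have "Re y \<ge> 1 + ?a" using d abs_Re_le_cmod[of "y - x"] by (simp add: field_simps abs_le_iff)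
    have "norm (?f n y) = \<bar>chi4 (Suc n)\<bar> * real (Suc n) powr (- Re y)"
      by (simp add: norm_mult norm_of_nat_Suc_powr del: of_nat_Suc)
    also have "\<dots> \<le> 1 * real (Suc n) powr (-1 - ?a)"
      using abs_chi4_le \<open>Re y \<ge> 1 + ?a\<close> by (intro mult_mono powr_mono) auto
    finally show "norm (?f n y) \<le> real (Suc n) powr (-1 - ?a)" by simp
  qed
  have "deriv L4 s = deriv (\<lambda>s. \<Sum>n. ?f n s) s"
  proof (rule deriv_cong_ev)
    have "eventually (\<lambda>s. s \<in> ?S) (nhds s)" using op s by (intro eventually_nhds_in_open) auto
    thus "eventually (\<lambda>s. L4 s = (\<Sum>n. ?f n s)) (nhds s)"
      by eventually_elim (use chi4_sums_L4 in \<open>auto simp: sums_iff\<close>)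
  qed simp
  moreover have "(\<lambda>n. deriv (?f n) s) sums deriv (\<lambda>s. \<Sum>n. ?f n s) s"
    by (rule holomorphic_on_suminf(3)[OF op hol bd]) (use s in auto)
  moreover have "deriv (?f n) s = - (of_real (chi4 (Suc n) * ln (real (Suc n))) * of_nat (Suc n) powr (-s))" for n
  proof (rule DERIV_imp_deriv)
    have "((\<lambda>s. of_nat (Suc n) powr (-s)) has_field_derivative (Ln (of_nat (Suc n)) * of_nat (Suc n) powr (-s) * (-1))) (at s)"
      by (rule DERIV_chain2[OF has_field_derivative_powr_right]) (auto intro!: derivative_eq_intros simp del: of_nat_Suc)
    from DERIV_cmult[OF this, of "of_real (chi4 (Suc n))"]
    show "(?f n has_field_derivative - (of_real (chi4 (Suc n) * ln (real (Suc n))) * of_nat (Suc n) powr (-s))) (at s)"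
      by (simp add: mult_ac Ln_of_nat del: of_nat_Suc)
  qed
  ultimately have 1: "(\<lambda>n. - (of_real (chi4 (Suc n) * ln (real (Suc n))) * of_nat (Suc n) powr (-s))) sums deriv L4 s"
    by (simp del: of_nat_Suc)
  have "(\<lambda>n. (of_real (chi4 (Suc n) * ln (real (Suc n))) * of_nat (Suc n) powr (-s))) sums
        ((\<Sum>n. of_real (chi4 (Suc n) * mangoldt (Suc n)) * of_nat (Suc n) powr (-s)) *
         (\<Sum>n. of_real (chi4 (Suc n)) * of_nat (Suc n) powr (-s)))"
  proof (rule dirichlet_product_sums[where c = "\<lambda>n. of_real (chi4 n * ln (real n)) * of_nat n powr (-s)"
       and a = "\<lambda>n. of_real (chi4 n * mangoldt n) * of_nat n powr (-s)" and b = "\<lambda>n. of_real (chi4 n) * of_nat n powr (-s)"])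
    show "summable (\<lambda>n. norm (of_real (chi4 (Suc n) * mangoldt (Suc n)) * of_nat (Suc n) powr (-s) :: complex))"
      by (rule summable_dirichlet_norm[OF s, of "\<lambda>n. of_real (chi4 n * mangoldt n)"])
         (rule norm_chi4_mangoldt_le)
    show "summable (\<lambda>n. norm (of_real (chi4 (Suc n)) * of_nat (Suc n) powr (-s) :: complex))"
      by (rule summable_dirichlet_norm[OF s, of "\<lambda>n. of_real (chi4 n)"])
         (rule norm_chi4_le)
    fix n :: nat assume n: "n > 0"
    have "(\<Sum>d | d dvd n. of_real (chi4 d * mangoldt d) * of_nat d powr (-s) * (of_real (chi4 (n div d)) * of_nat (n div d) powr (-s)) :: complex)
       = (\<Sum>d | d dvd n. of_real (chi4 n) * of_nat n powr (-s) * of_real (mangoldt d))"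
    proof (rule sum.cong)
      fix d assume "d \<in> {d. d dvd n}"
      then obtain m where m: "n = d * m" by auto
      hence "n div d = m" using n by auto
      thus "of_real (chi4 d * mangoldt d) * of_nat d powr (-s) * (of_real (chi4 (n div d)) * of_nat (n div d) powr (-s)) =
          (of_real (chi4 n) * of_nat n powr (-s) * of_real (mangoldt d) :: complex)"
        unfolding m by (simp add: chi4_mult powr_nat_mult del: of_nat_mult)
    qed simp
    also have "\<dots> = of_real (chi4 n) * of_nat n powr (-s) * of_real (\<Sum>d | d dvd n. mangoldt d)"
      by (simp add: sum_distrib_left)
    also have "\<dots> = of_real (chi4 n * ln (real n)) * of_nat n powr (-s)"
      using n mangoldt_sum[of n, where ?'a = real] by simp
    finally show "of_real (chi4 n * ln (real n)) * of_nat n powr (-s) =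
      (\<Sum>d | d dvd n. of_real (chi4 d * mangoldt d) * of_nat d powr (-s) * (of_real (chi4 (n div d)) * of_nat (n div d) powr (-s)) :: complex)" ..
  qed
  from sums_unique2[OF 1 sums_minus[OF this]] show ?thesis
    using sums_unique[OF chi4_sums_L4[OF s]] by (simp del: of_nat_Suc)
qed

lemma L4_of_real_sums:
  assumes "s > 0"
  shows "(\<lambda>j. real (4*j+1) powr (-s) - real (4*j+3) powr (-s)) sums Re (L4 (of_real s))"
    and "L4 (of_real s) = of_real (Re (L4 (of_real s)))"
proof -
  have "of_nat (4*j+1) powr (-of_real s) - of_nat (4*j+3) powr (-of_real s) =
      complex_of_real (real (4*j+1) powr (-s) - real (4*j+3) powr (-s))" for j
    using powr_of_real[of "real (4*j+1)" "-s"] powr_of_real[of "real (4*j+3)" "-s"] by simp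
  hence "(\<lambda>j. complex_of_real (real (4*j+1) powr (-s) - real (4*j+3) powr (-s))) sums L4 (of_real s)"
    using L4_sums[of "of_real s"] assms by simp
  hence *: "(\<lambda>j. real (4*j+1) powr (-s) - real (4*j+3) powr (-s)) sums Re (L4 (of_real s))"
      "(\<lambda>j. 0) sums Im (L4 (of_real s))"
    by (auto simp: sums_complex_iff)
  show "(\<lambda>j. real (4*j+1) powr (-s) - real (4*j+3) powr (-s)) sums Re (L4 (of_real s))" by (rule *)
  show "L4 (of_real s) = of_real (Re (L4 (of_real s)))"
    using *(2) by (simp add: complex_eq_iff sums_iff)
qed

text \<open>For real s every pair in the series is positive. The value at 2 later fixes a nonzero
  constant in \<open>L4_nonzero\<close>.\<close>

lemma L4_of_real_nonzero:
  assumes "s > 0"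
  shows "L4 (of_real s) \<noteq> 0"
proof -
  let ?f = "\<lambda>j. real (4*j+1) powr (-s) - real (4*j+3) powr (-s)"
  have "?f j > 0" for j
    using assms powr_less_mono2_neg[of "-s" "real (4*j+1)" "real (4*j+3)"] by simp
  hence "0 < suminf ?f" using L4_of_real_sums(1)[OF assms] by (intro suminf_pos) (auto simp: sums_iff)
  thus ?thesis using L4_of_real_sums(1)[OF assms] by (auto simp: sums_iff)
qed

section \<open>Consequences of the assumed square-root bound\<close>

locale psi4_bounded =
  fixes C :: real
  assumes psi4_le: "n > 0 \<Longrightarrow> \<bar>psi4 n\<bar> \<le> C * sqrt (real n)"
begin

lemma C_nonneg: "C \<ge> 0"
  using psi4_le[of 1] by simp

lemma norm_H4_term_le:
  assumes "Re s > 0"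
  shows "norm (of_real (psi4 (Suc n)) * (of_nat (Suc n) powr (-s) - of_nat (Suc (Suc n)) powr (-s)))
           \<le> C * norm s * real (Suc n) powr (-1 - (Re s - 1/2))"
proof -
  have "norm (of_real (psi4 (Suc n)) * (of_nat (Suc n) powr (-s) - of_nat (Suc (Suc n)) powr (-s)))
     \<le> (C * real (Suc n) powr (1/2)) * (norm s * real (Suc (Suc n) - Suc n) * real (Suc n) powr (-1 - Re s))"
    unfolding norm_mult using assms psi4_le[of "Suc n"] C_nonneg
    by (intro mult_mono norm_nat_powr_diff_le) (auto simp: powr_half_sqrt)
  also have "\<dots> = C * norm s * (real (Suc n) powr (1/2) * real (Suc n) powr (-1 - Re s))"
    by simp
  also have "real (Suc n) powr (1/2) * real (Suc n) powr (-1 - Re s) = real (Suc n) powr (-1 - (Re s - 1/2))"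
    by (subst powr_add [symmetric]) (simp add: algebra_simps)
  finally show ?thesis .
qed

lemma H4_holomorphic: "H4 holomorphic_on {s. Re s > 1/2}"
  and H4_sums: "\<And>s. Re s > 1/2 \<Longrightarrow>
     (\<lambda>n. of_real (psi4 (Suc n)) * (of_nat (Suc n) powr (-s) - of_nat (Suc (Suc n)) powr (-s))) sums H4 s"
proof -
  let ?S = "{s. Re s > 1/2}"
  let ?f = "\<lambda>n s. of_real (psi4 (Suc n)) * (of_nat (Suc n) powr (-s) - of_nat (Suc (Suc n)) powr (-s)) :: complex"
  have hol: "?f n holomorphic_on ?S" for n
    by (intro holomorphic_on_mult holomorphic_on_diff holomorphic_nat_powr holomorphic_on_const) auto
  have bd: "\<exists>d h. 0 < d \<and> summable h \<and> (\<forall>n. \<forall>y\<in>ball x d \<inter> ?S. norm (?f n y) \<le> h n)"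
    if x: "x \<in> ?S" for x
  proof (intro exI conjI allI ballI)
    let ?a = "(Re x - 1/2) / 2"
    show a: "?a > 0" using x by simp
    show "summable (\<lambda>n. C * (norm x + ?a) * real (Suc n) powr (-1 - ?a))"
      using a by (intro summable_mult real_powr_tail) auto
    fix n y assume y: "y \<in> ball x ?a \<inter> ?S"
    have d: "norm (y - x) < ?a" using y by (simp add: dist_norm norm_minus_commute)
    have ry: "Re y \<ge> 1/2 + ?a" using d abs_Re_le_cmod[of "y - x"] by (simp add: field_simps abs_le_iff)
    have ny: "norm y \<le> norm x + ?a" using d norm_triangle_ineq2[of y x] by linarith
    have "norm (?f n y) \<le> C * norm y * real (Suc n) powr (-1 - (Re y - 1/2))"
      using y by (intro norm_H4_term_le) auto
    also have "\<dots> \<le> C * (norm x + ?a) * real (Suc n) powr (-1 - ?a)"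
    proof (intro mult_mono powr_mono mult_nonneg_nonneg)
      show "- 1 - (Re y - 1 / 2) \<le> - 1 - ?a" using ry by linarith
      show "0 \<le> norm x + ?a" using ny norm_ge_zero[of y] by linarith
    qed (use ny C_nonneg in auto)
    finally show "norm (?f n y) \<le> C * (norm x + ?a) * real (Suc n) powr (-1 - ?a)" .
  qed
  have op: "open ?S" by (rule open_halfspace_Re_gt)
  show "H4 holomorphic_on ?S" unfolding H4_def [abs_def]
    by (rule holomorphic_on_suminf[OF op hol bd])
  show "(\<lambda>n. of_real (psi4 (Suc n)) * (of_nat (Suc n) powr (-s) - of_nat (Suc (Suc n)) powr (-s))) sums H4 s"
    if "Re s > 1/2" for s
    unfolding H4_def using holomorphic_on_suminf(2)[OF op hol bd] that by (intro summable_sums) auto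
qed

text \<open>Towards the critical line the bound grows only like 1 / (Re s - 1/2), a first-order
  blow-up that a weight with simple zeros on that line can cancel.\<close>

lemma norm_H4_le:
  assumes "Re s > 1/2"
  shows "norm (H4 s) \<le> C * norm s * (1 + 1 / (Re s - 1/2))"
proof -
  have x: "Re s - 1/2 > 0" using assms by simp
  have "norm (H4 s) \<le> (\<Sum>n. C * norm s * real (Suc n) powr (-1 - (Re s - 1/2)))"
    unfolding H4_def using assms
    by (intro norm_suminf_le norm_H4_term_le summable_mult real_powr_tail x) auto
  also have "\<dots> = C * norm s * (\<Sum>n. real (Suc n) powr (-1 - (Re s - 1/2)))"
    by (rule suminf_mult[OF real_powr_tail(1)[OF x]])
  also have "\<dots> \<le> C * norm s * (1 + 1 / (Re s - 1/2))"
    using C_nonneg by (intro mult_left_mono real_powr_tail x) auto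
  finally show ?thesis .
qed

lemma H4_eq:
  assumes s: "Re s > 1"
  shows "(\<lambda>n. of_real (chi4 (Suc n) * mangoldt (Suc n)) * of_nat (Suc n) powr (-s)) sums H4 s"
proof -
  let ?a = "\<lambda>n. of_real (chi4 (Suc n) * mangoldt (Suc n)) :: complex"
  let ?f = "\<lambda>n. of_nat (Suc n) powr (-s) :: complex"
  have ps: "psi4 (Suc n) = psi4 n + chi4 (Suc n) * mangoldt (Suc n)" for n
    by (simp add: psi4_def)
  have abel: "(\<Sum>n<N. ?a n * ?f n) = of_real (psi4 N) * ?f N + (\<Sum>n<N. of_real (psi4 (Suc n)) * (?f n - ?f (Suc n)))" for N
  proof (induction N)
    case 0 thus ?case by (simp add: psi4_def)
  next
    case (Suc N)
    thus ?case by (simp add: ps algebra_simps del: of_nat_Suc)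
  qed
  have "(\<lambda>N. of_real (psi4 N) * ?f N) \<longlonglongrightarrow> 0"
  proof (rule Lim_null_comparison)
    show "eventually (\<lambda>N. norm (of_real (psi4 N) * ?f N) \<le> C * real (Suc N) powr (1/2 - Re s)) sequentially"
    proof (rule always_eventually, rule allI)
      fix N
      have "\<bar>psi4 N\<bar> \<le> C * real (Suc N) powr (1/2)"
      proof (cases "N = 0")
        case False
        have "\<bar>psi4 N\<bar> \<le> C * sqrt (real N)" using False by (intro psi4_le) auto
        also have "\<dots> \<le> C * sqrt (real (Suc N))" using C_nonneg by (intro mult_left_mono) auto
        finally show ?thesis by (simp add: powr_half_sqrt)
      qed (use C_nonneg in \<open>simp add: psi4_def\<close>)
      hence "norm (of_real (psi4 N) * ?f N) \<le> C * real (Suc N) powr (1/2) * real (Suc N) powr (- Re s)"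
        unfolding norm_mult norm_of_nat_Suc_powr by (intro mult_mono) auto
      thus "norm (of_real (psi4 N) * ?f N) \<le> C * real (Suc N) powr (1/2 - Re s)"
        by (simp add: mult.assoc powr_add [symmetric] del: of_nat_Suc)
    qed
    have "(\<lambda>n. real (Suc n) powr (1/2 - Re s)) \<longlonglongrightarrow> 0"
      by (rule tendsto_neg_powr) (use s filterlim_compose[OF filterlim_real_sequentially filterlim_Suc] in \<open>simp_all del: of_nat_Suc\<close>)
    from tendsto_mult_right_zero[OF this, of C]
    show "(\<lambda>n. C * real (Suc n) powr (1/2 - Re s)) \<longlonglongrightarrow> 0" .
  qed
  from tendsto_add[OF this H4_sums[of s, unfolded sums_def]] s
  show ?thesis unfolding sums_def abel by simp
qed

text \<open>The identity is continued from Re s > 1 as a product rather than as a quotient, so that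
  it does not presuppose that \<open>L4\<close> has no zeros; their absence is deduced from
  it.\<close>

lemma deriv_L4_eq:
  assumes "Re s > 1/2"
  shows "deriv L4 s = - H4 s * L4 s"
proof (rule analytic_continuation_open[where s = "{s. Re s > 1}" and s' = "{s. Re s > 1/2}"
        and f = "deriv L4" and g = "\<lambda>s. - H4 s * L4 s"])
  show "open {s. Re s > 1}" "open {s. Re s > 1/2}" by (rule open_halfspace_Re_gt)+
  show "connected {s. Re s > 1/2}" by (intro convex_connected convex_halfspace_Re_gt)
  have "2 \<in> {s::complex. Re s > 1}" by simp
  thus "{s::complex. Re s > 1} \<noteq> {}" by blast
  have sub: "{s. Re s > 1/2} \<subseteq> {s. Re s > 0}" by auto
  show "deriv L4 holomorphic_on {s. Re s > 1/2}"
    by (rule holomorphic_on_subset[OF holomorphic_deriv[OF L4_holomorphic] sub]) (rule open_halfspace_Re_gt)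
  show "(\<lambda>s. - H4 s * L4 s) holomorphic_on {s. Re s > 1/2}"
    using H4_holomorphic holomorphic_on_subset[OF L4_holomorphic sub] by (intro holomorphic_intros)
  fix z assume "z \<in> {s. Re s > 1}"
  thus "deriv L4 z = - H4 z * L4 z" using deriv_L4[of z] H4_eq[of z] by (simp add: sums_iff)
qed (use assms in auto)

text \<open>If \<open>P\<close> is a primitive of \<open>H4\<close>, then \<open>L4 * exp P\<close> is constant.\<close>
lemma L4_nonzero:
  assumes "Re s > 1/2"
  shows "L4 s \<noteq> 0"
proof -
  let ?S = "{s. Re s > 1/2}"
  have op: "open ?S" by (rule open_halfspace_Re_gt)
  have cv: "convex ?S" by (rule convex_halfspace_Re_gt)
  obtain P where P: "\<And>x. x \<in> ?S \<Longrightarrow> (P has_field_derivative H4 x) (at x within ?S)"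
    using holomorphic_convex_primitive'[OF cv op H4_holomorphic] by blast
  have D: "((\<lambda>s. L4 s * exp (P s)) has_field_derivative 0) (at x within ?S)" if x: "x \<in> ?S" for x
  proof -
    have "(L4 has_field_derivative deriv L4 x) (at x)"
      using x by (intro holomorphic_derivI[OF L4_holomorphic open_halfspace_Re_gt]) auto
    hence L: "(L4 has_field_derivative deriv L4 x) (at x within ?S)"
      by (rule has_field_derivative_at_within)
    have "((\<lambda>s. exp (P s)) has_field_derivative exp (P x) * H4 x) (at x within ?S)"
      by (rule DERIV_chain2[OF DERIV_exp P[OF x]])
    from DERIV_mult[OF L this] show ?thesis using x deriv_L4_eq[of x] by (simp add: algebra_simps)
  qed
  obtain c where c: "\<And>x. x \<in> ?S \<Longrightarrow> L4 x * exp (P x) = c"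
    using has_field_derivative_zero_constant[OF cv D] by blast
  have "L4 2 \<noteq> 0" using L4_of_real_nonzero[of 2] by simp
  hence "c \<noteq> 0" using c[of 2] by auto
  thus ?thesis using c[of s] assms by auto
qed

end

section \<open>The functional equation\<close>

text \<open>Logarithmic differentiation of Gamma(w) Gamma(1 - w) sin(pi w) = pi, kept in product
  form so that a constant function is differentiated.\<close>

lemma Digamma_reflection:
  fixes z :: complex
  assumes "z \<notin> \<int>"
  shows "Digamma (1 - z) - Digamma z = of_real pi * cot (of_real pi * z)"
proof -
  have nz: "z \<notin> \<int>\<^sub>\<le>\<^sub>0" using assms by (auto elim: nonpos_Ints_cases)
  have nz1: "1 - z \<notin> \<int>\<^sub>\<le>\<^sub>0"
    using assms Ints_diff[of 1 "1 - z"] nonpos_Ints_subset_Ints by auto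
  have sin0: "sin (of_real pi * w) \<noteq> 0" if "w \<notin> \<int>" for w :: complex
    using that sin_eq_0[of "of_real pi * w"] by (auto simp: mult.commute)
  have op: "open (- \<int> :: complex set)" by (simp add: open_Compl closed_Ints)
  have const: "Gamma w * Gamma (1 - w) * sin (of_real pi * w) = of_real pi" if "w \<notin> \<int>" for w :: complex
    using Gamma_reflection_complex[of w] sin0[OF that] by (simp add: field_simps)
  have "((\<lambda>w. Gamma w * Gamma (1 - w) * sin (of_real pi * w)) has_field_derivative
     Gamma z * Gamma (1 - z) * ((Digamma z - Digamma (1 - z)) * sin (of_real pi * z) + of_real pi * cos (of_real pi * z))) (at z)"
    using nz nz1 by (auto intro!: derivative_eq_intros simp: algebra_simps)
  moreover have "((\<lambda>w. Gamma w * Gamma (1 - w) * sin (of_real pi * w)) has_field_derivative 0) (at z)"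
    by (rule has_field_derivative_transform_within_open[OF DERIV_const[of "of_real pi"] op]) (use assms const in auto)
  ultimately have "Gamma z * Gamma (1 - z) * ((Digamma z - Digamma (1 - z)) * sin (of_real pi * z) + of_real pi * cos (of_real pi * z)) = 0"
    by (rule DERIV_unique)
  moreover have "Gamma z * Gamma (1 - z) \<noteq> 0" using const[OF assms] by auto
  ultimately have "(Digamma z - Digamma (1 - z)) * sin (of_real pi * z) + of_real pi * cos (of_real pi * z) = 0" by simp
  thus ?thesis using sin0[OF assms] by (simp add: cot_def field_simps)
qed

lemma Digamma_diff_sums:
  fixes z w :: complex
  assumes "z \<noteq> 0" "w \<noteq> 0"
  shows "(\<lambda>k. inverse (z + of_nat k) - inverse (w + of_nat k)) sums (Digamma w - Digamma z)"
  using sums_diff[OF summable_sums[OF summable_Digamma[OF assms(2)]] summable_sums[OF summable_Digamma[OF assms(1)]]]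
  by (simp add: Digamma_def)

text \<open>The points i \<open>A k\<close> and their conjugates are the poles of 1 / cosh. Instead
  of summing residues, the reflection formula is applied at two conjugate points and the Digamma
  series are compared term by term.\<close>

lemma sech_partial_fractions:
  fixes t :: real
  defines "A \<equiv> \<lambda>k::nat. (2 * real k + 1) * pi / 2"
  shows "(\<lambda>j. A (2*j) / (t\<^sup>2 + (A (2*j))\<^sup>2) - A (2*j+1) / (t\<^sup>2 + (A (2*j+1))\<^sup>2)) sums (1 / (2 * cosh t))"
proof -
  \<comment> \<open>The scaling by 2 pi and the abscissa 1/4 come from \<open>A (2*k)\<close> = 2 pi
    (k + 1/4) and \<open>A (2*k+1)\<close> = 2 pi (k + 3/4).\<close>
  define \<tau> where "\<tau> = t / (2 * pi)"
  define z where "z = Complex (1/4) \<tau>"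
  define z' where "z' = Complex (1/4) (-\<tau>)"
  have "real_of_int i * 4 \<noteq> 1" for i
  proof
    assume "real_of_int i * 4 = 1"
    hence "real_of_int (i * 4) = real_of_int 1" by simp
    hence "i * 4 = 1" by (simp only: of_int_eq_iff)
    thus False by presburger
  qed
  hence zs: "z \<notin> \<int>" "z' \<notin> \<int>" by (auto simp: z_def z'_def complex_is_Int_iff elim!: Ints_cases)
  have one: "1 - z = Complex (3/4) (-\<tau>)" "1 - z' = Complex (3/4) \<tau>"
    by (simp_all add: z_def z'_def complex_eq_iff)
  have nz: "z \<noteq> 0" "z' \<noteq> 0" "1 - z \<noteq> 0" "1 - z' \<noteq> 0" unfolding one by (auto simp: z_def z'_def complex_eq_iff)
  have "(\<lambda>k. (inverse (z + of_nat k) - inverse ((1 - z') + of_nat k)) + (inverse (z' + of_nat k) - inverse ((1 - z) + of_nat k)))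
     sums ((Digamma (1 - z') - Digamma z) + (Digamma (1 - z) - Digamma z'))"
    by (intro sums_add Digamma_diff_sums nz)
  also have "(Digamma (1 - z') - Digamma z) + (Digamma (1 - z) - Digamma z') =
       (Digamma (1 - z) - Digamma z) + (Digamma (1 - z') - Digamma z')" by simp
  also have "\<dots> = of_real pi * (cot (of_real pi * z) + cot (of_real pi * z'))"
    by (simp add: Digamma_reflection zs algebra_simps)
  also have "\<dots> = of_real (2 * pi / cosh t)"
  proof -
    define a where "a = complex_of_real pi * z"
    define b where "b = complex_of_real pi * z'"
    have ab: "a + b = of_real pi / 2" "a - b = \<i> * of_real t"
      by (simp_all add: a_def b_def z_def z'_def \<tau>_def complex_eq_iff field_simps)
    have s: "sin a \<noteq> 0" "sin b \<noteq> 0"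
      using zs sin_eq_0[of a] sin_eq_0[of b] by (auto simp: mult.commute a_def b_def)
    \<comment> \<open>Since a + b = pi/2 and a - b = i t, the numerator is 1 and the product of
      sines is cosh t / 2.\<close>
    have "cot a + cot b = sin (a + b) / (sin a * sin b)"
      using s by (simp add: cot_def sin_add field_simps)
    also have "sin a * sin b = (cos (a - b) - cos (a + b)) / 2"
      by (simp add: cos_diff cos_add)
    also have "cos (a - b) = of_real (cosh t)" unfolding ab
      by (simp add: complex_eq_iff Re_cos Im_cos cosh_def)
    also have "cos (a + b) = 0" unfolding ab by simp
    also have "sin (a + b) = 1" unfolding ab by simp
    finally have "cot a + cot b = of_real (2 / cosh t)" by simp
    thus ?thesis unfolding a_def b_def by simp
  qed
  finally have "(\<lambda>k. (inverse (z + of_nat k) - inverse ((1 - z') + of_nat k)) + (inverse (z' + of_nat k) - inverse ((1 - z) + of_nat k)))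
     sums of_real (2 * pi / cosh t)" .
  hence "(\<lambda>k. Re ((inverse (z + of_nat k) - inverse ((1 - z') + of_nat k)) + (inverse (z' + of_nat k) - inverse ((1 - z) + of_nat k))) / (4 * pi))
     sums (2 * pi / cosh t / (4 * pi))"
    by (intro sums_divide) (auto simp: sums_complex_iff)
  also have "(\<lambda>k. Re ((inverse (z + of_nat k) - inverse ((1 - z') + of_nat k)) + (inverse (z' + of_nat k) - inverse ((1 - z) + of_nat k))) / (4 * pi))
    = (\<lambda>j. A (2*j) / (t\<^sup>2 + (A (2*j))\<^sup>2) - A (2*j+1) / (t\<^sup>2 + (A (2*j+1))\<^sup>2))"
  proof
    fix k :: nat
    have inv: "Re (inverse (Complex c y + of_nat k)) = (c + real k) / ((c + real k)\<^sup>2 + y\<^sup>2)" for c y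
      by (simp add: complex_eq_iff)
    have sc: "(c + real k) / ((c + real k)\<^sup>2 + \<tau>\<^sup>2) / (2 * pi) = (2 * pi * (c + real k)) / (t\<^sup>2 + (2 * pi * (c + real k))\<^sup>2)" for c
    proof -
      have *: "t\<^sup>2 + (2 * pi * (c + real k))\<^sup>2 = (2 * pi)\<^sup>2 * ((c + real k)\<^sup>2 + \<tau>\<^sup>2)"
        by (simp add: \<tau>_def field_simps power2_eq_square)
      have "2 * pi * x / ((2 * pi)\<^sup>2 * D) = x / D / (2 * pi)" for x D :: real
        by (cases "D = 0") (simp_all add: power2_eq_square field_simps)
      from this[of "c + real k" "(c + real k)\<^sup>2 + \<tau>\<^sup>2"] show ?thesis unfolding * ..
    qed
    have A: "A (2*k) = 2 * pi * (1/4 + real k)" "A (2*k+1) = 2 * pi * (3/4 + real k)"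
      by (simp_all add: A_def field_simps)
    show "Re ((inverse (z + of_nat k) - inverse ((1 - z') + of_nat k)) + (inverse (z' + of_nat k) - inverse ((1 - z) + of_nat k))) / (4 * pi)
     = A (2*k) / (t\<^sup>2 + (A (2*k))\<^sup>2) - A (2*k+1) / (t\<^sup>2 + (A (2*k+1))\<^sup>2)"
    proof -
      have alg: "((P - Q) + (P - Q)) / (4 * pi) = P / (2 * pi) - Q / (2 * pi)" for P Q
        by (simp add: field_simps)
      show ?thesis
        unfolding one unfolding z_def z'_def plus_complex.simps(1) minus_complex.simps(1) inv A sc[symmetric] power2_minus
        by (rule alg)
    qed
  qed
  also have "2 * pi / cosh t / (4 * pi) = 1 / (2 * cosh t)" by simp
  finally show ?thesis .
qed

section \<open>Gamma and Beta integrals, and the Mellin transform of 1 / (2 cosh t)\<close>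

lemma has_bochner_integral_Gamma:
  fixes s a :: real
  assumes "s > 0" "a > 0"
  shows "has_bochner_integral lborel (\<lambda>t. indicator {0<..} t * (t powr (s-1) * exp (-a*t))) (Gamma s * a powr (-s))"
proof (rule has_bochner_integral_nn_integral)
  have eq: "(\<integral>\<^sup>+t. ennreal (indicator {0..} t * t powr (s - 1) / exp t) \<partial>lborel) = ennreal (Gamma s)"
    using Gamma_conv_nn_integral_real[OF assms(1)] by simp
  have "ennreal (Gamma s) = ennreal a * (\<integral>\<^sup>+t. ennreal (indicator {0..} (0 + a*t) * (0 + a*t) powr (s - 1) / exp (0 + a*t)) \<partial>lborel)"
    unfolding eq[symmetric] using assms by (subst nn_integral_real_affine[where c = a and t = 0]) auto
  also have "\<dots> = ennreal a * (\<integral>\<^sup>+t. ennreal (a powr (s-1)) * ennreal (indicator {0<..} t * (t powr (s-1) * exp (-a*t))) \<partial>lborel)"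
  proof (intro arg_cong[where f = "(*) (ennreal a)"] nn_integral_cong, goal_cases)
    case (1 t)
    show ?case
    proof (cases "t > 0")
      case True
      thus ?thesis using assms
        by (subst ennreal_mult [symmetric]) (auto simp: powr_mult exp_minus field_simps)
    next
      case False
      thus ?thesis using assms by (cases "t = 0") (auto simp: indicator_def zero_le_mult_iff)
    qed
  qed
  also have "\<dots> = ennreal (a powr s) * (\<integral>\<^sup>+t. ennreal (indicator {0<..} t * (t powr (s-1) * exp (-a*t))) \<partial>lborel)"
    using assms by (subst nn_integral_cmult) (auto simp flip: mult.assoc ennreal_mult simp: powr_diff)
  finally have *: "ennreal (Gamma s) = ennreal (a powr s) * (\<integral>\<^sup>+t. ennreal (indicator {0<..} t * (t powr (s-1) * exp (-a*t))) \<partial>lborel)" .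
  have "ennreal (Gamma s * a powr (-s)) = ennreal (a powr (-s)) * ennreal (Gamma s)"
    using assms by (subst ennreal_mult [symmetric]) (auto simp: mult.commute)
  also have "\<dots> = (\<integral>\<^sup>+t. ennreal (indicator {0<..} t * (t powr (s-1) * exp (-a*t))) \<partial>lborel)"
    unfolding * using assms by (simp flip: mult.assoc ennreal_mult powr_add)
  finally show "(\<integral>\<^sup>+t. ennreal (indicator {0<..} t * (t powr (s-1) * exp (-a*t))) \<partial>lborel) = ennreal (Gamma s * a powr (-s))" ..
qed (use assms in \<open>auto simp: indicator_def\<close>)

text \<open>Tonelli for the nonnegative function exp(-u) v^(w-1) exp(-u v): integrating over v first
  gives Gamma(w) u^(-w), over u first gives v^(w-1) / (1 + v).\<close>

lemma has_bochner_integral_Gamma_reflection: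
  fixes w :: real
  assumes "0 < w" "w < 1"
  shows "has_bochner_integral lborel (\<lambda>v. indicator {0<..} v * (v powr (w-1) / (1 + v))) (Gamma w * Gamma (1 - w))"
proof (rule has_bochner_integral_nn_integral)
  have G: "(\<integral>\<^sup>+t. ennreal (indicator {0<..} t * (t powr (s-1) * exp (-a*t))) \<partial>lborel) = ennreal (Gamma s * a powr (-s))"
    if "s > 0" "a > 0" for s a :: real
    using has_bochner_integral_Gamma[OF that] that
    by (subst nn_integral_eq_integral) (auto simp: has_bochner_integral_iff indicator_def)
  let ?F = "\<lambda>u v. ennreal (indicator {0<..} u * exp (-u)) * ennreal (indicator {0<..} v * (v powr (w-1) * exp (- u * v)))"
  have "ennreal (Gamma w * Gamma (1 - w)) = ennreal (Gamma w) * (\<integral>\<^sup>+u. ennreal (indicator {0<..} u * (u powr ((1-w)-1) * exp (-1*u))) \<partial>lborel)"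
    using assms by (subst G) (auto simp: ennreal_mult)
  also have "\<dots> = (\<integral>\<^sup>+u. ennreal (Gamma w) * ennreal (indicator {0<..} u * (u powr ((1-w)-1) * exp (-1*u))) \<partial>lborel)"
    by (subst nn_integral_cmult) auto
  also have "\<dots> = (\<integral>\<^sup>+u. \<integral>\<^sup>+v. ?F u v \<partial>lborel \<partial>lborel)"
  proof (intro nn_integral_cong, goal_cases)
    case (1 u)
    show ?case
    proof (cases "u > 0")
      case True
      have "(\<integral>\<^sup>+v. ?F u v \<partial>lborel) = ennreal (exp (-u)) * ennreal (Gamma w * u powr (-w))"
        using True assms G[of w u] by (subst nn_integral_cmult) auto
      thus ?thesis using True assms
        by (auto simp: ennreal_mult [symmetric] mult_ac)
    qed auto
  qed
  also have "\<dots> = (\<integral>\<^sup>+v. \<integral>\<^sup>+u. ?F u v \<partial>lborel \<partial>lborel)"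
    by (rule lborel_pair.Fubini') measurable
  also have "\<dots> = (\<integral>\<^sup>+v. ennreal (indicator {0<..} v * (v powr (w-1) / (1 + v))) \<partial>lborel)"
  proof (intro nn_integral_cong, goal_cases)
    case (1 v)
    show ?case
    proof (cases "v > 0")
      case True
      have "(\<integral>\<^sup>+u. ?F u v \<partial>lborel) = (\<integral>\<^sup>+u. ennreal (v powr (w-1)) * ennreal (indicator {0<..} u * (u powr (1-1) * exp (-(1+v)*u))) \<partial>lborel)"
        using True by (intro nn_integral_cong)
          (auto simp: ennreal_mult [symmetric] indicator_def mult_ac exp_add [symmetric] algebra_simps)
      also have "\<dots> = ennreal (v powr (w-1)) * ennreal (Gamma 1 * (1 + v) powr (-1))"
        using True by (subst nn_integral_cmult, simp, subst G) auto
      also have "\<dots> = ennreal (indicator {0<..} v * (v powr (w-1) / (1 + v)))"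
        using True by (subst ennreal_mult [symmetric]) (auto simp: powr_minus field_simps)
      finally show ?thesis .
    qed auto
  qed
  finally show "(\<integral>\<^sup>+v. ennreal (indicator {0<..} v * (v powr (w-1) / (1 + v))) \<partial>lborel) = ennreal (Gamma w * Gamma (1 - w))" ..
qed (use assms in \<open>auto simp: indicator_def\<close>)

lemma has_bochner_integral_Beta_half:
  fixes s :: real
  assumes "0 < s" "s < 2"
  shows "has_bochner_integral lborel (\<lambda>t. indicator {0<..} t * (t powr (s-1) / (t\<^sup>2 + 1)))
           (Gamma (s/2) * Gamma (1 - s/2) / 2)"
proof -
  let ?f = "\<lambda>v::real. v powr (s/2-1) / (1 + v)"
  let ?S = "{0<..} :: real set"
  \<comment> \<open>The substitution v = t^2 is carried out with the change-of-variables theorem for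
    absolute integrability on sets; this equivalence translates from and to Bochner integrals over
    \<open>lborel\<close>.\<close>
  have conv: "has_bochner_integral lborel (\<lambda>t. indicator ?S t * f t) b \<longleftrightarrow>
     (f absolutely_integrable_on ?S \<and> integral ?S f = b)"
    if [measurable]: "f \<in> borel_measurable borel" for f :: "real \<Rightarrow> real" and b
  proof -
    have m: "(\<lambda>t. indicator ?S t *\<^sub>R f t) \<in> borel_measurable lborel" by measurable
    have "f absolutely_integrable_on ?S \<longleftrightarrow> integrable lborel (\<lambda>t. indicator ?S t *\<^sub>R f t)"
      unfolding set_integrable_def using integrable_completion[OF m] by simp
    moreover have "integral ?S f = (\<integral>t. indicator ?S t *\<^sub>R f t \<partial>lborel)"
      if "f absolutely_integrable_on ?S"
      using set_lebesgue_integral_eq_integral(2)[OF that] integral_completion[OF m]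
      unfolding set_lebesgue_integral_def by simp
    ultimately show ?thesis by (auto simp: has_bochner_integral_iff)
  qed
  have "?f absolutely_integrable_on ?S \<and> integral ?S ?f = Gamma (s/2) * Gamma (1 - s/2)"
    using has_bochner_integral_Gamma_reflection[of "s/2"] assms by (subst conv [symmetric]) auto
  moreover have img: "(\<lambda>t::real. t\<^sup>2) ` ?S = ?S"
  proof (intro equalityI subsetI)
    fix y :: real assume "y \<in> ?S"
    thus "y \<in> (\<lambda>t. t\<^sup>2) ` ?S" by (intro image_eqI[of _ _ "sqrt y"]) auto
  qed auto
  moreover have "(\<lambda>t. \<bar>2 * t\<bar> * ?f (t\<^sup>2)) absolutely_integrable_on ?S \<and>
       integral ?S (\<lambda>t. \<bar>2 * t\<bar> * ?f (t\<^sup>2)) = Gamma (s/2) * Gamma (1 - s/2) \<longleftrightarrow>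
       ?f absolutely_integrable_on (\<lambda>t. t\<^sup>2) ` ?S \<and> integral ((\<lambda>t. t\<^sup>2) ` ?S) ?f = Gamma (s/2) * Gamma (1 - s/2)"
    by (rule has_absolute_integral_change_of_variables_1')
       (auto intro!: derivative_eq_intros inj_onI simp: power2_eq_iff_nonneg)
  ultimately have "(\<lambda>t. \<bar>2 * t\<bar> * ?f (t\<^sup>2)) absolutely_integrable_on ?S \<and>
       integral ?S (\<lambda>t. \<bar>2 * t\<bar> * ?f (t\<^sup>2)) = Gamma (s/2) * Gamma (1 - s/2)" by simp
  hence "has_bochner_integral lborel (\<lambda>t. indicator ?S t * (\<bar>2 * t\<bar> * ?f (t\<^sup>2))) (Gamma (s/2) * Gamma (1 - s/2))"
    by (subst conv) auto
  from has_bochner_integral_divide_zero[OF this, of 2]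
  have "has_bochner_integral lborel (\<lambda>t. indicator ?S t * (\<bar>2 * t\<bar> * ?f (t\<^sup>2)) / 2) (Gamma (s/2) * Gamma (1 - s/2) / 2)" .
  also have "(\<lambda>t. indicator ?S t * (\<bar>2 * t\<bar> * ?f (t\<^sup>2)) / 2) = (\<lambda>t. indicator {0<..} t * (t powr (s-1) / (t\<^sup>2 + 1)))"
  proof
    fix t :: real
    have p: "t * (t\<^sup>2) powr (s/2-1) = t powr (s-1)" if "t > 0"
    proof -
      have "(t\<^sup>2) powr (s/2-1) = t powr (s-2)"
        using that by (simp add: powr_powr flip: powr_numeral)
      hence "t * (t\<^sup>2) powr (s/2-1) = t powr 1 * t powr (s-2)" using that by simp
      also have "\<dots> = t powr (s-1)" by (subst powr_add [symmetric]) simp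
      finally show ?thesis .
    qed
    show "indicator ?S t * (\<bar>2 * t\<bar> * ?f (t\<^sup>2)) / 2 = indicator {0<..} t * (t powr (s-1) / (t\<^sup>2 + 1))"
    proof (cases "t > 0")
      case True
      hence "indicator ?S t * (\<bar>2 * t\<bar> * ?f (t\<^sup>2)) / 2 = 2 * (t * (t\<^sup>2) powr (s/2-1) / (1 + t\<^sup>2)) / 2"
        by (simp del: mult_divide_mult_cancel_left_if)
      also have "\<dots> = t * (t\<^sup>2) powr (s/2-1) / (1 + t\<^sup>2)" by (rule nonzero_mult_div_cancel_left) simp
      also note p[OF True]
      finally show ?thesis using True by (simp add: add.commute)
    qed simp
  qed
  finally show ?thesis .
qed

lemma has_bochner_integral_Beta_scaled:
  fixes s a :: real
  assumes "0 < s" "s < 2" "a > 0"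
  shows "has_bochner_integral lborel (\<lambda>t. indicator {0<..} t * (t powr (s-1) / (t\<^sup>2 + a\<^sup>2)))
           (Gamma (s/2) * Gamma (1 - s/2) / 2 * a powr (s - 2))"
proof -
  have "has_bochner_integral lborel (\<lambda>t. indicator {0<..} (0 + (1/a) * t) * ((0 + (1/a) * t) powr (s-1) / ((0 + (1/a) * t)\<^sup>2 + 1)))
     (Gamma (s/2) * Gamma (1 - s/2) / 2 /\<^sub>R \<bar>1/a\<bar>)"
    using has_bochner_integral_Beta_half[OF assms(1,2)] assms
    by (subst lborel_has_bochner_integral_real_affine_iff[symmetric, of "1/a"]) auto
  from has_bochner_integral_mult_right[OF this, of "a powr (s-3)"]
  have "has_bochner_integral lborel (\<lambda>t. a powr (s-3) * (indicator {0<..} (0 + (1/a) * t) * ((0 + (1/a) * t) powr (s-1) / ((0 + (1/a) * t)\<^sup>2 + 1))))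
     (a powr (s-3) * (Gamma (s/2) * Gamma (1 - s/2) / 2 /\<^sub>R \<bar>1/a\<bar>))" by simp
  also have "(\<lambda>t. a powr (s-3) * (indicator {0<..} (0 + (1/a) * t) * ((0 + (1/a) * t) powr (s-1) / ((0 + (1/a) * t)\<^sup>2 + 1)))) =
     (\<lambda>t. indicator {0<..} t * (t powr (s-1) / (t\<^sup>2 + a\<^sup>2)))"
  proof
    fix t :: real
    show "a powr (s-3) * (indicator {0<..} (0 + (1/a) * t) * ((0 + (1/a) * t) powr (s-1) / ((0 + (1/a) * t)\<^sup>2 + 1))) =
      indicator {0<..} t * (t powr (s-1) / (t\<^sup>2 + a\<^sup>2))"
    proof (cases "t > 0")
      case True
      have "a powr (s-3) = a powr (s-1) / a\<^sup>2"
        using powr_diff[of a "s-1" 2] assms by simp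
      moreover have "(0 + (1/a) * t) powr (s-1) = t powr (s-1) / a powr (s-1)"
        using True assms by (simp add: powr_divide)
      moreover have "(0 + (1/a) * t)\<^sup>2 + 1 = (t\<^sup>2 + a\<^sup>2) / a\<^sup>2"
        using assms by (simp add: power_divide add_divide_distrib)
      moreover have "A / B * (T / A / (D / B)) = T / D" if "A \<noteq> 0" "B \<noteq> 0" for A B T D :: real
        using that by simp
      moreover have "a powr (s-1) \<noteq> 0" "a\<^sup>2 \<noteq> 0" using assms by auto
      moreover have "0 + (1/a) * t > 0" using True assms by simp
      ultimately show ?thesis using True by simp
    next
      case False
      thus ?thesis using assms by (auto simp: indicator_def zero_less_divide_iff)
    qed
  qed
  also have "a powr (s-3) * (Gamma (s/2) * Gamma (1 - s/2) / 2 /\<^sub>R \<bar>1/a\<bar>) = Gamma (s/2) * Gamma (1 - s/2) / 2 * a powr (s - 2)"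
  proof -
    have "a powr (s-2) = a powr ((s-3) + 1)" by simp
    also have "\<dots> = a powr (s-3) * a" using assms by (subst powr_add) auto
    finally show ?thesis using assms by simp
  qed
  finally show ?thesis .
qed

text \<open>
  The functional equation comes from evaluating the Mellin transform of \<open>1 / (2 cosh t)\<close> twice:
  with the geometric series in \<open>exp (-t)\<close> and with the partial fraction expansion.
\<close>
lemma Mellin_sech_series:
  fixes s :: real
  assumes s: "0 < s"
  shows "(\<lambda>j. Gamma s * (real (4*j+1) powr (-s) - real (4*j+3) powr (-s))) sums
           (\<integral>t. indicator {0<..} t * (t powr (s-1) / (2 * cosh t)) \<partial>lborel)"
proof -
  let ?f = "\<lambda>j t. indicator {0<..} t * (t powr (s-1) * exp (-real (4*j+1)*t)) - indicator {0<..} t * (t powr (s-1) * exp (-real (4*j+3)*t))"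
  have hb: "has_bochner_integral lborel (?f j) (Gamma s * (real (4*j+1) powr (-s) - real (4*j+3) powr (-s)))" for j
    using has_bochner_integral_diff[OF has_bochner_integral_Gamma[OF s, of "real (4*j+1)"] has_bochner_integral_Gamma[OF s, of "real (4*j+3)"]]
    by (simp add: algebra_simps)
  have nonneg: "?f j t \<ge> 0" for j t
    by (auto simp: indicator_def intro!: mult_left_mono)
  have pt: "(\<lambda>j. ?f j t) sums (indicator {0<..} t * (t powr (s-1) / (2 * cosh t)))" for t :: real
  proof (cases "t > 0")
    case True
    define r where "r = exp (-t)"
    have r: "0 < r" "r < 1" using True by (auto simp: r_def)
    have "r ^ 4 < 1" using r by (simp add: power_less_one_iff)
    hence "(\<lambda>j. (r - r ^ 3) * (r ^ 4) ^ j) sums ((r - r ^ 3) * (1 / (1 - r ^ 4)))"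
      using r by (intro sums_mult geometric_sums) auto
    hence "(\<lambda>j. t powr (s-1) * ((r - r ^ 3) * (r ^ 4) ^ j)) sums (t powr (s-1) * ((r - r ^ 3) * (1 / (1 - r ^ 4))))"
      by (rule sums_mult)
    also have "(\<lambda>j. t powr (s-1) * ((r - r ^ 3) * (r ^ 4) ^ j)) = (\<lambda>j. ?f j t)"
    proof
      fix j
      have "exp (- real k * t) = r ^ k" for k
        by (simp add: r_def exp_of_nat_mult [symmetric])
      from this[of "4*j+1"] this[of "4*j+3"]
      show "t powr (s-1) * ((r - r ^ 3) * (r ^ 4) ^ j) = ?f j t"
        using True by (simp add: algebra_simps power_add flip: power_mult)
    qed
    also have "(r - r ^ 3) * (1 / (1 - r ^ 4)) = 1 / (2 * cosh t)"
    proof -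
      have "1 - r ^ 4 = (1 - r\<^sup>2) * (1 + r\<^sup>2)" "r - r ^ 3 = (1 - r\<^sup>2) * r" by (simp_all add: algebra_simps power_numeral_reduce)
      moreover have "1 - r\<^sup>2 \<noteq> 0" using r by (simp add: power2_eq_1_iff)
      ultimately have "(r - r ^ 3) * (1 / (1 - r ^ 4)) = r / (1 + r\<^sup>2)" by simp
      also have "2 * cosh t = (1 + r\<^sup>2) / r"
        using r by (simp add: cosh_def r_def exp_minus field_simps power2_eq_square)
      hence "r / (1 + r\<^sup>2) = 1 / (2 * cosh t)" by simp
      finally show ?thesis .
    qed
    finally show ?thesis using True by simp
  qed simp
  have Lsum: "summable (\<lambda>j. Gamma s * (real (4*j+1) powr (-s) - real (4*j+3) powr (-s)))"
    by (rule summable_mult[OF sums_summable[OF L4_of_real_sums(1)[OF s]]])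
  have "(\<lambda>j. integral\<^sup>L lborel (?f j)) sums (\<integral>t. (\<Sum>j. ?f j t) \<partial>lborel)"
  proof (rule sums_integral)
    show "integrable lborel (?f j)" for j using hb[of j] by (simp add: has_bochner_integral_iff)
    show "AE t in lborel. summable (\<lambda>j. norm (?f j t))"
      using pt nonneg by (auto simp: abs_of_nonneg summable_def)
    have n: "(\<lambda>t. norm (?f j t)) = ?f j" for j
      by (rule ext) (simp only: real_norm_def abs_of_nonneg nonneg)
    have "(\<integral>t. norm (?f j t) \<partial>lborel) = Gamma s * (real (4*j+1) powr (-s) - real (4*j+3) powr (-s))" for j
      using hb[of j] unfolding n has_bochner_integral_iff by blast
    thus "summable (\<lambda>j. \<integral>t. norm (?f j t) \<partial>lborel)" using Lsum by simp
  qed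
  moreover have "integral\<^sup>L lborel (?f j) = Gamma s * (real (4*j+1) powr (-s) - real (4*j+3) powr (-s))" for j
    by (rule has_bochner_integral_integral_eq[OF hb])
  moreover have "(\<Sum>j. ?f j t) = indicator {0<..} t * (t powr (s-1) / (2 * cosh t))" for t
    using pt[of t] by (simp add: sums_iff)
  ultimately show ?thesis by simp
qed

text \<open>Integrating the partial fractions one by one gives multiples of A^(s-1), whose sum
  diverges. Consecutive fractions are therefore kept together: their difference is at most pi / (t^2
  + A^2), with integral a multiple of A^(s-2), summable because s < 1.\<close>

lemma Mellin_sech_partial_fractions:
  fixes s :: real
  assumes s: "0 < s" "s < 1"
  defines "A \<equiv> \<lambda>k::nat. (2 * real k + 1) * pi / 2"
  defines "K \<equiv> Gamma (s/2) * Gamma (1 - s/2) / 2"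
  shows "(\<lambda>j. K * (A (2*j) powr (s-1) - A (2*j+1) powr (s-1))) sums
           (\<integral>t. indicator {0<..} t * (t powr (s-1) / (2 * cosh t)) \<partial>lborel)"
proof -
  have Apos: "A k > 0" for k by (simp add: A_def)
  let ?g = "\<lambda>k t. indicator {0<..} t * (t powr (s-1) / (t\<^sup>2 + (A k)\<^sup>2))"
  let ?f = "\<lambda>j t. A (2*j) * ?g (2*j) t - A (2*j+1) * ?g (2*j+1) t"
  have hg: "has_bochner_integral lborel (?g k) (K * A k powr (s-2))" for k
    unfolding K_def using s Apos by (intro has_bochner_integral_Beta_scaled) auto
  have pw: "A k * (K * A k powr (s-2)) = K * A k powr (s-1)" for k
  proof -
    have "A k * A k powr (s-2) = A k powr 1 * A k powr (s-2)" using Apos[of k] by simp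
    also have "\<dots> = A k powr (s-1)" by (subst powr_add [symmetric]) simp
    finally show ?thesis by (simp add: mult_ac)
  qed
  have hb: "has_bochner_integral lborel (?f j) (K * (A (2*j) powr (s-1) - A (2*j+1) powr (s-1)))" for j
  proof -
    have "has_bochner_integral lborel (?f j) (A (2*j) * (K * A (2*j) powr (s-2)) - A (2*j+1) * (K * A (2*j+1) powr (s-2)))"
      by (intro has_bochner_integral_diff has_bochner_integral_mult_right hg)
    thus ?thesis unfolding pw by (simp add: algebra_simps)
  qed
  have feq: "?f j t = indicator {0<..} t * t powr (s-1) * (A (2*j) / (t\<^sup>2 + (A (2*j))\<^sup>2) - A (2*j+1) / (t\<^sup>2 + (A (2*j+1))\<^sup>2))" for j t
    by (simp add: algebra_simps)
  have pt: "(\<lambda>j. ?f j t) sums (indicator {0<..} t * t powr (s-1) * (1 / (2 * cosh t)))" for t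
    using sums_mult[OF sech_partial_fractions[of t], of "indicator {0<..} t * t powr (s-1)"]
    unfolding feq unfolding A_def .
  have bound: "norm (?f j t) \<le> pi * ?g (2*j) t" for j t
  proof -
    let ?a = "A (2*j)" and ?b = "A (2*j+1)"
    have ab: "?b = ?a + pi" by (simp add: A_def field_simps)
    have pos: "t\<^sup>2 + ?a\<^sup>2 > 0" "t\<^sup>2 + ?b\<^sup>2 > 0" using Apos[of "2*j"] Apos[of "2*j+1"] by (auto intro!: add_nonneg_pos)
    \<comment> \<open>Consecutive poles differ by pi, so the common numerator is pi (a b - t^2); it
      is at most pi (t^2 + b^2) in size, which cancels one denominator.\<close>
    have "?a / (t\<^sup>2 + ?a\<^sup>2) - ?b / (t\<^sup>2 + ?b\<^sup>2) = pi * (?a * ?b - t\<^sup>2) / ((t\<^sup>2 + ?a\<^sup>2) * (t\<^sup>2 + ?b\<^sup>2))"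
    proof -
      have "?a / (t\<^sup>2 + ?a\<^sup>2) - ?b / (t\<^sup>2 + ?b\<^sup>2) =
          (?a * (t\<^sup>2 + ?b\<^sup>2) - ?b * (t\<^sup>2 + ?a\<^sup>2)) / ((t\<^sup>2 + ?a\<^sup>2) * (t\<^sup>2 + ?b\<^sup>2))"
        using pos by (intro diff_frac_eq) auto
      also have "?a * (t\<^sup>2 + ?b\<^sup>2) - ?b * (t\<^sup>2 + ?a\<^sup>2) = (?b - ?a) * (?a * ?b - t\<^sup>2)"
        by (simp add: algebra_simps power2_eq_square)
      also have "?b - ?a = pi" using ab by simp
      finally show ?thesis .
    qed
    also have "\<bar>\<dots>\<bar> = pi * \<bar>?a * ?b - t\<^sup>2\<bar> / ((t\<^sup>2 + ?a\<^sup>2) * (t\<^sup>2 + ?b\<^sup>2))"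
      using pos by (simp add: abs_mult)
    also have "\<dots> \<le> pi * (t\<^sup>2 + ?b\<^sup>2) / ((t\<^sup>2 + ?a\<^sup>2) * (t\<^sup>2 + ?b\<^sup>2))"
    proof (intro divide_right_mono mult_left_mono)
      have "?a * ?b \<le> ?b * ?b" using Apos[of "2*j"] ab by (intro mult_right_mono) auto
      moreover have "?a * ?b \<ge> 0" using Apos[of "2*j"] Apos[of "2*j+1"] by simp
      ultimately show "\<bar>?a * ?b - t\<^sup>2\<bar> \<le> t\<^sup>2 + ?b\<^sup>2" using zero_le_power2[of t] unfolding power2_eq_square by linarith
    qed (use pos in auto)
    also have "\<dots> = pi / (t\<^sup>2 + ?a\<^sup>2)"
      using pos(2)[THEN less_imp_neq, THEN not_sym] by (rule nonzero_mult_divide_mult_cancel_right)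
    finally have 1: "\<bar>?a / (t\<^sup>2 + ?a\<^sup>2) - ?b / (t\<^sup>2 + ?b\<^sup>2)\<bar> \<le> pi / (t\<^sup>2 + ?a\<^sup>2)" .
    have "norm (?f j t) = indicator {0<..} t * t powr (s-1) * \<bar>?a / (t\<^sup>2 + ?a\<^sup>2) - ?b / (t\<^sup>2 + ?b\<^sup>2)\<bar>"
      unfolding feq by (simp add: abs_mult)
    also have "\<dots> \<le> indicator {0<..} t * t powr (s-1) * (pi / (t\<^sup>2 + ?a\<^sup>2))"
      by (intro mult_left_mono 1) auto
    finally show ?thesis by (simp add: mult_ac)
  qed
  have sg: "summable (\<lambda>j. A (2*j) powr (s-2))"
  proof (rule summable_comparison_test'[OF real_powr_tail(1)[of "1-s"]])
    show "1 - s > 0" using s by simp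
    fix j :: nat
    have "real (Suc j) \<le> A (2*j)"
    proof -
      have "2 * real (Suc j) \<le> (4 * real j + 1) * 3" by simp
      also have "\<dots> \<le> (4 * real j + 1) * pi" using pi_gt3 by (intro mult_left_mono) auto
      finally show ?thesis by (simp add: A_def)
    qed
    hence "A (2*j) powr (s-2) \<le> real (Suc j) powr (s-2)"
      using s by (intro powr_mono2') auto
    also have "s - 2 = -1 - (1 - s)" by simp
    finally show "norm (A (2*j) powr (s-2)) \<le> real (Suc j) powr (-1-(1-s))" by simp
  qed
  have "(\<lambda>j. integral\<^sup>L lborel (?f j)) sums (\<integral>t. (\<Sum>j. ?f j t) \<partial>lborel)"
  proof (rule sums_integral)
    show i: "integrable lborel (?f j)" for j using hb[of j] by (simp add: has_bochner_integral_iff)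
    show "AE t in lborel. summable (\<lambda>j. norm (?f j t))"
    proof (rule AE_I2)
      fix t :: real
      have "summable (\<lambda>j. 1 / (t\<^sup>2 + (A (2*j))\<^sup>2))"
      proof (rule summable_comparison_test'[OF real_powr_tail(1)[of 1]])
        fix j :: nat
        have "real (Suc j) \<le> A (2*j)"
        proof -
          have "2 * real (Suc j) \<le> (4 * real j + 1) * 3" by simp
          also have "\<dots> \<le> (4 * real j + 1) * pi" using pi_gt3 by (intro mult_left_mono) auto
          finally show ?thesis by (simp add: A_def)
        qed
        hence "(real (Suc j))\<^sup>2 \<le> (A (2*j))\<^sup>2" by (intro power_mono) auto
        hence "1 / (t\<^sup>2 + (A (2*j))\<^sup>2) \<le> 1 / (real (Suc j))\<^sup>2"
          by (intro divide_left_mono) (auto intro!: add_increasing mult_pos_pos add_nonneg_pos simp: Apos)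
        also have "\<dots> = real (Suc j) powr (-1-1)"
          by (simp add: powr_minus inverse_eq_divide powr_numeral)
        finally show "norm (1 / (t\<^sup>2 + (A (2*j))\<^sup>2)) \<le> real (Suc j) powr (-1-1)" by simp
      qed simp
      from summable_mult[OF this, of "pi * (indicator {0<..} t * t powr (s-1))"]
      have "summable (\<lambda>j. pi * ?g (2*j) t)" by (simp add: mult_ac)
      thus "summable (\<lambda>j. norm (?f j t))"
        by (rule summable_comparison_test'[where N = 0]) (use bound in auto)
    qed
    show "summable (\<lambda>j. \<integral>t. norm (?f j t) \<partial>lborel)"
    proof (rule summable_comparison_test'[where N = 0])
      show "summable (\<lambda>j. pi * K * A (2*j) powr (s-2))" by (intro summable_mult sg)
      fix j :: nat
      have "(\<integral>t. norm (?f j t) \<partial>lborel) \<le> (\<integral>t. pi * ?g (2*j) t \<partial>lborel)"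
      proof (intro integral_mono integrable_norm i bound)
        show "integrable lborel (\<lambda>t. pi * ?g (2*j) t)"
          using hg[of "2*j"] unfolding has_bochner_integral_iff by (intro integrable_mult_right) auto
      qed
      also have "\<dots> = pi * (K * A (2*j) powr (s-2))"
        using hg[of "2*j"] by (intro has_bochner_integral_integral_eq has_bochner_integral_mult_right)
      finally show "norm (\<integral>t. norm (?f j t) \<partial>lborel) \<le> pi * K * A (2*j) powr (s-2)" by (simp add: mult.assoc)
    qed
  qed
  moreover have "integral\<^sup>L lborel (?f j) = K * (A (2*j) powr (s-1) - A (2*j+1) powr (s-1))" for j
    by (rule has_bochner_integral_integral_eq[OF hb])
  moreover have "(\<Sum>j. ?f j t) = indicator {0<..} t * (t powr (s-1) / (2 * cosh t))" for t
    using pt[of t] by (simp add: sums_iff)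
  ultimately show ?thesis by simp
qed

text \<open>The completed L-function of an odd primitive character of conductor 4: the exponential
  is (4/pi)^(s/2), and the shift by 1 in the Gamma factor reflects oddness.\<close>

definition xi4 :: "complex \<Rightarrow> complex" where
  "xi4 s = exp (s / 2 * of_real (ln (4 / pi))) * Gamma ((s + 1) / 2) * L4 s"

text \<open>The poles \<open>A k\<close> are the odd multiples of pi/2, with signs alternating as in
  \<open>chi4\<close>. Hence the partial-fraction evaluation is again an \<open>L4\<close> series,
  now at 1 - s: the character is self-dual.\<close>

lemma L4_functional_equation_real:
  fixes s :: real
  assumes s: "0 < s" "s < 1"
  shows "Gamma s * Re (L4 (of_real s)) =
           Gamma (s/2) * Gamma (1 - s/2) / 2 * (pi/2) powr (s-1) * Re (L4 (of_real (1 - s)))"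
proof -
  define K where "K = Gamma (s/2) * Gamma (1 - s/2) / 2"
  define A where "A = (\<lambda>k::nat. (2 * real k + 1) * pi / 2)"
  have "(\<lambda>j. K * (A (2*j) powr (s-1) - A (2*j+1) powr (s-1))) sums
           (\<integral>t. indicator {0<..} t * (t powr (s-1) / (2 * cosh t)) \<partial>lborel)"
    using Mellin_sech_partial_fractions[OF s] unfolding A_def K_def .
  also have "(\<lambda>j. K * (A (2*j) powr (s-1) - A (2*j+1) powr (s-1))) =
      (\<lambda>j. K * (pi/2) powr (s-1) * (real (4*j+1) powr (-(1-s)) - real (4*j+3) powr (-(1-s))))"
  proof
    fix j :: nat
    have "A (2*j) = pi/2 * real (4*j+1)" "A (2*j+1) = pi/2 * real (4*j+3)"
      by (simp_all add: A_def algebra_simps)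
    thus "K * (A (2*j) powr (s-1) - A (2*j+1) powr (s-1)) =
       K * (pi/2) powr (s-1) * (real (4*j+1) powr (-(1-s)) - real (4*j+3) powr (-(1-s)))"
      by (simp only: powr_mult minus_diff_eq) (simp add: algebra_simps)
  qed
  finally have 1: "(\<lambda>j. K * (pi/2) powr (s-1) * (real (4*j+1) powr (-(1-s)) - real (4*j+3) powr (-(1-s)))) sums
     (\<integral>t. indicator {0<..} t * (t powr (s-1) / (2 * cosh t)) \<partial>lborel)" .
  have "1 - s > 0" using s by simp
  from sums_unique2[OF 1 sums_mult[OF L4_of_real_sums(1)[OF this]]]
    sums_unique2[OF Mellin_sech_series[OF s(1)] sums_mult[OF L4_of_real_sums(1)[OF s(1)]]]
  show ?thesis by (simp add: K_def)
qed

text \<open>Legendre duplication splits Gamma(s) into Gamma(s/2) Gamma((s+1)/2); the factor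
  Gamma(s/2) cancels against the other side, and powers of 2 and pi remain to be matched.\<close>

lemma xi4_reflect_real:
  fixes s :: real
  assumes s: "0 < s" "s < 1"
  shows "xi4 (of_real s) = xi4 (1 - of_real s)"
proof -
  let ?l = "\<lambda>s. Re (L4 (of_real s))"
  have xi: "xi4 (of_real s) = of_real ((4/pi) powr (s/2) * Gamma ((s+1)/2) * ?l s)" if "s > 0" for s :: real
  proof -
    have "Gamma ((complex_of_real s + 1) / 2) = of_real (Gamma ((s+1)/2))"
      by (simp flip: Gamma_complex_of_real)
    moreover have "exp (complex_of_real s / 2 * of_real (ln (4 / pi))) = of_real ((4/pi) powr (s/2))"
      by (simp add: powr_def flip: exp_of_real)
    ultimately show ?thesis
      unfolding xi4_def by (subst L4_of_real_sums(2)[OF that]) simp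
  qed
  have dup: "Gamma (s/2) * Gamma (s/2 + 1/2) = exp ((1 - s) * ln 2) * sqrt pi * Gamma s"
  proof -
    have np: "complex_of_real x \<notin> \<int>\<^sub>\<le>\<^sub>0" if "x > 0" for x
    proof
      assume "complex_of_real x \<in> \<int>\<^sub>\<le>\<^sub>0"
      then obtain n where n: "complex_of_real x = of_int n" "n \<le> 0" by (elim nonpos_Ints_cases)
      have "x = of_int n" using arg_cong[OF n(1), of Re] by simp
      thus False using that n by simp
    qed
    have "complex_of_real (s/2) \<notin> \<int>\<^sub>\<le>\<^sub>0" "complex_of_real (s/2) + 1/2 \<notin> \<int>\<^sub>\<le>\<^sub>0"
      using np[of "s/2"] np[of "s/2 + 1/2"] s by auto
    hence "Gamma (complex_of_real (s/2)) * Gamma (complex_of_real (s/2) + 1/2) =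
        exp ((1 - 2 * complex_of_real (s/2)) * of_real (ln 2)) * of_real (sqrt pi) * Gamma (2 * complex_of_real (s/2))"
      by (intro Gamma_legendre_duplication)
    also have "complex_of_real (s/2) + 1/2 = of_real (s/2 + 1/2)" by simp
    also have "2 * complex_of_real (s/2) = of_real s" by simp
    also have "exp ((1 - of_real s) * complex_of_real (ln 2)) = of_real (exp ((1 - s) * ln 2))"
      by (simp flip: exp_of_real)
    finally have "complex_of_real (Gamma (s/2) * Gamma (s/2 + 1/2)) = of_real (exp ((1 - s) * ln 2) * sqrt pi * Gamma s)"
      unfolding Gamma_complex_of_real by simp
    thus ?thesis by (simp only: of_real_eq_iff)
  qed
  have G0: "Gamma (s/2) > 0" using s by (intro Gamma_real_pos) auto
  have "Gamma (s/2) * (Gamma (s/2 + 1/2) * ?l s) = exp ((1 - s) * ln 2) * sqrt pi * (Gamma s * ?l s)"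
    using dup by (simp add: algebra_simps)
  also have "\<dots> = Gamma (s/2) * (exp ((1 - s) * ln 2) * sqrt pi * (Gamma (1 - s/2) / 2 * (pi/2) powr (s-1) * ?l (1 - s)))"
    unfolding L4_functional_equation_real[OF s] by (simp add: mult_ac)
  finally have "Gamma (s/2 + 1/2) * ?l s = exp ((1 - s) * ln 2) * sqrt pi * (Gamma (1 - s/2) / 2 * (pi/2) powr (s-1) * ?l (1 - s))"
    using G0 by simp
  hence eq: "(4/pi) powr (s/2) * (Gamma (s/2 + 1/2) * ?l s) =
     ((4/pi) powr (s/2) * exp ((1 - s) * ln 2) * sqrt pi / 2 * (pi/2) powr (s-1)) * (Gamma (1 - s/2) * ?l (1 - s))"
    by (simp add: mult_ac)
  have "(4/pi) powr (s/2) * exp ((1 - s) * ln 2) * sqrt pi / 2 * (pi/2) powr (s-1) = (4/pi) powr ((1-s)/2)"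
  proof -
    have sq: "sqrt pi = exp (ln pi / 2)" by (simp add: powr_half_sqrt [symmetric] powr_def)
    have l4: "ln 4 = 2 * ln (2::real)" using ln_realpow[of 2 2] by simp
    have two: "(1::real) / 2 = exp (- ln 2)" by (simp add: exp_minus)
    have "(4/pi) powr (s/2) * exp ((1 - s) * ln 2) * sqrt pi / 2 * (pi/2) powr (s-1) =
       (4/pi) powr (s/2) * exp ((1 - s) * ln 2) * sqrt pi * (1/2) * (pi/2) powr (s-1)" by simp
    also have "\<dots> = exp (s/2 * ln (4/pi) + (1-s) * ln 2 + ln pi / 2 + (- ln 2) + (s-1) * ln (pi/2))"
    proof -
      have "(4/pi) powr (s/2) = exp (s/2 * ln (4/pi))" "(pi/2) powr (s-1) = exp ((s-1) * ln (pi/2))"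
        by (simp_all add: powr_def)
      thus ?thesis unfolding sq two by (simp only: exp_add)
    qed
    also have "s/2 * ln (4/pi) + (1-s) * ln 2 + ln pi / 2 + (- ln 2) + (s-1) * ln (pi/2) = (1-s)/2 * ln (4/pi)"
      by (simp add: ln_div l4 field_simps)
    finally show ?thesis by (simp add: powr_def)
  qed
  note eq [unfolded this]
  moreover have "(s+1)/2 = s/2 + 1/2" "(1-s+1)/2 = 1 - s/2" by (simp_all add: field_simps)
  ultimately have "(4/pi) powr (s/2) * Gamma ((s+1)/2) * ?l s = (4/pi) powr ((1-s)/2) * Gamma ((1-s+1)/2) * ?l (1-s)"
    by (simp only: mult.assoc)
  moreover have "1 - complex_of_real s = of_real (1 - s)" by simp
  ultimately show ?thesis using s xi[of s] xi[of "1 - s"] by (simp only:)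
qed

lemma half_nonpos_Ints: "Re s > 0 \<Longrightarrow> (s + 1) / 2 \<notin> \<int>\<^sub>\<le>\<^sub>0"
  by (auto elim!: nonpos_Ints_cases simp: complex_eq_iff)

lemma xi4_holomorphic: "xi4 holomorphic_on {s. Re s > 0}"
  unfolding xi4_def [abs_def]
  by (intro holomorphic_intros L4_holomorphic) (use half_nonpos_Ints in auto)

text \<open>The Mellin argument covers real s in (0, 1); the identity theorem extends the result to
  the strip.\<close>

lemma xi4_reflect:
  assumes "0 < Re s" "Re s < 1"
  shows "xi4 s = xi4 (1 - s)"
proof -
  let ?S = "{s. Re s > 0} \<inter> {s. Re s < 1}"
  have op: "open ?S" by (intro open_Int open_halfspace_Re_gt open_halfspace_Re_lt)
  have con: "connected ?S" by (intro convex_connected convex_Int convex_halfspace_Re_gt convex_halfspace_Re_lt)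
  have hol: "(\<lambda>s. xi4 s - xi4 (1 - s)) holomorphic_on ?S"
  proof (intro holomorphic_on_diff)
    show "xi4 holomorphic_on ?S" by (rule holomorphic_on_subset[OF xi4_holomorphic]) auto
    have "(xi4 \<circ> (\<lambda>s. 1 - s)) holomorphic_on ?S"
      by (rule holomorphic_on_compose_gen[OF _ xi4_holomorphic]) (auto intro!: holomorphic_intros)
    thus "(\<lambda>s. xi4 (1 - s)) holomorphic_on ?S" by (simp add: o_def)
  qed
  have "(\<lambda>s. xi4 s - xi4 (1 - s)) s = 0"
  proof (rule analytic_continuation[OF hol op con, where U = "of_real ` {0<..<1}" and \<xi> = "1/2"])
    show "(1/2) islimpt (complex_of_real ` {0<..<1})"
    proof (subst islimpt_approachable, intro allI impI)
      fix e :: real assume "e > 0"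
      define d where "d = min (e/2) (1/4)"
      have "d > 0" "d < e" "d < 1/2" using \<open>e > 0\<close> by (auto simp: d_def)
      thus "\<exists>x'\<in>complex_of_real ` {0<..<1}. x' \<noteq> 1/2 \<and> dist x' (1/2) < e"
        by (intro bexI[of _ "of_real (1/2 + d)"]) (auto simp: dist_norm intro!: image_eqI[of _ _ "1/2 + d"])
    qed
  qed (use assms xi4_reflect_real in auto)
  thus ?thesis by simp
qed

section \<open>The completed L-function and its zeros\<close>

text \<open>Writing f as g (w - z)^n with g nonvanishing, f'/f has a simple pole of residue n. The
  approach is horizontal from the right because the zeros of interest lie on the imaginary axis and
  the Dirichlet series live to its right.\<close>

lemma logderiv_residue_limit:
  fixes f :: "complex \<Rightarrow> complex"
  assumes hol: "f holomorphic_on UNIV" and nz: "\<exists>w. f w \<noteq> 0"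
  shows "((\<lambda>x. of_real x * (deriv f (z + of_real x) / f (z + of_real x))) \<longlongrightarrow> of_int (zorder f z)) (at_right 0)"
    and "zorder f z \<ge> 0" and "f z = 0 \<Longrightarrow> zorder f z > 0"
proof -
  define n where "n = zorder f z"
  define g where "g = zor_poly f z"
  have *: "(if f z = 0 then n > 0 else n = 0) \<and> (\<exists>r. r > 0 \<and> cball z r \<subseteq> UNIV \<and> g holomorphic_on cball z r
    \<and> (\<forall>w\<in>cball z r. f w = g w * (w - z) ^ nat n \<and> g w \<noteq> 0))"
    unfolding n_def g_def by (rule zorder_exist_zero[OF hol]) (use nz in auto)
  from * show "zorder f z \<ge> 0" "f z = 0 \<Longrightarrow> zorder f z > 0" by (auto simp: n_def split: if_splits)
  from * obtain r where r: "r > 0" "g holomorphic_on cball z r"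
    and fg: "\<And>w. w \<in> cball z r \<Longrightarrow> f w = g w * (w - z) ^ nat n" "\<And>w. w \<in> cball z r \<Longrightarrow> g w \<noteq> 0" by blast
  have n0: "n \<ge> 0" using * by (auto split: if_splits)
  have gb: "g holomorphic_on ball z r" by (rule holomorphic_on_subset[OF r(2)]) auto
  have ld: "deriv f w / f w = of_int n / (w - z) + deriv g w / g w" if w: "w \<in> ball z r" "w \<noteq> z" for w
  proof -
    have gd: "(g has_field_derivative deriv g w) (at w)"
      using holomorphic_derivI[OF gb _ w(1)] by simp
    have "((\<lambda>w. g w * (w - z) ^ nat n) has_field_derivative
        (deriv g w * (w - z) ^ nat n + of_nat (nat n) * (w - z) ^ (nat n - 1) * g w)) (at w)"
      by (auto intro!: derivative_eq_intros gd)
    hence "(f has_field_derivative (deriv g w * (w - z) ^ nat n + of_nat (nat n) * (w - z) ^ (nat n - 1) * g w)) (at w)"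
      by (rule has_field_derivative_transform_within_open[of _ _ _ "ball z r"]) (use w fg in auto)
    hence "deriv f w = deriv g w * (w - z) ^ nat n + of_nat (nat n) * (w - z) ^ (nat n - 1) * g w"
      by (rule DERIV_imp_deriv)
    moreover have "of_nat (nat n) * (w - z) ^ (nat n - 1) = of_int n / (w - z) * (w - z) ^ nat n"
    proof (cases "nat n")
      case (Suc m)
      hence "n = 1 + int m" using n0 by linarith
      thus ?thesis using Suc w by (simp add: field_simps)
    qed (use n0 in auto)
    moreover have "f w = g w * (w - z) ^ nat n" "g w \<noteq> 0" using fg[of w] w by auto
    moreover have "d * A + q * A * G = (q + d / G) * (G * A)" if "G \<noteq> 0" for d A q G :: complex
      using that by (simp add: field_simps)
    ultimately have "deriv f w = (of_int n / (w - z) + deriv g w / g w) * f w" by (simp only:)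
    moreover have "f w \<noteq> 0" using \<open>f w = _\<close> \<open>g w \<noteq> 0\<close> w by simp
    ultimately show ?thesis by simp
  qed
  have cont: "continuous_on (ball z r) (\<lambda>w. deriv g w / g w)"
    using fg(2) gb by (intro holomorphic_on_imp_continuous_on holomorphic_on_divide holomorphic_deriv) auto
  have "isCont (\<lambda>w. deriv g w / g w) z"
    using cont r by (simp add: continuous_on_eq_continuous_at)
  moreover have "((\<lambda>x. z + complex_of_real x) \<longlongrightarrow> z) (at_right 0)"
    by (rule tendsto_eq_intros refl | simp)+
  ultimately have "((\<lambda>x. deriv g (z + of_real x) / g (z + of_real x)) \<longlongrightarrow> deriv g z / g z) (at_right 0)"
    by (rule isCont_tendsto_compose)
  hence "((\<lambda>x. of_int n + of_real x * (deriv g (z + of_real x) / g (z + of_real x))) \<longlongrightarrow> of_int n + of_real 0 * (deriv g z / g z)) (at_right 0)"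
    by (intro tendsto_add tendsto_const tendsto_mult tendsto_of_real tendsto_ident_at)
  hence lim: "((\<lambda>x. of_int n + of_real x * (deriv g (z + of_real x) / g (z + of_real x))) \<longlongrightarrow> of_int n) (at_right 0)"
    by simp
  have ev: "eventually (\<lambda>x. of_real x * (deriv f (z + of_real x) / f (z + of_real x)) = of_int n + of_real x * (deriv g (z + of_real x) / g (z + of_real x))) (at_right 0)"
    using eventually_at_right_real[OF r(1)]
  proof eventually_elim
    case (elim x)
    hence "deriv f (z + of_real x) / f (z + of_real x) = of_int n / (z + of_real x - z) + deriv g (z + of_real x) / g (z + of_real x)"
      by (intro ld) (auto simp: dist_norm)
    thus ?case using elim by (simp add: distrib_left)
  qed
  show "((\<lambda>x. of_real x * (deriv f (z + of_real x) / f (z + of_real x))) \<longlongrightarrow> of_int (zorder f z)) (at_right 0)"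
    using lim unfolding n_def[symmetric] by (subst tendsto_cong[OF ev])
qed

text \<open>Both cases agree in the critical strip; the point of symmetry is moved to 0.\<close>
definition f4 :: "complex \<Rightarrow> complex" where
  "f4 z = (if Re z > -1/2 then xi4 (1/2 + z) else xi4 (1/2 - z))"

lemma f4_right: "Re z > -1/2 \<Longrightarrow> f4 z = xi4 (1/2 + z)"
  by (simp add: f4_def)

lemma f4_left: "Re z < 1/2 \<Longrightarrow> f4 z = xi4 (1/2 - z)"
  using xi4_reflect[of "1/2 + z"] by (auto simp: f4_def)

lemma f4_minus: "f4 (-z) = f4 z"
proof (cases "Re z > -1/2")
  case True
  thus ?thesis using f4_right[of z] f4_left[of "-z"] by simp
next
  case False
  thus ?thesis using f4_left[of z] f4_right[of "-z"] by simp
qed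

lemma f4_holomorphic: "f4 holomorphic_on A"
proof -
  have A: "f4 holomorphic_on {z. Re z > -1/2}"
  proof (rule holomorphic_transform)
    have "(xi4 \<circ> (\<lambda>z. 1/2 + z)) holomorphic_on {z. Re z > -1/2}"
      by (rule holomorphic_on_compose_gen[OF _ xi4_holomorphic]) (auto intro!: holomorphic_intros)
    thus "(\<lambda>z. xi4 (1/2 + z)) holomorphic_on {z. Re z > -1/2}" by (simp add: o_def)
  qed (simp add: f4_right)
  have B: "f4 holomorphic_on {z. Re z < 1/2}"
  proof (rule holomorphic_transform)
    have "(xi4 \<circ> (\<lambda>z. 1/2 - z)) holomorphic_on {z. Re z < 1/2}"
      by (rule holomorphic_on_compose_gen[OF _ xi4_holomorphic]) (auto intro!: holomorphic_intros)
    thus "(\<lambda>z. xi4 (1/2 - z)) holomorphic_on {z. Re z < 1/2}" by (simp add: o_def)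
  qed (simp add: f4_left)
  have "f4 holomorphic_on {z. Re z > -1/2} \<union> {z. Re z < 1/2}"
    by (rule holomorphic_on_Un[OF A B open_halfspace_Re_gt open_halfspace_Re_lt])
  thus ?thesis by (rule holomorphic_on_subset) auto
qed

lemma deriv_f4_minus: "deriv f4 (-z) = - deriv f4 z"
proof -
  have d: "(f4 has_field_derivative deriv f4 w) (at w)" for w
    by (rule holomorphic_derivI[OF f4_holomorphic open_UNIV]) simp
  have "((\<lambda>w. f4 (-w)) has_field_derivative deriv f4 (-z) * (-1)) (at z)"
    by (rule DERIV_chain2[OF d]) (auto intro!: derivative_eq_intros)
  hence "(f4 has_field_derivative - deriv f4 (-z)) (at z)" by (simp add: f4_minus)
  from DERIV_unique[OF this d[of z]] show ?thesis by (simp add: equation_minus_iff)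
qed

text \<open>Linear growth is crude (the truth is logarithmic), but it keeps the horizontal sides of
  the rectangle at O(R^2), below the main term R^3. The threshold 3/4 is the real part of z/2 + 3/4
  on the imaginary axis.\<close>

lemma Digamma_norm_le:
  fixes w :: complex
  assumes "Re w \<ge> 3/4"
  shows "norm (Digamma w) \<le> 4 * (norm w + 1)"
proof -
  have w0: "w \<noteq> 0" using assms by auto
  have le: "norm (inverse (of_nat (Suc k)) - inverse (w + of_nat k)) \<le> 4/3 * (norm w + 1) * real (Suc k) powr (-1-1)" for k
  proof -
    have re: "3/4 * real (Suc k) \<le> Re (w + of_nat k)" using assms by simp
    hence n: "3/4 * real (Suc k) \<le> norm (w + of_nat k)" using complex_Re_le_cmod order_trans by blast
    hence wk: "w + of_nat k \<noteq> 0" using re by auto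
    have "inverse (of_nat (Suc k)) - inverse (w + of_nat k) = (w - 1) / (of_nat (Suc k) * (w + of_nat k))"
      using wk of_nat_neq_0[of k, where ?'a = complex] by (simp add: field_simps del: of_nat_Suc) (simp add: algebra_simps)
    hence "norm (inverse (of_nat (Suc k)) - inverse (w + of_nat k)) = norm (w - 1) / (real (Suc k) * norm (w + of_nat k))"
      by (simp add: norm_divide norm_mult del: of_nat_Suc)
    also have "\<dots> \<le> (norm w + 1) / (real (Suc k) * (3/4 * real (Suc k)))"
      using n norm_triangle_ineq4[of w 1] by (intro frac_le mult_left_mono mult_pos_pos) auto
    also have "\<dots> = 4/3 * (norm w + 1) * real (Suc k) powr (-1-1)"
      by (simp add: powr_minus powr_numeral power2_eq_square field_simps)
    finally show ?thesis .
  qed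
  have s: "summable (\<lambda>k. 4/3 * (norm w + 1) * real (Suc k) powr (-1-1))"
    by (intro summable_mult real_powr_tail) auto
  have 1: "norm (Digamma w) \<le> norm (\<Sum>k. inverse (of_nat (Suc k)) - inverse (w + of_nat k)) + norm (euler_mascheroni :: complex)"
    unfolding Digamma_def by (rule norm_triangle_ineq4)
  have "norm (\<Sum>k. inverse (of_nat (Suc k)) - inverse (w + of_nat k)) \<le> (\<Sum>k. 4/3 * (norm w + 1) * real (Suc k) powr (-1-1))"
    by (rule norm_suminf_le[OF le s])
  also have "\<dots> = 4/3 * (norm w + 1) * (\<Sum>k. real (Suc k) powr (-1-1))"
    by (rule suminf_mult) (intro real_powr_tail, simp)
  also have "\<dots> \<le> 4/3 * (norm w + 1) * 2"
    using real_powr_tail(2)[of 1] by (intro mult_left_mono) auto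
  finally have 2: "norm (\<Sum>k. inverse (of_nat (Suc k)) - inverse (w + of_nat k)) \<le> 4/3 * (norm w + 1) * 2" .
  have "norm (euler_mascheroni :: complex) = euler_mascheroni"
    using norm_of_real[of euler_mascheroni, where ?'a = complex] euler_mascheroni_pos by simp
  hence 3: "norm (euler_mascheroni :: complex) < 13/22" using euler_mascheroni_less_13_over_22 by simp
  have "D \<le> 4 * (n + 1)" if "D \<le> S + e" "S \<le> 4/3 * (n + 1) * 2" "e < 13/22" "0 \<le> n" for D S e n :: real
    using that by (simp add: field_simps)
  from this[OF 1 2 3 norm_ge_zero] show ?thesis .
qed

section \<open>Lower bounds for the real part of Digamma\<close>

lemma Re_inverse_le: "Re u > 0 \<Longrightarrow> Re (inverse u) \<le> 1 / Re u"
proof -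
  assume u: "Re u > 0"
  have "Re (inverse u) = Re u / ((Re u)\<^sup>2 + (Im u)\<^sup>2)" by simp
  also have "\<dots> \<le> Re u / (Re u)\<^sup>2" using u by (intro divide_left_mono) (auto intro!: mult_pos_pos add_pos_nonneg)
  finally show ?thesis using u by (simp add: power2_eq_square)
qed

lemma Re_Digamma_sums:
  assumes "Re w > 0"
  shows "(\<lambda>k. 1 / real (Suc k) - Re (inverse (w + of_nat k))) sums (Re (Digamma w) + euler_mascheroni)"
proof -
  have "w \<noteq> 0" using assms by auto
  from summable_sums[OF summable_Digamma[OF this]]
  have "(\<lambda>k. inverse (of_nat (Suc k)) - inverse (w + of_nat k)) sums (Digamma w + euler_mascheroni)"
    by (simp add: Digamma_def)
  hence "(\<lambda>k. Re (inverse (of_nat (Suc k)) - inverse (w + of_nat k))) sums Re (Digamma w + euler_mascheroni)"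
    by (simp add: sums_complex_iff)
  moreover have "Re (inverse (of_nat (Suc k))) = 1 / real (Suc k)" for k
    by (metis Re_complex_of_real inverse_eq_divide of_real_inverse of_real_of_nat_eq)
  moreover have "Re euler_mascheroni = euler_mascheroni"
    by (metis Re_complex_of_real of_real_euler_mascheroni)
  ultimately show ?thesis by simp
qed

text \<open>All terms of the series are nonnegative for Re w \<ge> 1, leaving only Euler's constant.
  This serves the part of the vertical side where no large lower bound is claimed.\<close>

lemma Re_Digamma_ge:
  assumes w: "Re w \<ge> 1"
  shows "Re (Digamma w) \<ge> -1"
proof -
  have s: "(\<lambda>k. 1 / real (Suc k) - Re (inverse (w + of_nat k))) sums (Re (Digamma w) + euler_mascheroni)"
    by (rule Re_Digamma_sums) (use w in auto)
  have "1 / real (Suc k) - Re (inverse (w + of_nat k)) \<ge> 0" for k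
  proof -
    have "Re (inverse (w + of_nat k)) \<le> 1 / Re (w + of_nat k)" using w by (intro Re_inverse_le) auto
    also have "\<dots> \<le> 1 / real (Suc k)" using w by (intro divide_left_mono) auto
    finally show ?thesis by simp
  qed
  hence "Re (Digamma w) + euler_mascheroni \<ge> 0" using s by (intro sums_le[OF _ sums_zero s]) auto
  thus ?thesis using euler_mascheroni_less_13_over_22 by simp
qed

text \<open>This is the source of the superlinear number of zeros. Once |Im w| is at least 2 (N +
  a), each of the first N terms keeps half of 1/(k+1), and the harmonic series diverges; the 1 in K
  + 1 absorbs Euler's constant.\<close>

lemma Re_Digamma_unbounded:
  fixes K a :: real
  assumes a: "a \<ge> 1"
  shows "\<exists>Y\<ge>0. \<forall>w. Re w = a \<and> \<bar>Im w\<bar> \<ge> Y \<longrightarrow> Re (Digamma w) \<ge> K"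
proof -
  have "filterlim (\<lambda>n. harm n :: real) at_top sequentially" by (rule harm_at_top)
  then obtain N where N: "harm N \<ge> 2 * (K + 1)"
    unfolding filterlim_at_top eventually_sequentially by blast
  define Y where "Y = 2 * (real N + a)"
  have "Re (Digamma w) \<ge> K" if w: "Re w = a" "\<bar>Im w\<bar> \<ge> Y" for w
  proof -
    let ?t = "\<lambda>k. 1 / real (Suc k) - Re (inverse (w + of_nat k))"
    have s: "?t sums (Re (Digamma w) + euler_mascheroni)"
      by (rule Re_Digamma_sums) (use w a in auto)
    have t0: "?t k \<ge> 0" for k
    proof -
      have "Re (inverse (w + of_nat k)) \<le> 1 / Re (w + of_nat k)" using w a by (intro Re_inverse_le) auto
      also have "\<dots> \<le> 1 / real (Suc k)" using w a by (intro divide_left_mono) auto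
      finally show ?thesis by simp
    qed
    have t1: "?t k \<ge> 1 / real (Suc k) / 2" if k: "k < N" for k
    proof -
      have y2: "Y\<^sup>2 \<le> (Im w)\<^sup>2" using power_mono[OF w(2), of 2] a by (simp add: Y_def)
      have "2 * real (Suc k) * (a + real k) \<le> 2 * (real N + a) * (real N + a)"
        using k a by (intro mult_mono) auto
      also have "\<dots> \<le> (2 * (real N + a)) * (2 * (real N + a))"
        using a by (intro mult_left_mono) auto
      also have "\<dots> = Y\<^sup>2" by (simp add: Y_def power2_eq_square)
      also note y2
      finally have le: "2 * real (Suc k) * (a + real k) \<le> (a + real k)\<^sup>2 + (Im w)\<^sup>2"
        by (smt (verit) zero_le_power2)
      have "Re (inverse (w + of_nat k)) = (a + real k) / ((a + real k)\<^sup>2 + (Im w)\<^sup>2)"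
        using w by simp
      also have "\<dots> \<le> (a + real k) / (2 * real (Suc k) * (a + real k))"
        using a le by (intro divide_left_mono mult_pos_pos add_pos_nonneg) auto
      also have "\<dots> = 1 / real (Suc k) / 2" using a by simp
      finally show ?thesis by linarith
    qed
    have "K + 1 \<le> harm N / 2" using N by simp
    also have "\<dots> = (\<Sum>k<N. 1 / real (Suc k) / 2)"
      unfolding harm_def sum_divide_distrib
      by (rule sum.reindex_bij_witness[of _ Suc "\<lambda>k. k - 1"]) (auto simp: inverse_eq_divide)
    also have "\<dots> \<le> (\<Sum>k<N. ?t k)" by (intro sum_mono t1) auto
    also have "\<dots> \<le> suminf ?t" using s t0 by (intro sum_le_suminf) (auto simp: sums_iff)
    also have "\<dots> = Re (Digamma w) + euler_mascheroni" using s by (simp add: sums_iff)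
    finally show ?thesis using euler_mascheroni_less_13_over_22 by simp
  qed
  moreover have "Y \<ge> 0" using a by (simp add: Y_def)
  ultimately show ?thesis by blast
qed

section \<open>The logarithmic derivative of f4 under the assumed bound\<close>

context psi4_bounded
begin

lemma f4_nonzero:
  assumes "Re z \<noteq> 0"
  shows "f4 z \<noteq> 0"
proof -
  have *: "f4 z \<noteq> 0" if "Re z > 0" for z
  proof -
    have "(1/2 + z + 1) / 2 \<notin> \<int>\<^sub>\<le>\<^sub>0" using that by (intro half_nonpos_Ints) auto
    thus ?thesis using L4_nonzero[of "1/2 + z"] that
      by (simp add: f4_right xi4_def Gamma_eq_zero_iff)
  qed
  show ?thesis using *[of z] *[of "-z"] assms by (cases "Re z > 0") (auto simp: f4_minus)
qed

lemma f4_logderiv: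
  assumes "Re z > 0"
  shows "deriv f4 z / f4 z = of_real (ln (4/pi) / 2) + Digamma (z / 2 + 3/4) / 2 - H4 (1/2 + z)"
proof -
  let ?s = "1/2 + z"
  let ?e = "\<lambda>z. exp ((1/2 + z) / 2 * of_real (ln (4 / pi)))" and ?g = "\<lambda>z. Gamma ((1/2 + z + 1) / 2)"
  have np: "(1/2 + z + 1) / 2 \<notin> \<int>\<^sub>\<le>\<^sub>0" using assms by (intro half_nonpos_Ints) auto
  have L: "(L4 has_field_derivative (- H4 ?s * L4 ?s)) (at ?s)"
    using holomorphic_derivI[OF L4_holomorphic open_halfspace_Re_gt, of ?s] deriv_L4_eq[of ?s] assms by simp
  have L': "((\<lambda>z. L4 (1/2 + z)) has_field_derivative (- H4 ?s * L4 ?s)) (at z)"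
  proof -
    have "((\<lambda>z. 1/2 + z) has_field_derivative 1) (at z)" by (auto intro!: derivative_eq_intros)
    from DERIV_chain2[where f = L4 and g = "\<lambda>z. 1/2 + z", OF L this] show ?thesis by simp
  qed
  have "((\<lambda>z. ?e z * ?g z * L4 (1/2 + z)) has_field_derivative
      ?e z * ?g z * L4 ?s * (of_real (ln (4/pi) / 2) + Digamma ((1/2 + z + 1) / 2) / 2 - H4 ?s)) (at z)"
  proof -
    have "((\<lambda>z. ?e z * ?g z) has_field_derivative
        ?e z * ?g z * (of_real (ln (4/pi) / 2) + Digamma ((1/2 + z + 1) / 2) / 2)) (at z)"
      using np by (auto intro!: derivative_eq_intros simp: algebra_simps)
    from DERIV_mult[OF this L'] show ?thesis by (simp add: algebra_simps)
  qed
  hence "(f4 has_field_derivative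
      ?e z * ?g z * L4 ?s * (of_real (ln (4/pi) / 2) + Digamma ((1/2 + z + 1) / 2) / 2 - H4 ?s)) (at z)"
    by (rule has_field_derivative_transform_within_open[OF _ open_halfspace_Re_gt[of 0]])
       (use assms in \<open>auto simp: f4_right xi4_def\<close>)
  hence "deriv f4 z = f4 z * (of_real (ln (4/pi) / 2) + Digamma ((1/2 + z + 1) / 2) / 2 - H4 ?s)"
    using assms by (simp add: DERIV_imp_deriv f4_right xi4_def)
  moreover have "(3/2 + z) / 2 = z / 2 + 3/4" by (simp add: field_simps)
  ultimately show ?thesis using f4_nonzero[of z] assms by simp
qed

end

section \<open>The linear bound for the number of zeros\<close>

text \<open>
  The boxes of integer combinations of \<open>S\<close> grow polynomially, so one of them is less than doubled
  by the next.
\<close>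
lemma exists_Folner_set:
  fixes S :: "real set"
  assumes S: "finite S"
  shows "\<exists>E. finite E \<and> E \<noteq> {} \<and> (\<forall>\<gamma>\<in>S. card E \<le> 2 * card {\<nu>\<in>E. \<nu> + \<gamma> \<in> E})"
proof -
  define F where "F = (\<lambda>N::nat. (\<lambda>j. \<Sum>\<gamma>\<in>S. real (j \<gamma>) * \<gamma>) ` (S \<rightarrow>\<^sub>E {0..N}))"
  have fin: "finite (F N)" for N unfolding F_def using S by (intro finite_imageI finite_PiE) auto
  have card_le: "card (F N) \<le> (N + 1) ^ card S" for N
    unfolding F_def using card_image_le[of "S \<rightarrow>\<^sub>E {0..N}" "\<lambda>j. \<Sum>\<gamma>\<in>S. real (j \<gamma>) * \<gamma>"] S
    by (simp add: card_PiE finite_PiE)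
  have ne: "F N \<noteq> {}" for N unfolding F_def by (auto simp: PiE_eq_empty_iff)
  have sub: "F N \<subseteq> F (Suc N)" for N
    unfolding F_def by (intro image_mono PiE_mono) auto
  have shift: "\<nu> + \<gamma> \<in> F (Suc N)" if "\<nu> \<in> F N" "\<gamma> \<in> S" for N \<nu> \<gamma>
  proof -
    obtain j where j: "j \<in> S \<rightarrow>\<^sub>E {0..N}" "\<nu> = (\<Sum>\<gamma>\<in>S. real (j \<gamma>) * \<gamma>)"
      using \<open>\<nu> \<in> F N\<close> by (auto simp: F_def)
    let ?j = "j(\<gamma> := Suc (j \<gamma>))"
    have mem: "?j \<in> S \<rightarrow>\<^sub>E {0..Suc N}" using j(1) that by (auto simp: PiE_iff extensional_def le_Suc_eq)
    have "(\<Sum>x\<in>S. real (?j x) * x) = (\<Sum>x\<in>S. real (j x) * x + (if x = \<gamma> then x else 0))"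
      by (intro sum.cong) (auto simp: algebra_simps)
    also have "\<dots> = \<nu> + \<gamma>" using S that(2) by (simp add: sum.distrib j(2))
    finally have eq: "(\<Sum>x\<in>S. real (?j x) * x) = \<nu> + \<gamma>" .
    show ?thesis unfolding F_def by (rule image_eqI[OF _ mem]) (simp only: eq)
  qed
  have "\<exists>N. card (F (Suc N)) \<le> 2 * card (F N)"
  proof (rule ccontr)
    assume "\<not> (\<exists>N. card (F (Suc N)) \<le> 2 * card (F N))"
    hence gr: "2 * card (F N) < card (F (Suc N))" for N by (auto simp: not_le)
    have "2 ^ N \<le> card (F N)" for N
    proof (induction N)
      case 0
      show ?case using fin[of 0] ne[of 0] by (simp add: Suc_le_eq card_gt_0_iff)
    next
      case (Suc N)
      thus ?case using gr[of N] by simp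
    qed
    hence le: "2 ^ N \<le> (N + 1) ^ card S" for N using card_le[of N] order_trans by blast
    have "eventually (\<lambda>N. real (N + 1) ^ card S < 2 ^ N) sequentially"
      by real_asymp
    then obtain N where "real (N + 1) ^ card S < 2 ^ N"
      by (auto simp: eventually_sequentially)
    hence "real ((N + 1) ^ card S) < real (2 ^ N)" by simp
    thus False using le[of N] by (simp only: of_nat_less_iff)
  qed
  then obtain N where N: "card (F (Suc N)) \<le> 2 * card (F N)" by blast
  show ?thesis
  proof (intro exI[of _ "F (Suc N)"] conjI ballI fin ne)
    fix \<gamma> assume "\<gamma> \<in> S"
    \<comment> \<open>Every point of the smaller box can be moved by any element of S without
      leaving the larger one, so half of the larger box is translated into itself.\<close>
    hence "F N \<subseteq> {\<nu> \<in> F (Suc N). \<nu> + \<gamma> \<in> F (Suc N)}" using shift sub[of N] by auto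
    hence "card (F N) \<le> card {\<nu> \<in> F (Suc N). \<nu> + \<gamma> \<in> F (Suc N)}"
      using fin by (intro card_mono) auto
    thus "card (F (Suc N)) \<le> 2 * card {\<nu> \<in> F (Suc N). \<nu> + \<gamma> \<in> F (Suc N)}" using N by linarith
  qed
qed

definition zeta_line :: "complex \<Rightarrow> complex" where
  "zeta_line z = (\<Sum>n. of_nat (Suc n) powr (-1-z))"

text \<open>Orthogonality of the oscillations n^(-iy) in the logarithmic Abel mean: zeta(1 + z) -
  1/z is locally bounded up to the line, so multiplication by x detects the pole at y = 0 and
  nothing else.\<close>

lemma zeta_line_limit:
  "((\<lambda>x. of_real x * zeta_line (Complex x y)) \<longlongrightarrow> (if y = 0 then 1 else 0)) (at_right 0)"
proof -
  have C: "Complex x y = of_real x + \<i> * of_real y" for x by (simp add: complex_eq_iff)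
  have tC: "((\<lambda>x. Complex x y) \<longlongrightarrow> Complex 0 y) (at_right 0)"
    unfolding C by (intro tendsto_intros)
  show ?thesis
  proof (cases "y = 0")
    case True
    have "((\<lambda>x. of_real x * zeta_line (Complex x y) - 1) \<longlongrightarrow> 0) (at_right 0)"
    proof (rule Lim_null_comparison)
      show "eventually (\<lambda>x. norm (of_real x * zeta_line (Complex x y) - 1) \<le> 2 * norm (Complex x y) * norm (Complex x y + 1)) (at_right 0)"
        using eventually_at_right_less[of 0]
      proof eventually_elim
        case (elim x)
        have "of_real x = Complex x y" using True by (simp add: complex_eq_iff)
        thus ?case unfolding zeta_line_def using norm_zeta_line_minus_pole_le[of "Complex x y"] elim by simp
      qed
      have "((\<lambda>x. 2 * norm (Complex x y) * norm (Complex x y + 1)) \<longlongrightarrow> 2 * norm (Complex 0 y) * norm (Complex 0 y + 1)) (at_right 0)"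
        by (intro tendsto_intros tC)
      thus "((\<lambda>x. 2 * norm (Complex x y) * norm (Complex x y + 1)) \<longlongrightarrow> 0) (at_right 0)"
        using True by (simp add: complex_norm)
    qed
    thus ?thesis using True by (simp add: LIM_zero_iff)
  next
    case False
    have "((\<lambda>x. of_real x * zeta_line (Complex x y)) \<longlongrightarrow> 0) (at_right 0)"
    proof (rule Lim_null_comparison)
      show "eventually (\<lambda>x. norm (of_real x * zeta_line (Complex x y)) \<le> x * ((1 + 2 * norm (Complex x y) * norm (Complex x y + 1)) / \<bar>y\<bar>)) (at_right 0)"
        using eventually_at_right_less[of 0]
      proof eventually_elim
        case (elim x)
        let ?z = "Complex x y"
        have "norm (?z * zeta_line ?z) \<le> norm (?z * zeta_line ?z - 1) + 1"
          using norm_triangle_ineq[of "?z * zeta_line ?z - 1" 1] by simp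
        also have "norm (?z * zeta_line ?z - 1) \<le> 2 * norm ?z * norm (?z + 1)"
          unfolding zeta_line_def using norm_zeta_line_minus_pole_le[of ?z] elim by simp
        finally have 1: "norm ?z * norm (zeta_line ?z) \<le> 1 + 2 * norm ?z * norm (?z + 1)" by (simp add: norm_mult)
        have "\<bar>y\<bar> * norm (zeta_line ?z) \<le> norm ?z * norm (zeta_line ?z)"
          using abs_Im_le_cmod[of ?z] by (intro mult_right_mono) auto
        with 1 have "\<bar>y\<bar> * norm (zeta_line ?z) \<le> 1 + 2 * norm ?z * norm (?z + 1)" by linarith
        hence "norm (zeta_line ?z) \<le> (1 + 2 * norm ?z * norm (?z + 1)) / \<bar>y\<bar>"
          using False by (simp add: field_simps)
        thus ?case using elim unfolding norm_mult by (intro mult_mono) auto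
      qed
      have "((\<lambda>x. x * ((1 + 2 * norm (Complex x y) * norm (Complex x y + 1)) / \<bar>y\<bar>)) \<longlongrightarrow>
          0 * ((1 + 2 * norm (Complex 0 y) * norm (Complex 0 y + 1)) / \<bar>y\<bar>)) (at_right 0)"
        by (intro tendsto_intros tC) (use False in auto)
      thus "((\<lambda>x. x * ((1 + 2 * norm (Complex x y) * norm (Complex x y + 1)) / \<bar>y\<bar>)) \<longlongrightarrow> 0) (at_right 0)"
        by simp
    qed
    thus ?thesis using False by simp
  qed
qed

text \<open>Multiplicity of the zero at height \<gamma>, as a function on all reals. Under the
  assumed bound it is 0 off the zeros, so it can be evaluated at arbitrary differences of
  frequencies.\<close>

definition mult4 :: "real \<Rightarrow> real" where
  "mult4 \<gamma> = of_int (zorder f4 (\<i> * of_real \<gamma>))"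

definition b4 :: "nat \<Rightarrow> real" where
  "b4 n = psi4 (Suc n) / sqrt (real (Suc n))"

text \<open>
  Discrete substitute for the Laplace transform of \<open>\<psi>(e\<^sup>u, \<chi>) e\<^sup>-\<^sup>u\<^sup>/\<^sup>2\<close>; it differs from
  \<open>H4 (1/2 + z) / (1/2 + z)\<close> by a bounded term.
\<close>
definition D4 :: "complex \<Rightarrow> complex" where
  "D4 z = (\<Sum>n. of_real (b4 n) * of_nat (Suc n) powr (-1-z))"

section \<open>Mean values at the ordinates of the zeros\<close>

context psi4_bounded
begin

lemma f4_not_zero: "\<exists>w. f4 w \<noteq> 0"
  using f4_nonzero[of 1] by auto

lemma mult4_nonneg: "mult4 \<gamma> \<ge> 0"
  unfolding mult4_def using logderiv_residue_limit(2)[OF f4_holomorphic f4_not_zero] by simp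

lemma abs_b4_le: "\<bar>b4 n\<bar> \<le> C"
  using psi4_le[of "Suc n"] by (simp add: b4_def field_simps)

lemma D4_sums:
  assumes "Re z > 0"
  shows "(\<lambda>n. of_real (b4 n) * of_nat (Suc n) powr (-1-z)) sums D4 z"
proof -
  have "summable (\<lambda>n. C * norm (of_nat (Suc n) powr (-1-z) :: complex))"
    by (intro summable_mult summable_zeta_line assms)
  hence "summable (\<lambda>n. of_real (b4 n) * of_nat (Suc n) powr (-1-z) :: complex)"
    by (rule summable_comparison_test'[where N = 0])
       (auto simp: norm_mult intro!: mult_right_mono abs_b4_le)
  thus ?thesis unfolding D4_def by (rule summable_sums)
qed

text \<open>Each difference n^(-s) - (n+1)^(-s) is replaced by s n^(-s-1). The error, times
  \<open>psi4\<close> = O(n^(1/2)), is O(n^(-2 - Re z)), hence summable uniformly up to the critical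
  line and invisible after multiplication by x -> 0.\<close>

lemma H4_minus_D4:
  assumes z: "Re z > 0"
  shows "norm (H4 (1/2 + z) - (1/2 + z) * D4 z) \<le> 2 * C * norm (1/2 + z) * norm (3/2 + z)"
proof -
  let ?s = "1/2 + z"
  let ?A = "\<lambda>n. of_real (psi4 (Suc n)) * (of_nat (Suc n) powr (-?s) - of_nat (Suc (Suc n)) powr (-?s)) -
              ?s * (of_real (b4 n) * of_nat (Suc n) powr (-1-z)) :: complex"
  have eq: "?A n = of_real (psi4 (Suc n)) * (of_nat (Suc n) powr (-?s) - of_nat (Suc (Suc n)) powr (-?s) - ?s * of_nat (Suc n) powr (-?s-1))" for n
  proof -
    have "complex_of_real (sqrt (real (Suc n))) = of_nat (Suc n) powr (1/2)"
      using powr_of_real[of "real (Suc n)" "1/2"] by (simp add: powr_half_sqrt)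
    hence "of_nat (Suc n) powr (-1-z) = of_real (sqrt (real (Suc n))) * of_nat (Suc n) powr (-?s-1)"
      by (simp add: powr_add [symmetric] del: of_nat_Suc)
    hence "of_real (b4 n) * of_nat (Suc n) powr (-1-z) = of_real (psi4 (Suc n)) * of_nat (Suc n) powr (-?s-1)"
      by (simp add: b4_def del: of_nat_Suc)
    thus ?thesis by (simp add: algebra_simps del: of_nat_Suc)
  qed
  have x: "1 + Re z > 0" using z by simp
  have le: "norm (?A n) \<le> C * norm ?s * norm (3/2 + z) * real (Suc n) powr (-1-(1+Re z))" for n
  proof -
    have nn: "complex_of_real (real (Suc n)) = of_nat (Suc n)" "complex_of_real (real (Suc n) + 1) = of_nat (Suc (Suc n))" by simp_all
    have "norm (?A n) \<le> (C * sqrt (real (Suc n))) * (norm ?s * norm (?s + 1) * real (Suc n) powr (-Re ?s - 2))"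
      unfolding eq norm_mult
      using norm_powr_diff2_le[of "real (Suc n)" ?s] z psi4_le[of "Suc n"] C_nonneg unfolding nn
      by (intro mult_mono) auto
    also have "\<dots> = C * norm ?s * norm (?s + 1) * (real (Suc n) powr (1/2) * real (Suc n) powr (-Re ?s - 2))"
      by (simp add: powr_half_sqrt del: of_nat_Suc)
    also have "real (Suc n) powr (1/2) * real (Suc n) powr (-Re ?s - 2) = real (Suc n) powr (-1-(1+Re z))"
      by (subst powr_add [symmetric]) simp
    also have "?s + 1 = 3/2 + z" by simp
    finally show ?thesis .
  qed
  have "?A sums (H4 ?s - ?s * D4 z)"
    using H4_sums[of ?s] D4_sums[OF z] z by (intro sums_diff sums_mult) auto
  hence "norm (H4 ?s - ?s * D4 z) = norm (suminf ?A)" by (simp add: sums_iff)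
  also have "\<dots> \<le> (\<Sum>n. C * norm ?s * norm (3/2 + z) * real (Suc n) powr (-1-(1+Re z)))"
    by (rule norm_suminf_le[OF le summable_mult[OF real_powr_tail(1)[OF x]]])
  also have "\<dots> = C * norm ?s * norm (3/2 + z) * (\<Sum>n. real (Suc n) powr (-1-(1+Re z)))"
    by (rule suminf_mult[OF real_powr_tail(1)[OF x]])
  also have "\<dots> \<le> C * norm ?s * norm (3/2 + z) * 2"
  proof (intro mult_left_mono)
    have "1 / (1 + Re z) \<le> 1" using z by simp
    thus "(\<Sum>n. real (Suc n) powr (-1-(1+Re z))) \<le> 2"
      using real_powr_tail(2)[OF x] by linarith
  qed (use C_nonneg in auto)
  finally show ?thesis by (simp add: mult_ac)
qed

text \<open>On the line the Digamma part is regular, so \<open>H4\<close> carries the whole pole of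
  the logarithmic derivative with opposite sign; passing to \<open>D4\<close> divides by s = 1/2 + i
  \<gamma>. Heights without zeros are included, with limit 0.\<close>

lemma D4_limit:
  "((\<lambda>x. of_real x * D4 (Complex x \<gamma>)) \<longlongrightarrow> - of_real (mult4 \<gamma>) / (1/2 + \<i> * of_real \<gamma>)) (at_right 0)"
proof -
  let ?z = "\<lambda>x. Complex x \<gamma>"
  have C: "?z x = \<i> * of_real \<gamma> + of_real x" for x by (simp add: complex_eq_iff)
  have tC: "(?z \<longlongrightarrow> \<i> * of_real \<gamma>) (at_right 0)"
    unfolding C by (rule tendsto_eq_intros refl | simp)+
  have nz: "1/2 + \<i> * of_real \<gamma> \<noteq> 0" by (simp add: complex_eq_iff)
  have 1: "((\<lambda>x. of_real x * (deriv f4 (?z x) / f4 (?z x))) \<longlongrightarrow> of_real (mult4 \<gamma>)) (at_right 0)"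
    using logderiv_residue_limit(1)[OF f4_holomorphic f4_not_zero, of "\<i> * of_real \<gamma>"]
    unfolding C mult4_def by simp
  have np: "\<i> * of_real \<gamma> / 2 + 3/4 \<notin> \<int>\<^sub>\<le>\<^sub>0"
    by (auto elim!: nonpos_Ints_cases simp: complex_eq_iff)
  have 2: "((\<lambda>x. Digamma (?z x / 2 + 3/4)) \<longlongrightarrow> Digamma (\<i> * of_real \<gamma> / 2 + 3/4)) (at_right 0)"
  proof (rule isCont_tendsto_compose[where g = Digamma])
    show "isCont Digamma (\<i> * complex_of_real \<gamma> / 2 + 3/4)" using np by (intro isCont_Polygamma) auto
    show "((\<lambda>x. ?z x / 2 + 3/4) \<longlongrightarrow> \<i> * of_real \<gamma> / 2 + 3/4) (at_right 0)" by (intro tendsto_intros tC) auto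
  qed
  have "((\<lambda>x. of_real x * (of_real (ln (4/pi) / 2) + Digamma (?z x / 2 + 3/4) / 2) - of_real x * (deriv f4 (?z x) / f4 (?z x)))
      \<longlongrightarrow> of_real 0 * (of_real (ln (4/pi) / 2) + Digamma (\<i> * of_real \<gamma> / 2 + 3/4) / 2) - of_real (mult4 \<gamma>)) (at_right 0)"
    by (intro tendsto_intros 1 2) auto
  hence "((\<lambda>x. of_real x * (of_real (ln (4/pi) / 2) + Digamma (?z x / 2 + 3/4) / 2) - of_real x * (deriv f4 (?z x) / f4 (?z x)))
      \<longlongrightarrow> - of_real (mult4 \<gamma>)) (at_right 0)" by simp
  moreover have "eventually (\<lambda>x. of_real x * (of_real (ln (4/pi) / 2) + Digamma (?z x / 2 + 3/4) / 2) - of_real x * (deriv f4 (?z x) / f4 (?z x)) =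
     of_real x * H4 (1/2 + ?z x)) (at_right 0)"
    using eventually_at_right_less[of 0]
    by eventually_elim (simp add: f4_logderiv algebra_simps)
  ultimately have H: "((\<lambda>x. of_real x * H4 (1/2 + ?z x)) \<longlongrightarrow> - of_real (mult4 \<gamma>)) (at_right 0)"
    by (simp add: tendsto_cong)
  have E: "((\<lambda>x. of_real x * (H4 (1/2 + ?z x) - (1/2 + ?z x) * D4 (?z x))) \<longlongrightarrow> 0) (at_right 0)"
  proof (rule Lim_null_comparison)
    show "eventually (\<lambda>x. norm (of_real x * (H4 (1/2 + ?z x) - (1/2 + ?z x) * D4 (?z x))) \<le>
        x * (2 * C * norm (1/2 + ?z x) * norm (3/2 + ?z x))) (at_right 0)"
      using eventually_at_right_less[of 0]
    proof eventually_elim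
      case (elim x)
      thus ?case unfolding norm_mult using H4_minus_D4[of "?z x"] by (intro mult_mono) auto
    qed
    have "((\<lambda>x. x * (2 * C * norm (1/2 + ?z x) * norm (3/2 + ?z x))) \<longlongrightarrow>
        0 * (2 * C * norm (1/2 + \<i> * of_real \<gamma>) * norm (3/2 + \<i> * of_real \<gamma>))) (at_right 0)"
      by (intro tendsto_intros tC)
    thus "((\<lambda>x. x * (2 * C * norm (1/2 + ?z x) * norm (3/2 + ?z x))) \<longlongrightarrow> 0) (at_right 0)" by simp
  qed
  have "((\<lambda>x. (of_real x * H4 (1/2 + ?z x) - of_real x * (H4 (1/2 + ?z x) - (1/2 + ?z x) * D4 (?z x))) / (1/2 + ?z x))
     \<longlongrightarrow> (- of_real (mult4 \<gamma>) - 0) / (1/2 + \<i> * of_real \<gamma>)) (at_right 0)"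
    by (intro tendsto_intros H E tC nz)
  moreover have "eventually (\<lambda>x. (of_real x * H4 (1/2 + ?z x) - of_real x * (H4 (1/2 + ?z x) - (1/2 + ?z x) * D4 (?z x))) / (1/2 + ?z x) =
      of_real x * D4 (?z x)) (at_right 0)"
    using eventually_at_right_less[of 0]
  proof eventually_elim
    case (elim x)
    have "1/2 + ?z x \<noteq> 0" using elim by (simp add: complex_eq_iff)
    moreover have "(a * h - a * (h - s * d)) / s = a * d" if "s \<noteq> 0" for a h s d :: complex
      using that by (simp add: field_simps)
    ultimately show ?case by blast
  qed
  ultimately show ?thesis by (simp add: tendsto_cong)
qed

text \<open>
  With the Fejer kernel \<open>Q u = \<bar>\<Sum>\<mu>\<in>E. cis (-\<mu> u)\<bar>\<^sup>2\<close>, the inequality compares the Abel mean of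
  \<open>b4\<close> against \<open>Q (u - v) - Q (u + v)\<close> with \<open>C\<close> times the mean of \<open>Q (u - v) + Q (u + v)\<close>. The difference
  of the two shifts produces coefficients that become nonnegative after integration over \<open>v\<close>, so
  that zeros outside a chosen finite set can later be dropped.
\<close>
lemma sin_weighted_mult4_le:
  assumes E: "finite E" "E \<noteq> {}"
  shows "(\<Sum>\<mu>\<in>E. \<Sum>\<nu>\<in>E. mult4 (\<mu> - \<nu>) * ((\<mu> - \<nu>) * sin ((\<mu> - \<nu>) * v)) / (1/4 + (\<mu> - \<nu>)\<^sup>2)) \<le> C * card E"
proof -
  define Q where "Q = (\<lambda>u. (norm (\<Sum>\<mu>\<in>E. cis (- \<mu> * u)))\<^sup>2)"
  define u where "u = (\<lambda>n. ln (real (Suc n)))"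
  define w where "w = (\<lambda>n x. real (Suc n) powr (-1-x))"
  have Q: "complex_of_real (Q t) = (\<Sum>\<mu>\<in>E. \<Sum>\<nu>\<in>E. cis (- (\<mu> - \<nu>) * t))" for t
    unfolding Q_def complex_norm_square
    by (simp add: sum_product cis_cnj cis_mult algebra_simps) (rule sum.swap)
  have Q0: "Q t \<ge> 0" for t by (simp add: Q_def)
  have pw: "of_nat (Suc n) powr (-1 - Complex x y) = of_real (w n x) * cis (- y * u n)" for n x y
  proof -
    have "of_nat (Suc n) powr (-1 - Complex x y) = exp ((-1 - Complex x y) * of_real (u n))"
      by (simp add: powr_def u_def Ln_of_nat del: of_nat_Suc)
    also have "(-1 - Complex x y) * of_real (u n) = of_real ((-1-x) * u n) + \<i> * of_real (- y * u n)"
      by (simp add: complex_eq_iff algebra_simps)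
    also have "exp \<dots> = of_real (exp ((-1-x) * u n)) * cis (- y * u n)"
      by (simp only: exp_add exp_of_real cis_conv_exp)
    also have "exp ((-1-x) * u n) = w n x"
      by (simp add: w_def u_def powr_def)
    finally show ?thesis .
  qed
  \<comment> \<open>\<open>T\<close> and \<open>U\<close> are the signed and unsigned means
    expressed through Dirichlet series: differences and sums of the two shifts by v produce 2 i sin
    and 2 cos.\<close>
  define T where "T = (\<lambda>x. \<Sum>\<mu>\<in>E. \<Sum>\<nu>\<in>E. 2 * \<i> * of_real (sin ((\<mu> - \<nu>) * v)) * D4 (Complex x (\<mu> - \<nu>)))"
  define U where "U = (\<lambda>x. \<Sum>\<mu>\<in>E. \<Sum>\<nu>\<in>E. 2 * of_real (cos ((\<mu> - \<nu>) * v)) * zeta_line (Complex x (\<mu> - \<nu>)))"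
  have T_sums: "(\<lambda>n. of_real (b4 n * w n x * (Q (u n - v) - Q (u n + v)))) sums T x" if x: "x > 0" for x
  proof -
    have "(\<lambda>n. \<Sum>\<mu>\<in>E. \<Sum>\<nu>\<in>E. 2 * \<i> * of_real (sin ((\<mu> - \<nu>) * v)) * (of_real (b4 n) * of_nat (Suc n) powr (-1 - Complex x (\<mu> - \<nu>)))) sums T x"
      unfolding T_def using x by (intro sums_sum sums_mult D4_sums) auto
    also have "(\<lambda>n. \<Sum>\<mu>\<in>E. \<Sum>\<nu>\<in>E. 2 * \<i> * of_real (sin ((\<mu> - \<nu>) * v)) * (of_real (b4 n) * of_nat (Suc n) powr (-1 - Complex x (\<mu> - \<nu>)))) =
       (\<lambda>n. of_real (b4 n * w n x * (Q (u n - v) - Q (u n + v))))"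
    proof
      fix n
      have "2 * \<i> * of_real (sin (y * v)) * (of_real (b4 n) * (of_real (w n x) * cis (- y * u n))) =
          of_real (b4 n * w n x) * (cis (- y * (u n - v)) - cis (- y * (u n + v)))" for y
      proof -
        have "cis (- y * (u n - v)) - cis (- y * (u n + v)) = cis (- y * u n) * (cis (y * v) - cis (- (y * v)))"
          by (simp add: right_diff_distrib cis_mult algebra_simps)
        also have "cis (y * v) - cis (- (y * v)) = 2 * \<i> * of_real (sin (y * v))"
          by (simp add: complex_eq_iff)
        finally show ?thesis by simp
      qed
      hence "(\<Sum>\<mu>\<in>E. \<Sum>\<nu>\<in>E. 2 * \<i> * of_real (sin ((\<mu> - \<nu>) * v)) * (of_real (b4 n) * of_nat (Suc n) powr (-1 - Complex x (\<mu> - \<nu>)))) =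
         (\<Sum>\<mu>\<in>E. \<Sum>\<nu>\<in>E. of_real (b4 n * w n x) * (cis (- (\<mu> - \<nu>) * (u n - v)) - cis (- (\<mu> - \<nu>) * (u n + v))))"
        unfolding pw by (intro sum.cong refl)
      also have "\<dots> = of_real (b4 n * w n x) * (of_real (Q (u n - v)) - of_real (Q (u n + v)))"
        unfolding Q sum_subtractf [symmetric] sum_distrib_left by simp
      finally show "(\<Sum>\<mu>\<in>E. \<Sum>\<nu>\<in>E. 2 * \<i> * of_real (sin ((\<mu> - \<nu>) * v)) * (of_real (b4 n) * of_nat (Suc n) powr (-1 - Complex x (\<mu> - \<nu>)))) =
         of_real (b4 n * w n x * (Q (u n - v) - Q (u n + v)))" by simp
    qed
    finally show ?thesis .
  qed
  have U_sums: "(\<lambda>n. of_real (w n x * (Q (u n - v) + Q (u n + v)))) sums U x" if x: "x > 0" for x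
  proof -
    have "(\<lambda>n. \<Sum>\<mu>\<in>E. \<Sum>\<nu>\<in>E. 2 * of_real (cos ((\<mu> - \<nu>) * v)) * of_nat (Suc n) powr (-1 - Complex x (\<mu> - \<nu>))) sums U x"
      unfolding U_def zeta_line_def using x
      by (intro sums_sum sums_mult summable_sums summable_norm_cancel[OF summable_zeta_line]) auto
    also have "(\<lambda>n. \<Sum>\<mu>\<in>E. \<Sum>\<nu>\<in>E. 2 * of_real (cos ((\<mu> - \<nu>) * v)) * of_nat (Suc n) powr (-1 - Complex x (\<mu> - \<nu>))) =
       (\<lambda>n. of_real (w n x * (Q (u n - v) + Q (u n + v))))"
    proof
      fix n
      have "2 * of_real (cos (y * v)) * (of_real (w n x) * cis (- y * u n)) =
          of_real (w n x) * (cis (- y * (u n - v)) + cis (- y * (u n + v)))" for y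
      proof -
        have "cis (- y * (u n - v)) + cis (- y * (u n + v)) = cis (- y * u n) * (cis (y * v) + cis (- (y * v)))"
          by (simp add: distrib_left cis_mult algebra_simps)
        also have "cis (y * v) + cis (- (y * v)) = 2 * of_real (cos (y * v))"
          by (simp add: complex_eq_iff)
        finally show ?thesis by simp
      qed
      hence "(\<Sum>\<mu>\<in>E. \<Sum>\<nu>\<in>E. 2 * of_real (cos ((\<mu> - \<nu>) * v)) * of_nat (Suc n) powr (-1 - Complex x (\<mu> - \<nu>))) =
         (\<Sum>\<mu>\<in>E. \<Sum>\<nu>\<in>E. of_real (w n x) * (cis (- (\<mu> - \<nu>) * (u n - v)) + cis (- (\<mu> - \<nu>) * (u n + v))))"
        unfolding pw by (intro sum.cong refl)
      also have "\<dots> = of_real (w n x) * (of_real (Q (u n - v)) + of_real (Q (u n + v)))"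
        unfolding Q sum.distrib [symmetric] sum_distrib_left by simp
      finally show "(\<Sum>\<mu>\<in>E. \<Sum>\<nu>\<in>E. 2 * of_real (cos ((\<mu> - \<nu>) * v)) * of_nat (Suc n) powr (-1 - Complex x (\<mu> - \<nu>))) =
         of_real (w n x * (Q (u n - v) + Q (u n + v)))" by simp
    qed
    finally show ?thesis .
  qed
  \<comment> \<open>Nonnegativity of Q gives |Q(u - v) - Q(u + v)| \<le> Q(u - v) + Q(u + v), and
    |\<open>b4\<close>| \<le> C.\<close>
  have bound: "norm (of_real x * T x) \<le> C * Re (of_real x * U x)" if x: "x > 0" for x
  proof -
    have "(\<lambda>n. w n x * (Q (u n - v) + Q (u n + v))) sums Re (U x)"
      using U_sums[OF x] by (auto simp: sums_complex_iff)
    hence s: "(\<lambda>n. C * (w n x * (Q (u n - v) + Q (u n + v)))) sums (C * Re (U x))" by (rule sums_mult)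
    have "norm (T x) = norm (\<Sum>n. complex_of_real (b4 n * w n x * (Q (u n - v) - Q (u n + v))))"
      using T_sums[OF x] by (simp only: sums_iff)
    also have "\<dots> \<le> (\<Sum>n. C * (w n x * (Q (u n - v) + Q (u n + v))))"
    proof (rule norm_suminf_le)
      fix n
      have "norm (complex_of_real (b4 n * w n x * (Q (u n - v) - Q (u n + v)))) = \<bar>b4 n\<bar> * (w n x * \<bar>Q (u n - v) - Q (u n + v)\<bar>)"
        by (simp only: norm_of_real abs_mult) (simp add: w_def)
      also have "\<dots> \<le> C * (w n x * (Q (u n - v) + Q (u n + v)))"
        using abs_b4_le[of n] Q0[of "u n - v"] Q0[of "u n + v"] C_nonneg
        by (intro mult_mono) (auto simp: w_def)
      finally show "norm (complex_of_real (b4 n * w n x * (Q (u n - v) - Q (u n + v)))) \<le> C * (w n x * (Q (u n - v) + Q (u n + v)))" .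
    qed (use s in \<open>simp add: sums_iff\<close>)
    also have "\<dots> = C * Re (U x)" using s by (simp add: sums_iff)
    finally have "x * norm (T x) \<le> x * (C * Re (U x))" using x by (intro mult_left_mono) auto
    thus ?thesis using x by (simp add: norm_mult mult_ac)
  qed
  define Tl where "Tl = (\<Sum>\<mu>\<in>E. \<Sum>\<nu>\<in>E. 2 * \<i> * of_real (sin ((\<mu> - \<nu>) * v)) * (- of_real (mult4 (\<mu> - \<nu>)) / (1/2 + \<i> * of_real (\<mu> - \<nu>))))"
  \<comment> \<open>In the limit only the diagonal survives in the unsigned mean, which is why the
    bound is linear in \<open>card E\<close>.\<close>
  define Ul where "Ul = (\<Sum>\<mu>\<in>E. \<Sum>\<nu>\<in>E. 2 * complex_of_real (cos ((\<mu> - \<nu>) * v)) * (if \<mu> - \<nu> = 0 then 1 else 0))"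
  have "((\<lambda>x. \<Sum>\<mu>\<in>E. \<Sum>\<nu>\<in>E. 2 * \<i> * of_real (sin ((\<mu> - \<nu>) * v)) * (of_real x * D4 (Complex x (\<mu> - \<nu>)))) \<longlongrightarrow> Tl) (at_right 0)"
    unfolding Tl_def by (intro tendsto_sum tendsto_mult tendsto_const D4_limit)
  also have "(\<lambda>x. \<Sum>\<mu>\<in>E. \<Sum>\<nu>\<in>E. 2 * \<i> * of_real (sin ((\<mu> - \<nu>) * v)) * (of_real x * D4 (Complex x (\<mu> - \<nu>)))) = (\<lambda>x. of_real x * T x)"
    by (simp add: T_def sum_distrib_left mult_ac)
  finally have Tlim: "((\<lambda>x. of_real x * T x) \<longlongrightarrow> Tl) (at_right 0)" .
  have "((\<lambda>x. \<Sum>\<mu>\<in>E. \<Sum>\<nu>\<in>E. 2 * of_real (cos ((\<mu> - \<nu>) * v)) * (of_real x * zeta_line (Complex x (\<mu> - \<nu>)))) \<longlongrightarrow> Ul) (at_right 0)"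
    unfolding Ul_def by (intro tendsto_sum tendsto_mult tendsto_const zeta_line_limit)
  also have "(\<lambda>x. \<Sum>\<mu>\<in>E. \<Sum>\<nu>\<in>E. 2 * of_real (cos ((\<mu> - \<nu>) * v)) * (of_real x * zeta_line (Complex x (\<mu> - \<nu>)))) = (\<lambda>x. of_real x * U x)"
    by (simp add: U_def sum_distrib_left mult_ac)
  finally have Ulim: "((\<lambda>x. of_real x * U x) \<longlongrightarrow> Ul) (at_right 0)" .
  have "norm Tl \<le> C * Re Ul"
  proof (rule tendsto_le)
    show "((\<lambda>x. norm (of_real x * T x)) \<longlongrightarrow> norm Tl) (at_right 0)" by (intro tendsto_norm Tlim)
    show "((\<lambda>x. C * Re (of_real x * U x)) \<longlongrightarrow> C * Re Ul) (at_right 0)" by (intro tendsto_intros Ulim)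
    show "eventually (\<lambda>x. norm (of_real x * T x) \<le> C * Re (of_real x * U x)) (at_right 0)"
      using eventually_at_right_less[of 0] by eventually_elim (rule bound)
  qed simp
  moreover have "Ul = 2 * of_nat (card E)"
  proof -
    have "Ul = (\<Sum>\<mu>\<in>E. \<Sum>\<nu>\<in>E. if \<nu> = \<mu> then 2 else 0)"
      unfolding Ul_def by (intro sum.cong refl) auto
    thus ?thesis using E by simp
  qed
  moreover have "- Re Tl = 2 * (\<Sum>\<mu>\<in>E. \<Sum>\<nu>\<in>E. mult4 (\<mu> - \<nu>) * ((\<mu> - \<nu>) * sin ((\<mu> - \<nu>) * v)) / (1/4 + (\<mu> - \<nu>)\<^sup>2))"
  proof -
    \<comment> \<open>The real part of i / (1/2 + i y) is y / (1/4 + y^2); multiplied by sin (y v)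
      it becomes even in y.\<close>
    have "- Re (2 * \<i> * of_real (sin (y * v)) * (- of_real (mult4 y) / (1/2 + \<i> * of_real y))) = 2 * (mult4 y * (y * sin (y * v)) / (1/4 + y\<^sup>2))" for y
    proof -
      have "2 * \<i> * of_real (sin (y * v)) * (- of_real (mult4 y) / (1/2 + \<i> * of_real y)) =
         of_real (- 2 * sin (y * v) * mult4 y) * (\<i> / (1/2 + \<i> * of_real y))" by simp
      also have "Re \<dots> = - 2 * sin (y * v) * mult4 y * Re (\<i> / (1/2 + \<i> * of_real y))"
        by (simp only: Re_complex_of_real times_complex.simps Im_complex_of_real mult_zero_left diff_zero)
      also have "Re (\<i> / (1/2 + \<i> * of_real y)) = y / (1/4 + y\<^sup>2)"
        by (simp add: Re_divide power2_eq_square)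
      finally show ?thesis by simp
    qed
    thus ?thesis unfolding Tl_def Re_sum sum_negf [symmetric] sum_distrib_left by (intro sum.cong refl)
  qed
  moreover have "- Re Tl \<le> norm Tl" using abs_Re_le_cmod[of Tl] by linarith
  ultimately show ?thesis by simp
qed

text \<open>Integration of the sine inequality over v from 0 to d, phrased as monotonicity of C |E|
  v minus the sum. The factors y sin(y v) have no fixed sign, but their integrals 1 - cos(y d) are
  nonnegative.\<close>

lemma cos_weighted_mult4_le:
  assumes E: "finite E" "E \<noteq> {}" and d: "d \<ge> 0"
  shows "(\<Sum>\<mu>\<in>E. \<Sum>\<nu>\<in>E. mult4 (\<mu> - \<nu>) * (1 - cos ((\<mu> - \<nu>) * d)) / (1/4 + (\<mu> - \<nu>)\<^sup>2)) \<le> C * card E * d"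
proof -
  let ?g = "\<lambda>v. (\<Sum>\<mu>\<in>E. \<Sum>\<nu>\<in>E. mult4 (\<mu> - \<nu>) * (1 - cos ((\<mu> - \<nu>) * v)) / (1/4 + (\<mu> - \<nu>)\<^sup>2))"
  let ?g' = "\<lambda>v. (\<Sum>\<mu>\<in>E. \<Sum>\<nu>\<in>E. mult4 (\<mu> - \<nu>) * ((\<mu> - \<nu>) * sin ((\<mu> - \<nu>) * v)) / (1/4 + (\<mu> - \<nu>)\<^sup>2))"
  have trm: "((\<lambda>v. m * (1 - cos (y * v)) / c) has_real_derivative m * (y * sin (y * v)) / c) (at v)" for m y c v :: real
    by (rule DERIV_cdivide) (auto intro!: derivative_eq_intros)
  have "(?g has_real_derivative ?g' v) (at v)" for v
    by (intro DERIV_sum trm)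
  hence "((\<lambda>v. C * card E * v - ?g v) has_real_derivative (C * card E - ?g' v)) (at v)" for v
    by (intro DERIV_diff) (auto intro!: derivative_eq_intros)
  hence "C * card E * 0 - ?g 0 \<le> C * card E * d - ?g d"
    using sin_weighted_mult4_le[OF E] d
    by (intro DERIV_nonneg_imp_nondecreasing[of 0 d "\<lambda>v. C * card E * v - ?g v"]) (auto intro!: exI)
  thus ?thesis by simp
qed

text \<open>By the choice of E, each \<gamma> in S is a difference of elements of E in at least
  |E|/2 ways. All other differences contribute nonnegative terms and are dropped; the half costs the
  factor 2.\<close>

lemma sum_mult4_le:
  assumes S: "finite S" and d: "d \<ge> 0"
  shows "(\<Sum>\<gamma>\<in>S. mult4 \<gamma> * (1 - cos (\<gamma> * d)) / (1/4 + \<gamma>\<^sup>2)) \<le> 2 * C * d"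
proof -
  let ?h = "\<lambda>\<gamma>. mult4 \<gamma> * (1 - cos (\<gamma> * d)) / (1/4 + \<gamma>\<^sup>2)"
  have h0: "?h \<gamma> \<ge> 0" for \<gamma>
    using mult4_nonneg[of \<gamma>] by (intro divide_nonneg_nonneg mult_nonneg_nonneg) auto
  obtain E where E: "finite E" "E \<noteq> {}" "\<And>\<gamma>. \<gamma> \<in> S \<Longrightarrow> card E \<le> 2 * card {\<nu>\<in>E. \<nu> + \<gamma> \<in> E}"
    using exists_Folner_set[OF S] by blast
  have "real (card E) * (\<Sum>\<gamma>\<in>S. ?h \<gamma>) = (\<Sum>\<gamma>\<in>S. real (card E) * ?h \<gamma>)" by (simp add: sum_distrib_left)
  also have "\<dots> \<le> (\<Sum>\<gamma>\<in>S. real (2 * card {\<nu>\<in>E. \<nu> + \<gamma> \<in> E}) * ?h \<gamma>)"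
    using E(3) h0 by (intro sum_mono mult_right_mono) (auto simp del: of_nat_mult)
  also have "\<dots> = 2 * (\<Sum>\<gamma>\<in>S. \<Sum>\<nu>\<in>{\<nu>\<in>E. \<nu> + \<gamma> \<in> E}. ?h \<gamma>)"
    by (simp add: sum_distrib_left mult_ac)
  also have "(\<Sum>\<gamma>\<in>S. \<Sum>\<nu>\<in>{\<nu>\<in>E. \<nu> + \<gamma> \<in> E}. ?h \<gamma>) = (\<Sum>(\<gamma>,\<nu>)\<in>(SIGMA \<gamma>:S. {\<nu>\<in>E. \<nu> + \<gamma> \<in> E}). ?h \<gamma>)"
    using S E(1) by (subst sum.Sigma) auto
  also have "\<dots> = (\<Sum>(\<mu>,\<nu>)\<in>{(\<mu>,\<nu>)\<in>E\<times>E. \<mu> - \<nu> \<in> S}. ?h (\<mu> - \<nu>))"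
    by (rule sum.reindex_bij_witness[of _ "\<lambda>(\<mu>,\<nu>). (\<mu> - \<nu>, \<nu>)" "\<lambda>(\<gamma>,\<nu>). (\<nu> + \<gamma>, \<nu>)"]) auto
  also have "\<dots> \<le> (\<Sum>(\<mu>,\<nu>)\<in>E\<times>E. ?h (\<mu> - \<nu>))"
    using E(1) h0 by (intro sum_mono2) auto
  also have "\<dots> = (\<Sum>\<mu>\<in>E. \<Sum>\<nu>\<in>E. ?h (\<mu> - \<nu>))" by (simp add: sum.cartesian_product)
  also have "\<dots> \<le> C * card E * d" by (rule cos_weighted_mult4_le) fact+
  finally have "real (card E) * (\<Sum>\<gamma>\<in>S. ?h \<gamma>) \<le> real (card E) * (2 * C * d)" by (simp add: mult_ac)
  moreover have "real (card E) > 0" using E by (simp add: card_gt_0_iff)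
  ultimately show ?thesis by (simp only: mult_le_cancel_left_pos)
qed

end

section \<open>The argument principle on a rectangle\<close>

text \<open>Half-angle formula with the crude bound sin x \<ge> x/2, valid on [0, 1/2] because cos
  exceeds cos(pi/3) there.\<close>

lemma one_minus_cos_ge:
  fixes t :: real
  assumes "\<bar>t\<bar> \<le> 1"
  shows "1 - cos t \<ge> t\<^sup>2 / 8"
proof -
  have *: "sin x \<ge> x / 2" if x: "0 \<le> x" "x \<le> 1/2" for x :: real
  proof (cases "x = 0")
    case False
    hence "x > 0" using x by simp
    then obtain y where y: "0 < y" "y < x" "sin x - sin 0 = (x - 0) * cos y"
      using MVT2[of 0 x sin cos] by (auto intro!: derivative_eq_intros)
    have "cos (pi / 3) \<le> cos y" using y x pi_gt3 by (intro cos_monotone_0_pi_le) auto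
    hence "x * (1/2) \<le> x * cos y" using x by (intro mult_left_mono) (auto simp: cos_60)
    thus ?thesis using y by simp
  qed simp
  have "(\<bar>t\<bar> / 2 / 2)\<^sup>2 \<le> (sin (\<bar>t\<bar> / 2))\<^sup>2"
    using *[of "\<bar>t\<bar> / 2"] assms by (intro power_mono) auto
  also have "2 * (sin (\<bar>t\<bar> / 2))\<^sup>2 = 1 - cos \<bar>t\<bar>"
    using cos_double_sin[of "\<bar>t\<bar> / 2"] by simp
  hence "(sin (\<bar>t\<bar> / 2))\<^sup>2 = (1 - cos t) / 2" by simp
  finally show ?thesis by (simp add: power_divide)
qed

lemma ln_4_over_pi: "0 \<le> ln (4 / pi)" "ln (4 / pi) \<le> 1"
proof -
  have "4 / pi \<ge> 1" using pi_less_4 by simp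
  thus "0 \<le> ln (4 / pi)" by (rule ln_ge_zero)
  have "ln (4 / pi) \<le> 4 / pi - 1" by (rule ln_le_minus_one) simp
  also have "4 / pi \<le> 2" using pi_gt3 by (simp add: field_simps)
  finally show "ln (4 / pi) \<le> 1" by simp
qed

context psi4_bounded
begin

text \<open>Re s = 5/2 corresponds to the right side Re z = 2 of the rectangle. The Dirichlet series
  converges absolutely there, giving a bound independent of height, whereas
  \<open>norm_H4_le\<close> grows with |s|.\<close>

lemma H4_bounded: "\<exists>B\<ge>0. \<forall>s. Re s = 5/2 \<longrightarrow> norm (H4 s) \<le> B"
proof -
  let ?a = "\<lambda>n s. of_real (chi4 (Suc n) * mangoldt (Suc n)) * of_nat (Suc n) powr (-s) :: complex"
  have nrm: "norm (?a n s) = norm (?a n (5/2))" if "Re s = 5/2" for n s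
    unfolding norm_mult norm_of_nat_Suc_powr uminus_complex.simps that by simp
  have su: "summable (\<lambda>n. norm (?a n (5/2)))"
    by (rule summable_dirichlet_norm[of "5/2" "\<lambda>n. of_real (chi4 n * mangoldt n)"])
       (simp, rule norm_chi4_mangoldt_le)
  have "norm (H4 s) \<le> (\<Sum>n. norm (?a n (5/2)))" if s: "Re s = 5/2" for s
  proof -
    have "H4 s = (\<Sum>n. ?a n s)" using H4_eq[of s] s by (simp add: sums_iff)
    also have "norm \<dots> \<le> (\<Sum>n. norm (?a n (5/2)))"
      by (rule norm_suminf_le[OF _ su]) (simp only: nrm[OF s])
    finally show ?thesis .
  qed
  moreover have "(\<Sum>n. norm (?a n (5/2))) \<ge> 0" by (intro suminf_nonneg su) auto
  ultimately show ?thesis by blast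
qed

text \<open>Compactness settles this once \<open>f4\<close> is nonconstant. If it were constant, its
  logarithmic derivative would vanish and express Digamma on Re w = 7/4 through bounded quantities,
  against its growth.\<close>

lemma finite_f4_zeros: "finite {\<gamma>::real. \<bar>\<gamma>\<bar> \<le> R \<and> f4 (\<i> * of_real \<gamma>) = 0}"
proof -
  have nc: "\<not> f4 constant_on UNIV"
  proof
    assume "f4 constant_on UNIV"
    then obtain c where c: "\<And>z. f4 z = c" by (auto simp: constant_on_def)
    have d: "deriv f4 z = 0" for z
      by (rule DERIV_imp_deriv, rule has_field_derivative_transform_within_open[OF DERIV_const[of c] open_UNIV])
         (use c in auto)
    obtain B where B: "\<And>s. Re s = 5/2 \<Longrightarrow> norm (H4 s) \<le> B" using H4_bounded by blast
    obtain Y where Y: "\<And>w. Re w = 7/4 \<Longrightarrow> \<bar>Im w\<bar> \<ge> Y \<Longrightarrow> Re (Digamma w) \<ge> 2 * B + 1"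
      using Re_Digamma_unbounded[of "7/4" "2 * B + 1"] by auto
    \<comment> \<open>Chosen so that z/2 + 3/4 has real part 7/4 and imaginary part |Y|.\<close>
    let ?z = "Complex 2 (2 * \<bar>Y\<bar>)"
    have "0 = of_real (ln (4/pi) / 2) + Digamma (?z / 2 + 3/4) / 2 - H4 (1/2 + ?z)"
      using f4_logderiv[of ?z] by (simp add: d)
    hence "0 = Re (of_real (ln (4/pi) / 2) + Digamma (?z / 2 + 3/4) / 2 - H4 (1/2 + ?z))" by simp
    hence "Re (Digamma (?z / 2 + 3/4)) = 2 * Re (H4 (1/2 + ?z)) - ln (4/pi)" by simp
    moreover have "Re (H4 (1/2 + ?z)) \<le> B" using B[of "1/2 + ?z"] abs_Re_le_cmod[of "H4 (1/2 + ?z)"] by simp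
    moreover have "Re (Digamma (?z / 2 + 3/4)) \<ge> 2 * B + 1" by (rule Y) auto
    ultimately show False using ln_4_over_pi by linarith
  qed
  have "finite {z \<in> cball 0 R. f4 z = 0}"
    by (rule holomorphic_compact_finite_zeros[OF f4_holomorphic open_UNIV connected_UNIV _ _ nc]) auto
  hence "finite ((\<lambda>z. Im z) ` {z \<in> cball 0 R. f4 z = 0})" by (rule finite_imageI)
  moreover have "{\<gamma>::real. \<bar>\<gamma>\<bar> \<le> R \<and> f4 (\<i> * of_real \<gamma>) = 0} \<subseteq> (\<lambda>z. Im z) ` {z \<in> cball 0 R. f4 z = 0}"
    by (auto intro!: image_eqI[where x = "\<i> * of_real x" for x] simp: norm_mult)
  ultimately show ?thesis by (rule finite_subset[rotated])
qed

text \<open>Take d = 1/R in \<open>sum_mult4_le\<close>: for 1 \<le> |\<gamma>| \<le> R the weight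
  is at least 1 / (10 R^2), while the right side is 2 C / R. Lower zeros, where the factor
  \<gamma>^2 / (1/4 + \<gamma>^2) degenerates, are collected in \<open>M0\<close>.\<close>

lemma sum_mult4_linear:
  "\<exists>M0\<ge>0. \<forall>R\<ge>1. \<forall>S\<subseteq>{\<gamma>. \<bar>\<gamma>\<bar> \<le> R \<and> f4 (\<i> * of_real \<gamma>) = 0}. (\<Sum>\<gamma>\<in>S. mult4 \<gamma>) \<le> 20 * C * R + M0"
proof -
  define Z where "Z = (\<lambda>R. {\<gamma>. \<bar>\<gamma>\<bar> \<le> R \<and> f4 (\<i> * of_real \<gamma>) = 0})"
  define M0 where "M0 = (\<Sum>\<gamma>\<in>Z 1. mult4 \<gamma>)"
  have fin: "finite (Z R)" for R unfolding Z_def by (rule finite_f4_zeros)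
  have "(\<Sum>\<gamma>\<in>S. mult4 \<gamma>) \<le> 20 * C * R + M0" if R: "R \<ge> 1" and S: "S \<subseteq> Z R" for R S
  proof -
    have fS: "finite S" using S fin finite_subset by blast
    let ?A = "{\<gamma>\<in>S. \<bar>\<gamma>\<bar> \<ge> 1}"
    have "(\<Sum>\<gamma>\<in>?A. mult4 \<gamma> / (10 * R\<^sup>2)) \<le> (\<Sum>\<gamma>\<in>?A. mult4 \<gamma> * (1 - cos (\<gamma> * (1 / R))) / (1/4 + \<gamma>\<^sup>2))"
    proof (rule sum_mono)
      fix \<gamma> assume g: "\<gamma> \<in> ?A"
      hence g1: "\<bar>\<gamma>\<bar> \<le> R" "\<gamma>\<^sup>2 \<ge> 1" using S by (auto simp: Z_def abs_square_le_1 power2_ge_1_iff)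
      have "\<bar>\<gamma> * (1/R)\<bar> \<le> 1" using g1 R by (simp add: abs_mult field_simps)
      hence "(\<gamma> * (1/R))\<^sup>2 / 8 \<le> 1 - cos (\<gamma> * (1/R))" by (rule one_minus_cos_ge)
      hence c: "\<gamma>\<^sup>2 / (8 * R\<^sup>2) \<le> 1 - cos (\<gamma> * (1/R))" by (simp add: power_mult_distrib power_divide)
      have pos: "1/4 + \<gamma>\<^sup>2 > 0" "R\<^sup>2 > 0" using g1 R by (auto intro: add_pos_nonneg)
      \<comment> \<open>The worst case is \<gamma>^2 = 1, and 8 (1/4 + 1) = 10.\<close>
      have "1 / 10 \<le> (\<gamma>\<^sup>2 / 8) / (1/4 + \<gamma>\<^sup>2)" using pos g1 by (simp add: field_simps)
      hence "1 / 10 / R\<^sup>2 \<le> (\<gamma>\<^sup>2 / 8) / (1/4 + \<gamma>\<^sup>2) / R\<^sup>2" using pos by (intro divide_right_mono) auto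
      also have "(\<gamma>\<^sup>2 / 8) / (1/4 + \<gamma>\<^sup>2) / R\<^sup>2 = (\<gamma>\<^sup>2 / (8 * R\<^sup>2)) / (1/4 + \<gamma>\<^sup>2)"
        by (simp only: divide_divide_eq_left mult_ac)
      finally have "1 / (10 * R\<^sup>2) \<le> (\<gamma>\<^sup>2 / (8 * R\<^sup>2)) / (1/4 + \<gamma>\<^sup>2)" by simp
      also have "\<dots> \<le> (1 - cos (\<gamma> * (1/R))) / (1/4 + \<gamma>\<^sup>2)" using c pos by (intro divide_right_mono) auto
      finally have "mult4 \<gamma> * (1 / (10 * R\<^sup>2)) \<le> mult4 \<gamma> * ((1 - cos (\<gamma> * (1/R))) / (1/4 + \<gamma>\<^sup>2))"
        using mult4_nonneg by (intro mult_left_mono) auto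
      thus "mult4 \<gamma> / (10 * R\<^sup>2) \<le> mult4 \<gamma> * (1 - cos (\<gamma> * (1 / R))) / (1/4 + \<gamma>\<^sup>2)" by simp
    qed
    also have "\<dots> \<le> 2 * C * (1 / R)" using fS R by (intro sum_mult4_le) auto
    finally have "(\<Sum>\<gamma>\<in>?A. mult4 \<gamma>) / (10 * R\<^sup>2) \<le> 2 * C / R" by (simp add: sum_divide_distrib)
    hence A: "(\<Sum>\<gamma>\<in>?A. mult4 \<gamma>) \<le> 20 * C * R" using R by (simp add: field_simps power2_eq_square)
    have B: "(\<Sum>\<gamma>\<in>S - ?A. mult4 \<gamma>) \<le> M0"
      unfolding M0_def using S mult4_nonneg by (intro sum_mono2 fin) (auto simp: Z_def)
    have "(\<Sum>\<gamma>\<in>S. mult4 \<gamma>) = (\<Sum>\<gamma>\<in>S - ?A. mult4 \<gamma>) + (\<Sum>\<gamma>\<in>?A. mult4 \<gamma>)"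
      by (rule sum.subset_diff) (use fS in auto)
    thus ?thesis using A B by simp
  qed
  moreover have "M0 \<ge> 0" unfolding M0_def by (intro sum_nonneg mult4_nonneg)
  ultimately show ?thesis unfolding Z_def by blast
qed

section \<open>The weighted contour integral\<close>

lemma exists_good_height: "\<exists>R\<ge>R0. f4 (\<i> * of_real R) \<noteq> 0"
proof (rule ccontr)
  assume "\<not> (\<exists>R\<ge>R0. f4 (\<i> * of_real R) \<noteq> 0)"
  hence "{R0..R0+1} \<subseteq> {\<gamma>::real. \<bar>\<gamma>\<bar> \<le> \<bar>R0\<bar> + 1 \<and> f4 (\<i> * of_real \<gamma>) = 0}" by auto
  hence "finite {R0..R0+1}" using finite_f4_zeros finite_subset by blast
  thus False using infinite_Icc[of R0 "R0 + 1"] by simp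
qed

definition logder4 :: "complex \<Rightarrow> complex" where
  "logder4 z = deriv f4 z / f4 z"

text \<open>
  The weight vanishes at \<open>\<plusminus>iR\<close>, which compensates the bound \<open>O(R / Re z)\<close> for the logarithmic
  derivative on the horizontal sides of the rectangle.
\<close>
definition wlog4 :: "real \<Rightarrow> complex \<Rightarrow> complex" where
  "wlog4 R z = deriv f4 z * ((of_real R)\<^sup>2 + z\<^sup>2) / f4 z"

lemma wlog4_eq: "wlog4 R z = logder4 z * ((of_real R)\<^sup>2 + z\<^sup>2)"
  by (simp add: wlog4_def logder4_def)

lemma wlog4_minus: "wlog4 R (-z) = - wlog4 R z"
  by (simp add: wlog4_def deriv_f4_minus f4_minus)

text \<open>Argument principle with test function R^2 + z^2, which is R^2 - \<gamma>^2 at z = i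
  \<gamma>. Oddness of the integrand makes opposite sides contribute equally, so the right and top
  sides suffice.\<close>

lemma wlog4_rectangle:
  assumes R: "R > 0" and nz: "f4 (\<i> * of_real R) \<noteq> 0"
  defines "ri \<equiv> contour_integral (linepath (Complex 2 (-R)) (Complex 2 R)) (wlog4 R)"
    and "to \<equiv> contour_integral (linepath (Complex 2 R) (Complex (-2) R)) (wlog4 R)"
  shows "2 * ri + 2 * to = 2 * pi * \<i> * of_real (\<Sum>\<gamma>\<in>{\<gamma>. \<bar>\<gamma>\<bar> < R \<and> f4 (\<i> * of_real \<gamma>) = 0}. (R\<^sup>2 - \<gamma>\<^sup>2) * mult4 \<gamma>)"
    and "wlog4 R contour_integrable_on linepath (Complex 2 (-R)) (Complex 2 R)"
    and "wlog4 R contour_integrable_on linepath (Complex 2 R) (Complex (-2) R)"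
proof -
  define a1 a2 a3 a4 where a: "a1 = Complex (-2) (-R)" "a2 = Complex 2 (-R)" "a3 = Complex 2 R" "a4 = Complex (-2) R"
  let ?P = "{z. Re z \<in> {-2, 2} \<and> Im z \<in> {-R..R}} \<union> {z. Im z \<in> {-R, R} \<and> Re z \<in> {-2..2}}"
  have pi: "path_image (rectpath a1 a3) = ?P"
    using R by (subst path_image_rectpath) (auto simp: a)
  have zero_im: "Re z = 0" if "f4 z = 0" for z using f4_nonzero[of z] that by blast
  have nzP: "f4 z \<noteq> 0" if "z \<in> ?P" for z
  proof
    assume z0: "f4 z = 0"
    hence r: "Re z = 0" by (rule zero_im)
    hence "z = \<i> * of_real R \<or> z = - (\<i> * of_real R)" using that by (auto simp: complex_eq_iff)
    thus False using z0 nz by (auto simp: f4_minus)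
  qed
  have hold: "deriv f4 holomorphic_on UNIV" by (intro holomorphic_deriv f4_holomorphic) auto
  have cont: "continuous_on ?P (wlog4 R)"
    unfolding wlog4_def [abs_def] using nzP
    by (intro continuous_intros holomorphic_on_imp_continuous_on[OF holomorphic_on_subset[OF hold]]
          holomorphic_on_imp_continuous_on[OF f4_holomorphic]) auto
  have seg: "closed_segment a1 a2 \<subseteq> ?P" "closed_segment a2 a3 \<subseteq> ?P" "closed_segment a3 a4 \<subseteq> ?P" "closed_segment a4 a1 \<subseteq> ?P"
  proof -
    have "path_image (rectpath a1 a3) = closed_segment a1 a2 \<union> closed_segment a2 a3 \<union> closed_segment a3 a4 \<union> closed_segment a4 a1"
      by (simp add: rectpath_def Let_def path_image_join a Un_assoc)
    thus "closed_segment a1 a2 \<subseteq> ?P" "closed_segment a2 a3 \<subseteq> ?P" "closed_segment a3 a4 \<subseteq> ?P" "closed_segment a4 a1 \<subseteq> ?P"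
      using pi by blast+
  qed
  have ci: "wlog4 R contour_integrable_on linepath a1 a2" "wlog4 R contour_integrable_on linepath a2 a3"
    "wlog4 R contour_integrable_on linepath a3 a4" "wlog4 R contour_integrable_on linepath a4 a1"
    using seg by (auto intro!: contour_integrable_continuous_linepath continuous_on_subset[OF cont])
  thus "wlog4 R contour_integrable_on linepath (Complex 2 (-R)) (Complex 2 R)"
    "wlog4 R contour_integrable_on linepath (Complex 2 R) (Complex (-2) R)" by (simp_all add: a)
  have neg: "contour_integral (linepath (-u) (-v)) (wlog4 R) = contour_integral (linepath u v) (wlog4 R)"
    if "wlog4 R contour_integrable_on linepath u v" for u v
  proof -
    have lp: "linepath (-u) (-v) = uminus \<circ> linepath u v"
      by (auto simp: fun_eq_iff linepath_def algebra_simps)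
    have "contour_integral (linepath (-u) (-v)) (wlog4 R) = - contour_integral (linepath u v) (\<lambda>z. wlog4 R (-z))"
      unfolding lp by (rule contour_integral_negatepath) simp
    also have "(\<lambda>z. wlog4 R (-z)) = (\<lambda>z. - wlog4 R z)" by (simp add: wlog4_minus)
    also have "contour_integral (linepath u v) (\<lambda>z. - wlog4 R z) = - contour_integral (linepath u v) (wlog4 R)"
      by (rule contour_integral_neg)
    finally show ?thesis by simp
  qed
  have m: "a1 = - a3" "a2 = - a4" by (simp_all add: a complex_eq_iff)
  have "contour_integral (rectpath a1 a3) (wlog4 R) =
     contour_integral (linepath a1 a2) (wlog4 R) + (contour_integral (linepath a2 a3) (wlog4 R) +
     (contour_integral (linepath a3 a4) (wlog4 R) + contour_integral (linepath a4 a1) (wlog4 R)))"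
  proof -
    have "rectpath a1 a3 = linepath a1 a2 +++ linepath a2 a3 +++ linepath a3 a4 +++ linepath a4 a1"
      by (simp add: rectpath_def Let_def a)
    thus ?thesis using ci by (simp add: valid_path_join)
  qed
  also have "contour_integral (linepath a1 a2) (wlog4 R) = to"
    using neg[OF ci(3)] by (simp add: to_def a complex_minus)
  also have "contour_integral (linepath a4 a1) (wlog4 R) = ri"
    using neg[OF ci(2)] by (simp add: ri_def a complex_minus)
  also have "contour_integral (linepath a2 a3) (wlog4 R) = ri" by (simp add: ri_def a)
  also have "contour_integral (linepath a3 a4) (wlog4 R) = to" by (simp add: to_def a)
  finally have sum: "contour_integral (rectpath a1 a3) (wlog4 R) = 2 * ri + 2 * to" by simp
  \<comment> \<open>The argument principle requires finitely many zeros in its domain, so the plane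
    is cut down to a disc containing the rectangle; zeros of the disc above or below the rectangle
    get winding number 0.\<close>
  define B where "B = R + 4"
  let ?pz = "{w \<in> ball 0 B. f4 w = 0 \<or> w \<in> {}}"
  let ?S = "{\<gamma>. \<bar>\<gamma>\<bar> < R \<and> f4 (\<i> * of_real \<gamma>) = 0}"
  let ?T = "{\<gamma>. \<bar>\<gamma>\<bar> < B \<and> f4 (\<i> * of_real \<gamma>) = 0}"
  have finT: "finite ?T" by (rule finite_subset[OF _ finite_f4_zeros[of B]]) auto
  have pz_eq: "?pz = (\<lambda>\<gamma>. \<i> * of_real \<gamma>) ` ?T"
  proof (intro equalityI subsetI)
    fix w assume w: "w \<in> ?pz"
    hence "Re w = 0" using zero_im by auto
    hence weq: "w = \<i> * of_real (Im w)" by (simp add: complex_eq_iff)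
    moreover have "norm w = \<bar>Im w\<bar>" using \<open>Re w = 0\<close> by (simp add: norm_complex_def)
    ultimately show "w \<in> (\<lambda>\<gamma>. \<i> * of_real \<gamma>) ` ?T" using w by (intro image_eqI[of _ _ "Im w"]) auto
  qed (auto simp: norm_mult)
  have box: "cbox a1 a3 \<subseteq> ball 0 B"
  proof
    fix z assume "z \<in> cbox a1 a3"
    hence "\<bar>Re z\<bar> \<le> 2" "\<bar>Im z\<bar> \<le> R" by (auto simp: in_cbox_complex_iff a)
    thus "z \<in> ball 0 B" using cmod_le[of z] by (simp add: B_def)
  qed
  have "contour_integral (rectpath a1 a3) (\<lambda>x. deriv f4 x * ((of_real R)\<^sup>2 + x\<^sup>2) / f4 x) =
     2 * pi * \<i> * (\<Sum>p\<in>?pz. winding_number (rectpath a1 a3) p * ((of_real R)\<^sup>2 + p\<^sup>2) * zorder f4 p)"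
  proof (rule argument_principle[where S = "ball 0 B" and poles = "{}"])
    show "path_image (rectpath a1 a3) \<subseteq> ball 0 B - ?pz"
      using path_image_rectpath_subset_cbox[of a1 a3] R box nzP unfolding pi by (auto simp: a)
    show "\<forall>z. z \<notin> ball 0 B \<longrightarrow> winding_number (rectpath a1 a3) z = 0"
      using box R by (auto intro!: winding_number_rectpath_outside simp: a)
    show "finite ?pz" unfolding pz_eq using finT by (rule finite_imageI)
  qed (auto intro!: f4_holomorphic holomorphic_intros)
  also have "(\<Sum>p\<in>?pz. winding_number (rectpath a1 a3) p * ((of_real R)\<^sup>2 + p\<^sup>2) * zorder f4 p) =
     (\<Sum>\<gamma>\<in>?T. winding_number (rectpath a1 a3) (\<i> * of_real \<gamma>) * ((of_real R)\<^sup>2 + (\<i> * of_real \<gamma>)\<^sup>2) * zorder f4 (\<i> * of_real \<gamma>))"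
    unfolding pz_eq by (subst sum.reindex) (auto simp: inj_on_def)
  also have "\<dots> = (\<Sum>\<gamma>\<in>?S. of_real ((R\<^sup>2 - \<gamma>\<^sup>2) * mult4 \<gamma>))"
  proof (rule sum.mono_neutral_cong_right[OF finT])
    show "?S \<subseteq> ?T" by (auto simp: B_def)
    show "\<forall>\<gamma>\<in>?T - ?S. winding_number (rectpath a1 a3) (\<i> * of_real \<gamma>) * ((of_real R)\<^sup>2 + (\<i> * of_real \<gamma>)\<^sup>2) * zorder f4 (\<i> * of_real \<gamma>) = 0"
    proof
      fix \<gamma> assume g: "\<gamma> \<in> ?T - ?S"
      hence "\<bar>\<gamma>\<bar> \<ge> R" "f4 (\<i> * of_real \<gamma>) = 0" by auto
      moreover have "\<bar>\<gamma>\<bar> \<noteq> R"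
      proof
        assume "\<bar>\<gamma>\<bar> = R"
        hence "\<gamma> = R \<or> \<gamma> = -R" by auto
        thus False using \<open>f4 (\<i> * of_real \<gamma>) = 0\<close> nz by (auto simp: f4_minus)
      qed
      ultimately have "\<i> * of_real \<gamma> \<notin> cbox a1 a3" by (auto simp: in_cbox_complex_iff a)
      hence "winding_number (rectpath a1 a3) (\<i> * of_real \<gamma>) = 0"
        using R by (intro winding_number_rectpath_outside) (auto simp: a)
      thus "winding_number (rectpath a1 a3) (\<i> * of_real \<gamma>) * ((of_real R)\<^sup>2 + (\<i> * of_real \<gamma>)\<^sup>2) * zorder f4 (\<i> * of_real \<gamma>) = 0" by simp
    qed
    fix \<gamma> assume g: "\<gamma> \<in> ?S"
    hence "winding_number (rectpath a1 a3) (\<i> * of_real \<gamma>) = 1"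
      by (intro winding_number_rectpath) (auto simp: in_box_complex_iff a)
    thus "winding_number (rectpath a1 a3) (\<i> * of_real \<gamma>) * ((of_real R)\<^sup>2 + (\<i> * of_real \<gamma>)\<^sup>2) * zorder f4 (\<i> * of_real \<gamma>) =
        of_real ((R\<^sup>2 - \<gamma>\<^sup>2) * mult4 \<gamma>)"
      by (simp add: mult4_def power_mult_distrib)
  qed
  finally show "2 * ri + 2 * to = 2 * pi * \<i> * of_real (\<Sum>\<gamma>\<in>?S. (R\<^sup>2 - \<gamma>\<^sup>2) * mult4 \<gamma>)"
    unfolding sum[symmetric] wlog4_def [abs_def] by simp
qed

lemma logder4_eq:
  assumes "Re z > 0"
  shows "logder4 z = of_real (ln (4/pi) / 2) + Digamma (z / 2 + 3/4) / 2 - H4 (1/2 + z)"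
  unfolding logder4_def by (rule f4_logderiv[OF assms])

lemma norm_Digamma_half_le:
  assumes "0 \<le> Re z" "Re z \<le> 2" "\<bar>Im z\<bar> \<le> R"
  shows "norm (Digamma (z / 2 + 3/4) / 2) \<le> 6 + R"
proof -
  have "norm (z / 2 + 3/4) \<le> \<bar>Re (z / 2 + 3/4)\<bar> + \<bar>Im (z / 2 + 3/4)\<bar>" by (rule cmod_le)
  also have "\<dots> \<le> 7/4 + R / 2" using assms by simp
  finally have n: "norm (z / 2 + 3/4) \<le> 7/4 + R / 2" .
  have "norm (Digamma (z / 2 + 3/4)) \<le> 4 * (norm (z / 2 + 3/4) + 1)"
    using assms by (intro Digamma_norm_le) auto
  with n show ?thesis by (simp add: norm_divide)
qed

text \<open>If |Im z| = R, then R^2 + z^2 = x (x + 2 i Im z) with x = Re z, so the weight supplies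
  exactly the factor x that cancels 1/x in the bound for \<open>H4\<close>. Negative x follows by
  oddness.\<close>

lemma wlog4_horizontal:
  assumes R: "R \<ge> 3" and z: "\<bar>Im z\<bar> = R" "\<bar>Re z\<bar> \<le> 2"
  shows "norm (wlog4 R z) \<le> (56 + 56 * C) * R\<^sup>2"
proof -
  have pos: "norm (wlog4 R z) \<le> (56 + 56 * C) * R\<^sup>2" if z: "\<bar>Im z\<bar> = R" "0 < Re z" "Re z \<le> 2" for z
  proof -
    let ?x = "Re z"
    have nz: "norm z \<le> 2 + R" using cmod_le[of z] z by simp
    have h: "norm ((of_real R)\<^sup>2 + z\<^sup>2) \<le> ?x * (2 + 2 * R)"
    proof -
      have "(of_real R)\<^sup>2 + z\<^sup>2 = of_real ?x * (of_real ?x + 2 * \<i> * of_real (Im z))"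
      proof -
        have "(Im z)\<^sup>2 = R\<^sup>2" using z(1) by (metis power2_abs)
        thus ?thesis by (simp add: complex_eq_iff power2_eq_square algebra_simps)
      qed
      also have "norm \<dots> = ?x * norm (of_real ?x + 2 * \<i> * of_real (Im z))" using z by (simp add: norm_mult)
      also have "norm (of_real ?x + 2 * \<i> * of_real (Im z)) \<le> 2 + 2 * R"
        using norm_triangle_ineq[of "of_real ?x" "2 * \<i> * of_real (Im z)"] z by (simp add: norm_mult)
      finally show ?thesis using z by (simp add: mult_left_mono)
    qed
    have H: "norm (H4 (1/2 + z)) \<le> C * (3 + R) * (3 / ?x)"
    proof -
      have "norm (H4 (1/2 + z)) \<le> C * norm (1/2 + z) * (1 + 1 / ?x)"
        using norm_H4_le[of "1/2 + z"] z by simp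
      also have "\<dots> \<le> C * (3 + R) * (3 / ?x)"
      proof (intro mult_mono mult_nonneg_nonneg)
        show "norm (1/2 + z) \<le> 3 + R" using norm_triangle_ineq[of "1/2" z] nz by simp
        show "1 + 1 / ?x \<le> 3 / ?x" using z by (simp add: field_simps)
      qed (use C_nonneg R z in auto)
      finally show ?thesis .
    qed
    have q: "norm (logder4 z) \<le> (7 + R) + C * (3 + R) * (3 / ?x)"
    proof -
      have "norm (logder4 z) \<le> norm (complex_of_real (ln (4/pi) / 2)) + norm (Digamma (z / 2 + 3/4) / 2) + norm (H4 (1/2 + z))"
        unfolding logder4_eq[OF z(2)] by (intro norm_triangle_le_diff add_mono norm_triangle_ineq order_refl)
      moreover have "norm (complex_of_real (ln (4/pi) / 2)) \<le> 1"
        using ln_4_over_pi unfolding norm_of_real by simp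
      moreover have "norm (Digamma (z / 2 + 3/4) / 2) \<le> 6 + R" using z by (intro norm_Digamma_half_le) auto
      ultimately show ?thesis using H by linarith
    qed
    have "norm (wlog4 R z) \<le> ((7 + R) + C * (3 + R) * (3 / ?x)) * (?x * (2 + 2 * R))"
      unfolding wlog4_eq norm_mult using q h z R C_nonneg
      by (intro mult_mono add_nonneg_nonneg mult_nonneg_nonneg) auto
    also have "\<dots> = (7 + R) * ?x * (2 + 2 * R) + C * (3 + R) * 3 * (2 + 2 * R)"
      using z by (simp add: field_simps)
    \<comment> \<open>From R \<ge> 3: 7 + R, 2 + 2 R and 3 + R are at most 4 R, 4 R and 2 R.\<close>
    also have "\<dots> \<le> (4 * R) * 2 * (4 * R) + C * (2 * R) * 3 * (4 * R)"
      using z R C_nonneg by (intro add_mono mult_mono mult_nonneg_nonneg) auto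
    also have "\<dots> = (32 + 24 * C) * R\<^sup>2" by (simp add: power2_eq_square algebra_simps)
    also have "\<dots> \<le> (56 + 56 * C) * R\<^sup>2" using C_nonneg by (intro mult_right_mono) auto
    finally show ?thesis .
  qed
  consider "Re z > 0" | "Re z < 0" | "Re z = 0" by linarith
  thus ?thesis
  proof cases
    case 1
    thus ?thesis using z by (intro pos) auto
  next
    case 2
    have "norm (wlog4 R (-z)) \<le> (56 + 56 * C) * R\<^sup>2" using 2 z by (intro pos) auto
    thus ?thesis by (simp add: wlog4_minus)
  next
    case 3
    have "(Im z)\<^sup>2 = R\<^sup>2" using z(1) by (metis power2_abs)
    hence "(of_real R)\<^sup>2 + z\<^sup>2 = 0" using 3 by (simp add: complex_eq_iff power2_eq_square)
    hence "wlog4 R z = 0" by (simp add: wlog4_def)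
    thus ?thesis using C_nonneg by simp
  qed
qed

text \<open>The parameters allow two uses: large K with c > 0 in the middle range of heights, and K
  = -1/2 with c = 0 elsewhere, matching the bound -1 of \<open>Re_Digamma_ge\<close>. The product of
  the imaginary parts, like the bounded \<open>H4\<close>, costs only O(R^2) pointwise.\<close>

lemma Re_wlog4_vertical:
  assumes B: "B \<ge> 0" "\<And>s. Re s = 5/2 \<Longrightarrow> norm (H4 s) \<le> B"
    and R: "R \<ge> 3" and y: "\<bar>y\<bar> \<le> R"
    and K: "Re (Digamma (Complex (7/4) (y/2))) \<ge> 2 * K" "K \<ge> -1/2"
    and c: "c \<ge> 0" "c * R\<^sup>2 \<le> (K + 1/2) * (R\<^sup>2 - y\<^sup>2)"
  shows "Re (wlog4 R (Complex 2 y)) \<ge> c * R\<^sup>2 - (14 + 6 * B) * R\<^sup>2"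
proof -
  let ?z = "Complex 2 y"
  let ?q = "logder4 ?z"
  have w: "?z / 2 + 3/4 = Complex (7/4) (y/2)" by (simp add: complex_eq_iff)
  have nB: "norm (H4 (1/2 + ?z)) \<le> B" by (rule B) simp
  have q: "?q = of_real (ln (4/pi) / 2) + Digamma (?z / 2 + 3/4) / 2 - H4 (1/2 + ?z)"
    by (rule logder4_eq) simp
  have Req: "Re ?q \<ge> K - B"
  proof -
    have "Re ?q = ln (4/pi) / 2 + Re (Digamma (Complex (7/4) (y/2))) / 2 - Re (H4 (1/2 + ?z))"
      unfolding q w by simp
    thus ?thesis using ln_4_over_pi K nB abs_Re_le_cmod[of "H4 (1/2 + ?z)"] by linarith
  qed
  have Imq: "\<bar>Im ?q\<bar> \<le> 6 + R + B"
  proof -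
    have "Im ?q = Im (Digamma (?z / 2 + 3/4) / 2) - Im (H4 (1/2 + ?z))" unfolding q by simp
    moreover have "\<bar>Im (Digamma (?z / 2 + 3/4) / 2)\<bar> \<le> 6 + R"
      using norm_Digamma_half_le[of ?z R] abs_Im_le_cmod[of "Digamma (?z / 2 + 3/4) / 2"] y by simp
    moreover have "\<bar>Im (H4 (1/2 + ?z))\<bar> \<le> B" using abs_Im_le_cmod[of "H4 (1/2 + ?z)"] nB by linarith
    ultimately show ?thesis by linarith
  qed
  have y2: "y\<^sup>2 \<le> R\<^sup>2" using y by (simp add: abs_le_square_iff [symmetric])
  have R9: "9 \<le> R\<^sup>2" using power_mono[of 3 R 2] R by simp
  have "(of_real R)\<^sup>2 + ?z\<^sup>2 = Complex (R\<^sup>2 + 4 - y\<^sup>2) (4 * y)"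
    by (simp add: complex_eq_iff power2_eq_square)
  hence eq: "Re (wlog4 R ?z) = Re ?q * (R\<^sup>2 + 4 - y\<^sup>2) - Im ?q * (4 * y)"
    by (simp add: wlog4_eq)
  have "(K - B) * (R\<^sup>2 + 4 - y\<^sup>2) \<le> Re ?q * (R\<^sup>2 + 4 - y\<^sup>2)"
    using Req y2 by (intro mult_right_mono) auto
  moreover have "(K - B) * (R\<^sup>2 + 4 - y\<^sup>2) \<ge> c * R\<^sup>2 - (1/2 + B) * (2 * R\<^sup>2)"
  proof -
    have "(K + 1/2) * (R\<^sup>2 - y\<^sup>2) \<le> (K + 1/2) * (R\<^sup>2 + 4 - y\<^sup>2)" using K by (intro mult_left_mono) auto
    moreover have "(1/2 + B) * (R\<^sup>2 + 4 - y\<^sup>2) \<le> (1/2 + B) * (2 * R\<^sup>2)"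
      using B R9 zero_le_power2[of y] by (intro mult_left_mono) linarith+
    moreover have "(K - B) * (R\<^sup>2 + 4 - y\<^sup>2) = (K + 1/2) * (R\<^sup>2 + 4 - y\<^sup>2) - (1/2 + B) * (R\<^sup>2 + 4 - y\<^sup>2)"
      by (simp add: algebra_simps)
    ultimately show ?thesis using c by linarith
  qed
  moreover have "Im ?q * (4 * y) \<le> (12 + 4 * B) * R\<^sup>2"
  proof -
    have "Im ?q * (4 * y) \<le> \<bar>Im ?q\<bar> * (4 * \<bar>y\<bar>)" by (metis abs_ge_self abs_mult abs_numeral)
    also have "\<dots> \<le> ((3 + B) * R) * (4 * R)"
    proof (intro mult_mono)
      have "B * 1 \<le> B * R" using B R by (intro mult_left_mono) auto
      thus "\<bar>Im ?q\<bar> \<le> (3 + B) * R" using Imq R by (simp add: algebra_simps)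
    qed (use y R B in auto)
    finally show ?thesis by (simp add: power2_eq_square algebra_simps)
  qed
  ultimately have "Re (wlog4 R ?z) \<ge> c * R\<^sup>2 - (1/2 + B) * (2 * R\<^sup>2) - (12 + 4 * B) * R\<^sup>2"
    unfolding eq by linarith
  also have "c * R\<^sup>2 - (1/2 + B) * (2 * R\<^sup>2) - (12 + 4 * B) * R\<^sup>2 = c * R\<^sup>2 - (13 + 6 * B) * R\<^sup>2"
    by (simp add: algebra_simps)
  also have "\<dots> \<ge> c * R\<^sup>2 - (14 + 6 * B) * R\<^sup>2" by (simp add: mult_right_mono)
  finally show ?thesis by simp
qed

lemma psi4_bound_contradiction: False
proof -
  obtain B where B: "B \<ge> 0" "\<And>s. Re s = 5/2 \<Longrightarrow> norm (H4 s) \<le> B" using H4_bounded by blast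
  obtain M0 where M0: "M0 \<ge> 0" "\<And>R S. R \<ge> 1 \<Longrightarrow> S \<subseteq> {\<gamma>. \<bar>\<gamma>\<bar> \<le> R \<and> f4 (\<i> * of_real \<gamma>) = 0} \<Longrightarrow> (\<Sum>\<gamma>\<in>S. mult4 \<gamma>) \<le> 20 * C * R + M0"
    using sum_mult4_linear by blast
  define P where "P = 14 + 6 * B"
  define c2 where "c2 = 56 + 56 * C"
  \<comment> \<open>W exceeds by 1 the sum of all competing coefficients of R^3, so the main
    contribution 2 W R^3 cannot be balanced.\<close>
  define W where "W = 4 * P + 8 * c2 + 7 * (20 * C + M0) + 1"
  have Wpos: "W > 0" unfolding W_def P_def c2_def using B C_nonneg M0 by (intro add_nonneg_pos add_nonneg_nonneg mult_nonneg_nonneg) auto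
  \<comment> \<open>For y in [R/4, R/2] one has R^2 - y^2 \<ge> R^2/2, so K = 8 W gives an integrand
    of at least 4 W R^2 up to the error; over length R/4 this integrates to W R^3.\<close>
  define K where "K = 2 * (4 * W)"
  have Kpos: "K \<ge> 0" using Wpos by (simp add: K_def)
  obtain Y where Y: "Y \<ge> 0" "\<And>w. Re w = 7/4 \<Longrightarrow> \<bar>Im w\<bar> \<ge> Y \<Longrightarrow> Re (Digamma w) \<ge> 2 * K"
    using Re_Digamma_unbounded[of "7/4" "2 * K"] by auto
  \<comment> \<open>The 8 Y ensures y/2 \<ge> R/8 \<ge> Y for y \<ge> R/4, the height at which
    Digamma is evaluated.\<close>
  obtain R where R: "R \<ge> 3 + 8 * Y" and nz: "f4 (\<i> * of_real R) \<noteq> 0" using exists_good_height by blast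
  have R3: "R \<ge> 3" using R Y by simp
  let ?S = "{\<gamma>. \<bar>\<gamma>\<bar> < R \<and> f4 (\<i> * of_real \<gamma>) = 0}"
  define ri where "ri = contour_integral (linepath (Complex 2 (-R)) (Complex 2 R)) (wlog4 R)"
  define to where "to = contour_integral (linepath (Complex 2 R) (Complex (-2) R)) (wlog4 R)"
  have rect: "2 * ri + 2 * to = 2 * pi * \<i> * of_real (\<Sum>\<gamma>\<in>?S. (R\<^sup>2 - \<gamma>\<^sup>2) * mult4 \<gamma>)"
    and ci: "wlog4 R contour_integrable_on linepath (Complex 2 (-R)) (Complex 2 R)"
      "wlog4 R contour_integrable_on linepath (Complex 2 R) (Complex (-2) R)"
    unfolding ri_def to_def using wlog4_rectangle[OF _ nz] R3 by auto
  have upper: "(\<Sum>\<gamma>\<in>?S. (R\<^sup>2 - \<gamma>\<^sup>2) * mult4 \<gamma>) \<le> R\<^sup>2 * (20 * C * R + M0)"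
  proof -
    have "(\<Sum>\<gamma>\<in>?S. (R\<^sup>2 - \<gamma>\<^sup>2) * mult4 \<gamma>) \<le> (\<Sum>\<gamma>\<in>?S. R\<^sup>2 * mult4 \<gamma>)"
      using mult4_nonneg by (intro sum_mono mult_right_mono) auto
    also have "\<dots> = R\<^sup>2 * (\<Sum>\<gamma>\<in>?S. mult4 \<gamma>)" by (simp add: sum_distrib_left)
    also have "\<dots> \<le> R\<^sup>2 * (20 * C * R + M0)" using R3 by (intro mult_left_mono M0) auto
    finally show ?thesis .
  qed
  have to_bound: "norm to \<le> 4 * c2 * R\<^sup>2"
  proof -
    have "norm to \<le> (c2 * R\<^sup>2) * norm (Complex (-2) R - Complex 2 R)"
      unfolding to_def
    proof (rule contour_integral_bound_linepath[OF ci(2)])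
      show "0 \<le> c2 * R\<^sup>2" using C_nonneg by (simp add: c2_def)
      fix x assume "x \<in> closed_segment (Complex 2 R) (Complex (-2) R)"
      hence "Im x = R" "Re x \<in> closed_segment 2 (-2)"
        by (auto simp: closed_segment_same_Im)
      thus "norm (wlog4 R x) \<le> c2 * R\<^sup>2" unfolding c2_def using R3
        by (intro wlog4_horizontal) (auto simp: closed_segment_eq_real_ivl)
    qed
    also have "norm (Complex (-2) R - Complex 2 R) = 4" by (simp add: norm_complex_def)
    finally show ?thesis by simp
  qed
  have ri_bound: "Im ri \<ge> (R / 4) * (8 * W * R\<^sup>2 / 2) - 2 * R * (P * R\<^sup>2)"
  proof -
    have "(wlog4 R has_contour_integral ri) (linepath (Complex 2 (-R)) (Complex 2 R))"
      unfolding ri_def using ci(1) by (rule has_contour_integral_integral)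
    \<comment> \<open>On the vertical side dz = i dy, so Im \<open>ri\<close> is the integral of the
      real part of the integrand.\<close>
    hence "((\<lambda>y. wlog4 R (Complex 2 y)) has_integral (- \<i> * ri)) {-R..R}"
      by (subst (asm) has_contour_integral_linepath_same_Re_iff[where c = 2 and a = "-R" and b = R]) (use R3 in auto)
    from has_integral_Re[OF this] have I: "((\<lambda>y. Re (wlog4 R (Complex 2 y))) has_integral Im ri) {-R..R}" by simp
    have "((\<lambda>y. if y \<in> {R/4..R/2} then 4 * W * R\<^sup>2 else 0) has_integral ((R/2 - R/4) *\<^sub>R (4 * W * R\<^sup>2))) {-R..R}"
      using R3 has_integral_const_real[of "4 * W * R\<^sup>2" "R/4" "R/2"]
      by (subst has_integral_restrict) auto
    moreover have "((\<lambda>y. P * R\<^sup>2) has_integral ((R - (-R)) *\<^sub>R (P * R\<^sup>2))) {-R..R}"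
      using R3 has_integral_const_real[of "P * R\<^sup>2" "-R" R] by simp
    ultimately have J: "((\<lambda>y. (if y \<in> {R/4..R/2} then 4 * W * R\<^sup>2 else 0) - P * R\<^sup>2) has_integral
        ((R/2 - R/4) *\<^sub>R (4 * W * R\<^sup>2) - (R - (-R)) *\<^sub>R (P * R\<^sup>2))) {-R..R}"
      by (rule has_integral_diff)
    have "(R/2 - R/4) *\<^sub>R (4 * W * R\<^sup>2) - (R - (-R)) *\<^sub>R (P * R\<^sup>2) \<le> Im ri"
    proof (rule has_integral_le[OF J I])
      fix y assume y: "y \<in> {-R..R}"
      hence yR: "\<bar>y\<bar> \<le> R" by auto
      show "(if y \<in> {R/4..R/2} then 4 * W * R\<^sup>2 else 0) - P * R\<^sup>2 \<le> Re (wlog4 R (Complex 2 y))"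
      proof (cases "y \<in> {R/4..R/2}")
        case True
        have "Re (Digamma (Complex (7/4) (y/2))) \<ge> 2 * K"
          using True R Y(1) by (intro Y(2)) auto
        moreover have "4 * W * R\<^sup>2 \<le> (K + 1/2) * (R\<^sup>2 - y\<^sup>2)"
        proof -
          have "y\<^sup>2 \<le> (R/2)\<^sup>2" using True R3 by (intro power_mono) auto
          moreover have "(R/2)\<^sup>2 = R\<^sup>2 / 4" by (simp add: power_divide)
          ultimately have "R\<^sup>2 / 2 \<le> R\<^sup>2 - y\<^sup>2" using zero_le_power2[of R] by linarith
          hence "K * (R\<^sup>2 / 2) \<le> (K + 1/2) * (R\<^sup>2 - y\<^sup>2)" using Kpos by (intro mult_mono) auto
          thus ?thesis by (simp add: K_def)
        qed
        ultimately have "Re (wlog4 R (Complex 2 y)) \<ge> (4 * W) * R\<^sup>2 - (14 + 6 * B) * R\<^sup>2"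
          using Kpos Wpos by (intro Re_wlog4_vertical[OF B R3 yR, where K = K]) auto
        thus ?thesis unfolding if_P[OF True] P_def by simp
      next
        case False
        have "Re (Digamma (Complex (7/4) (y/2))) \<ge> 2 * (-1/2)"
          using Re_Digamma_ge[of "Complex (7/4) (y/2)"] by simp
        hence "Re (wlog4 R (Complex 2 y)) \<ge> 0 * R\<^sup>2 - (14 + 6 * B) * R\<^sup>2"
          by (intro Re_wlog4_vertical[OF B R3 yR, where K = "-1/2"]) auto
        thus ?thesis unfolding if_not_P[OF False] P_def by simp
      qed
    qed
    thus ?thesis by simp
  qed
  have "2 * Im ri + 2 * Im to = 2 * pi * (\<Sum>\<gamma>\<in>?S. (R\<^sup>2 - \<gamma>\<^sup>2) * mult4 \<gamma>)"
    using arg_cong[OF rect, of Im] by simp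
  also have "\<dots> \<le> 7 * (R\<^sup>2 * (20 * C * R + M0))"
  proof -
    have "2 * pi * (\<Sum>\<gamma>\<in>?S. (R\<^sup>2 - \<gamma>\<^sup>2) * mult4 \<gamma>) \<le> 2 * pi * (R\<^sup>2 * (20 * C * R + M0))"
      using upper by (intro mult_left_mono) auto
    also have "\<dots> \<le> 7 * (R\<^sup>2 * (20 * C * R + M0))"
      using pi_approx C_nonneg M0 R3 by (intro mult_right_mono) auto
    finally show ?thesis .
  qed
  also have "\<dots> \<le> 7 * (20 * C + M0) * R ^ 3"
  proof -
    have "M0 * R\<^sup>2 * 1 \<le> M0 * R\<^sup>2 * R" using M0 R3 by (intro mult_left_mono) auto
    thus ?thesis by (simp add: power2_eq_square power3_eq_cube algebra_simps)
  qed
  finally have "2 * Im ri + 2 * Im to \<le> 7 * (20 * C + M0) * R ^ 3" .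
  moreover have "Im to \<ge> - (4 * c2 * R ^ 3)"
  proof -
    have c0: "c2 \<ge> 0" using C_nonneg by (simp add: c2_def)
    have "4 * c2 * R\<^sup>2 * 1 \<le> 4 * c2 * R\<^sup>2 * R" using R3 c0 by (intro mult_left_mono) auto
    hence "4 * c2 * R\<^sup>2 \<le> 4 * c2 * R ^ 3" by (simp add: power2_eq_square power3_eq_cube mult_ac)
    thus ?thesis using to_bound abs_Im_le_cmod[of to] by linarith
  qed
  moreover have "Im ri \<ge> W * R ^ 3 - 2 * P * R ^ 3"
    using ri_bound by (simp add: power2_eq_square power3_eq_cube mult_ac)
  moreover have "2 * a - 2 * c \<le> d" if "2 * r + 2 * t \<le> d" "t \<ge> - c" "r \<ge> a" for a c d r t :: real
    using that by linarith
  ultimately have "2 * (W * R ^ 3 - 2 * P * R ^ 3) - 2 * (4 * c2 * R ^ 3) \<le> 7 * (20 * C + M0) * R ^ 3" by blast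
  hence "(2 * W - (4 * P + 8 * c2 + 7 * (20 * C + M0))) * R ^ 3 \<le> 0" by (simp add: algebra_simps)
  moreover have "R ^ 3 > 0" using R3 by simp
  ultimately have "2 * W - (4 * P + 8 * c2 + 7 * (20 * C + M0)) \<le> 0" by (simp add: mult_le_0_iff)
  thus False using Wpos by (simp add: W_def)
qed

end

theorem psi4_unbounded: "\<exists>n>0. \<bar>psi4 n\<bar> > C * sqrt (real n)"
proof (rule ccontr)
  assume "\<not> ?thesis"
  then interpret psi4_bounded C by unfold_locales (meson not_less)
  show False by (rule psi4_bound_contradiction)
qed

section \<open>Chebyshev bound and the variance in progressions modulo powers of 2\<close>

lemma card_multiples: "card {k\<in>{1..n}. d dvd k} = n div d" if "d > 0" for n d :: nat
proof -
  have "bij_betw (\<lambda>i. d * i) {1..n div d} {k\<in>{1..n}. d dvd k}"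
    by (rule bij_betwI[where g = "\<lambda>k. k div d"])
       (use that in \<open>auto simp: less_eq_div_iff_mult_less_eq mult.commute div_le_mono Suc_le_eq div_greater_zero_iff dvd_imp_le\<close>)
  from bij_betw_same_card[OF this] show ?thesis by simp
qed

lemma ln_fact_eq_sum_mangoldt:
  "ln (fact n) = (\<Sum>d\<in>{1..n}. mangoldt d * real (n div d))"
proof -
  have "ln (fact n :: real) = (\<Sum>k\<in>{1..n}. ln (real k))"
    by (induction n) (simp_all add: ln_mult add.commute del: of_nat_Suc)
  also have "\<dots> = (\<Sum>k\<in>{1..n}. \<Sum>d | d dvd k. mangoldt d)"
    using mangoldt_sum[where ?'a = real] by (intro sum.cong) auto
  also have "\<dots> = (\<Sum>k\<in>{1..n}. \<Sum>d\<in>{d\<in>{1..n}. d dvd k}. mangoldt d)"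
    by (intro sum.cong refl) (auto intro: dvd_imp_le order_trans Nat.gr0I dest: dvd_imp_le simp: Suc_le_eq)
  also have "\<dots> = (\<Sum>d\<in>{1..n}. \<Sum>k\<in>{k\<in>{1..n}. d dvd k}. mangoldt d)"
    by (rule sum.swap_restrict) auto
  also have "\<dots> = (\<Sum>d\<in>{1..n}. mangoldt d * real (n div d))"
  proof (rule sum.cong)
    fix d assume "d \<in> {1..n}"
    hence "card {k\<in>{1..n}. d dvd k} = n div d" by (intro card_multiples) auto
    thus "(\<Sum>k\<in>{k\<in>{1..n}. d dvd k}. mangoldt d) = mangoldt d * real (n div d)"
      unfolding sum_constant by simp
  qed simp
  finally show ?thesis .
qed

text \<open>Compares \<open>n!\<close> with the square of \<open>(n div 2)!\<close> through the central binomial coefficient.\<close>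
lemma sum_mangoldt_le: "(\<Sum>k\<in>{1..n}. mangoldt k :: real) \<le> 4 * real n"
proof (induction n rule: less_induct)
  case (less n)
  show ?case
  proof (cases "n = 0")
    case False
    define m where "m = n div 2"
    have mn: "m < n" "2 * m \<le> n" "n \<le> 2 * m + 1" using False by (auto simp: m_def)
    \<comment> \<open>The floor difference is nonnegative for every k and equals 1 for m < k \<le> 2
      m, so the central binomial coefficient dominates the sum over that interval.\<close>
    have "(\<Sum>k\<in>{m+1..2*m}. mangoldt k :: real) \<le> (\<Sum>k\<in>{1..2*m}. mangoldt k * (real (2*m div k) - 2 * real (m div k)))"
    proof -
      have ge: "2 * real (m div k) \<le> real (2*m div k)" for k
      proof -
        have "2 * (m div k) \<le> 2 * m div k"
        proof (cases "k = 0")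
          case False
          have "2 * (m div k) * k \<le> 2 * m" using div_times_less_eq_dividend[of m k] by simp
          thus ?thesis using False by (simp add: less_eq_div_iff_mult_less_eq)
        qed simp
        thus ?thesis by (metis of_nat_le_iff of_nat_mult of_nat_numeral)
      qed
      have "(\<Sum>k\<in>{m+1..2*m}. mangoldt k :: real) = (\<Sum>k\<in>{m+1..2*m}. mangoldt k * (real (2*m div k) - 2 * real (m div k)))"
      proof (rule sum.cong)
        fix k assume k: "k \<in> {m+1..2*m}"
        hence "2 * m div k = 1" by (intro div_nat_eqI) auto
        moreover have "m div k = 0" using k by simp
        ultimately show "(mangoldt k :: real) = mangoldt k * (real (2*m div k) - 2 * real (m div k))" by simp
      qed simp
      also have "\<dots> \<le> (\<Sum>k\<in>{1..2*m}. mangoldt k * (real (2*m div k) - 2 * real (m div k)))"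
        using ge mangoldt_nonneg by (intro sum_mono2) auto
      finally show ?thesis .
    qed
    also have "\<dots> = (\<Sum>k\<in>{1..2*m}. mangoldt k * real (2*m div k)) - 2 * (\<Sum>k\<in>{1..2*m}. mangoldt k * real (m div k))"
      by (simp add: sum_subtractf sum_distrib_left algebra_simps)
    also have "(\<Sum>k\<in>{1..2*m}. mangoldt k * real (m div k)) = (\<Sum>k\<in>{1..m}. mangoldt k * real (m div k))"
      by (rule sum.mono_neutral_right) auto
    also have "(\<Sum>k\<in>{1..2*m}. mangoldt k * real (2*m div k)) - 2 * (\<Sum>k\<in>{1..m}. mangoldt k * real (m div k)) = ln (fact (2*m)) - 2 * ln (fact m)"
      by (simp add: ln_fact_eq_sum_mangoldt)
    also have "\<dots> \<le> real (2*m)"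
    proof -
      have "(fact (2*m) :: real) = fact m * fact m * real (2*m choose m)"
        using binomial_fact_lemma[of m "2*m"] by (metis diff_add_inverse le_add1 mult_2 of_nat_fact of_nat_mult)
      hence "ln (fact (2*m)) = 2 * ln (fact m) + ln (real (2*m choose m))"
        by (simp add: ln_mult)
      also have "ln (real (2*m choose m)) \<le> ln (2 ^ (2*m))"
      proof (subst ln_le_cancel_iff)
        show "real (2*m choose m) \<le> 2 ^ (2*m)"
          using binomial_le_pow2[of "2*m" m] by (metis of_nat_le_iff of_nat_numeral of_nat_power)
      qed auto
      also have "ln (2 ^ (2*m) :: real) = real (2*m) * ln 2" by (simp add: ln_realpow)
      also have "\<dots> \<le> real (2*m) * 1" using ln_2_less_1 by (intro mult_left_mono) auto
      finally show ?thesis by simp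
    qed
    finally have 1: "(\<Sum>k\<in>{m+1..2*m}. mangoldt k :: real) \<le> real (2*m)" .
    have "(\<Sum>k\<in>{1..n}. mangoldt k :: real) \<le> (\<Sum>k\<in>{1..2*m}. mangoldt k) + ln n"
    proof (cases "n = 2 * m")
      case True thus ?thesis using False by simp
    next
      case False
      hence n: "n = Suc (2*m)" using mn by simp
      show ?thesis unfolding n using mangoldt_le[of "Suc (2*m)"] by (simp del: of_nat_Suc)
    qed
    also have "(\<Sum>k\<in>{1..2*m}. mangoldt k :: real) = (\<Sum>k\<in>{1..m}. mangoldt k) + (\<Sum>k\<in>{m+1..2*m}. mangoldt k)"
      using sum.ub_add_nat[of 1 m "mangoldt :: nat \<Rightarrow> real" m] by (simp add: mult_2)
    also have "\<dots> \<le> 4 * real m + real (2*m)" using less.IH[OF mn(1)] 1 by (intro add_mono)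
    also have "ln (real n) \<le> real n - 1" using False by (intro ln_le_minus_one) auto
    finally have "(\<Sum>k\<in>{1..n}. mangoldt k :: real) \<le> 4 * real m + real (2*m) + (real n - 1)" by simp
    \<comment> \<open>The total 4 m + 2 m + (n - 1) is at most 4 n - 1, which closes the
      induction.\<close>
    moreover have "2 * real m \<le> real n" using mn(2) by linarith
    ultimately show ?thesis by simp
  qed simp
qed

section \<open>From prime powers to primes\<close>

definition theta4 :: "nat \<Rightarrow> real" where
  "theta4 n = (\<Sum>p\<in>{p\<in>{1..n}. prime p}. chi4 p * ln (real p))"

text \<open>
  A proper prime power is \<open>m\<^sup>2\<close> or \<open>m\<^sup>2 p\<close> for a smaller power \<open>m\<close> of the same prime \<open>p\<close>, so it is
  counted by \<open>\<Lambda>(m)\<close> with \<open>m \<le> \<surd>n\<close>.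
\<close>
lemma psi4_theta4: "\<bar>psi4 n - theta4 n\<bar> \<le> 8 * sqrt (real n)"
proof -
  define s where "s = nat \<lfloor>sqrt (real n)\<rfloor>"
  define A where "A = {k\<in>{1..n}. primepow k \<and> \<not> prime k}"
  define B where "B = {m\<in>{1..s}. primepow m}"
  let ?f1 = "\<lambda>m::nat. m ^ 2" and ?f2 = "\<lambda>m::nat. m ^ 2 * aprimedivisor m"
  have "psi4 n = (\<Sum>k\<in>{p\<in>{1..n}. prime p}. chi4 k * mangoldt k) + (\<Sum>k\<in>{1..n} - {p\<in>{1..n}. prime p}. chi4 k * mangoldt k)"
    unfolding psi4_def by (subst sum.subset_diff[of "{p\<in>{1..n}. prime p}"]) auto
  also have "(\<Sum>k\<in>{p\<in>{1..n}. prime p}. chi4 k * mangoldt k) = theta4 n"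
    unfolding theta4_def by (intro sum.cong) auto
  also have "(\<Sum>k\<in>{1..n} - {p\<in>{1..n}. prime p}. chi4 k * mangoldt k) = (\<Sum>k\<in>A. chi4 k * mangoldt k)"
    by (rule sum.mono_neutral_right) (auto simp: A_def mangoldt_def)
  finally have "\<bar>psi4 n - theta4 n\<bar> = \<bar>\<Sum>k\<in>A. chi4 k * mangoldt k\<bar>" by simp
  also have "\<dots> \<le> (\<Sum>k\<in>A. \<bar>chi4 k * mangoldt k\<bar>)" by (rule sum_abs)
  also have "\<dots> \<le> (\<Sum>k\<in>A. 1 * mangoldt k)"
    unfolding abs_mult using abs_chi4_le mangoldt_nonneg by (intro sum_mono mult_mono) auto
  also have "\<dots> = (\<Sum>k\<in>A. mangoldt k)" by simp
  also have "\<dots> \<le> (\<Sum>k\<in>?f1 ` B \<union> ?f2 ` B. mangoldt k)"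
  proof (rule sum_mono2)
    show "A \<subseteq> ?f1 ` B \<union> ?f2 ` B"
    proof
      fix k assume k: "k \<in> A"
      then obtain p i where p: "prime p" "i > 0" "k = p ^ i" by (auto simp: A_def primepow_def)
      have "i \<noteq> 1" using k p by (auto simp: A_def)
      define m where "m = p ^ (i div 2)"
      have i2: "i div 2 > 0" using p(2) \<open>i \<noteq> 1\<close> by linarith
      have p0: "p > 0" using p(1) prime_gt_0_nat by blast
      have "m ^ 2 \<le> k" unfolding m_def p(3) power_mult [symmetric] using p0 by (intro power_increasing) auto
      also have "k \<le> n" using k by (simp add: A_def)
      finally have "real m ^ 2 \<le> real n" by (metis of_nat_le_iff of_nat_power)
      hence "real m \<le> sqrt (real n)" by (intro real_le_rsqrt)
      hence ms: "m \<le> s" unfolding s_def by (intro le_nat_floor)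
      have mB: "m \<in> B" using ms p i2 p0 by (auto simp: B_def m_def primepow_def Suc_le_eq)
      have ap: "aprimedivisor m = p" unfolding m_def using p(1) i2 by (intro aprimedivisor_prime_power) auto
      show "k \<in> ?f1 ` B \<union> ?f2 ` B"
      proof (cases "even i")
        case True
        hence "k = m ^ 2" by (simp add: m_def p(3) power_mult [symmetric])
        thus ?thesis using mB by blast
      next
        case False
        hence "i = Suc (2 * (i div 2))" by presburger
        hence "k = m ^ 2 * p" unfolding m_def p(3) power_mult [symmetric] by (metis mult.commute power_Suc)
        thus ?thesis using mB ap by blast
      qed
    qed
  qed (auto simp: B_def mangoldt_nonneg)
  also have "\<dots> \<le> (\<Sum>k\<in>?f1 ` B. mangoldt k) + (\<Sum>k\<in>?f2 ` B. mangoldt k)"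
    by (subst sum_Un) (auto simp: B_def intro!: sum_nonneg mangoldt_nonneg)
  also have "\<dots> \<le> (\<Sum>m\<in>B. mangoldt (?f1 m)) + (\<Sum>m\<in>B. mangoldt (?f2 m))"
    using mangoldt_nonneg by (intro add_mono sum_image_le[unfolded o_def]) (auto simp: B_def)
  also have "\<dots> = (\<Sum>m\<in>B. mangoldt m) + (\<Sum>m\<in>B. mangoldt m)"
  proof -
    have "mangoldt (?f1 m) = (mangoldt m :: real) \<and> mangoldt (?f2 m) = (mangoldt m :: real)" if "m \<in> B" for m
    proof -
      obtain p i where p: "prime p" "i > 0" "m = p ^ i" using \<open>m \<in> B\<close> by (auto simp: B_def primepow_def)
      have "aprimedivisor m = p" unfolding p(3) using p by (intro aprimedivisor_prime_power) auto
      moreover have "m ^ 2 = p ^ (2 * i)" "m ^ 2 * p = p ^ Suc (2 * i)" unfolding p(3) by (simp_all add: power_mult [symmetric] mult.commute)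
      ultimately show ?thesis using p by (simp add: mangoldt_primepow' del: power_Suc)
    qed
    thus ?thesis by simp
  qed
  also have "\<dots> \<le> 4 * real s + 4 * real s"
  proof -
    have "(\<Sum>m\<in>B. mangoldt m :: real) \<le> (\<Sum>m\<in>{1..s}. mangoldt m)"
      by (rule sum_mono2) (auto simp: B_def mangoldt_nonneg)
    thus ?thesis using sum_mangoldt_le[of s] by linarith
  qed
  also have "real s \<le> sqrt (real n)" unfolding s_def by simp
  finally show ?thesis by simp
qed

text \<open>A constant exceeding every |\<open>psi4 m\<close>| with m \<le> M forces the extremal n
  beyond M. The extra 8 absorbs the difference of \<open>psi4\<close> and \<open>theta4\<close>, so
  one n serves both.\<close>

lemma psi4_theta4_large: "\<exists>n>M. \<bar>psi4 n\<bar> > D * sqrt (real n) \<and> \<bar>theta4 n\<bar> > D * sqrt (real n)"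
proof -
  define A where "A = (\<Sum>m\<in>{1..M}. \<bar>psi4 m\<bar>)"
  define E where "E = max (\<bar>D\<bar> + 8) A"
  obtain n where n: "n > 0" "\<bar>psi4 n\<bar> > E * sqrt (real n)" using psi4_unbounded by blast
  have E0: "E \<ge> 0" by (simp add: E_def)
  have "n > M"
  proof (rule ccontr)
    assume "\<not> n > M"
    hence "\<bar>psi4 n\<bar> \<le> A" unfolding A_def using n by (intro member_le_sum) auto
    also have "A \<le> E * 1" by (simp add: E_def)
    also have "\<dots> \<le> E * sqrt (real n)" using n E0 by (intro mult_left_mono) auto
    finally show False using n by simp
  qed
  have "(\<bar>D\<bar> + 8) * sqrt (real n) \<le> E * sqrt (real n)" by (intro mult_right_mono) (auto simp: E_def)
  hence "\<bar>psi4 n\<bar> > (\<bar>D\<bar> + 8) * sqrt (real n)" using n by linarith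
  hence 1: "\<bar>psi4 n\<bar> > \<bar>D\<bar> * sqrt (real n) + 8 * sqrt (real n)" by (simp add: distrib_right)
  have 2: "D * sqrt (real n) \<le> \<bar>D\<bar> * sqrt (real n)" by (intro mult_right_mono) auto
  have "\<bar>psi4 n\<bar> > D * sqrt (real n)" using 1 2 real_sqrt_ge_zero[of "real n"] by linarith
  moreover have "\<bar>theta4 n\<bar> > D * sqrt (real n)" using 1 2 psi4_theta4[of n] by linarith
  ultimately show ?thesis using \<open>n > M\<close> by blast
qed

section \<open>Lower bounds for the variances\<close>

lemma vonMangoldt_eq: "vonMangoldt n = mangoldt n"
proof (cases "primepow n")
  case True
  then obtain p k where p: "prime p" "k > 0" "n = p ^ k" by (auto simp: primepow_def)
  have "(THE p. prime p \<and> (\<exists>k\<ge>1. n = p ^ k)) = aprimedivisor n"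
  proof (rule the_equality)
    show "prime (aprimedivisor n) \<and> (\<exists>k\<ge>1. n = aprimedivisor n ^ k)"
      using p aprimedivisor_prime_power[of p k] by (auto simp: Suc_le_eq)
    fix r assume "prime r \<and> (\<exists>k\<ge>1. n = r ^ k)"
    thus "r = aprimedivisor n" using aprimedivisor_prime_power[of r] by (auto simp: Suc_le_eq)
  qed
  moreover have "\<exists>p k. prime p \<and> k \<ge> 1 \<and> n = p ^ k" using p by (auto simp: Suc_le_eq)
  ultimately show ?thesis using True by (simp add: vonMangoldt_def mangoldt_def)
next
  case False
  hence "\<not> (\<exists>p k. prime p \<and> k \<ge> 1 \<and> n = p ^ k)" by (auto simp: primepow_def Suc_le_eq)
  hence "vonMangoldt n = 0" unfolding vonMangoldt_def by (rule if_not_P)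
  thus ?thesis using False by (simp add: mangoldt_def)
qed

lemma sum_chi4_lessThan: "(\<Sum>a<4*m. chi4 a) = 0"
proof (induction m)
  case (Suc m)
  have "{..<4 * Suc m} = {..<4*m} \<union> {4*m, 4*m+1, 4*m+2, 4*m+3}" by auto
  hence "(\<Sum>a<4 * Suc m. chi4 a) = (\<Sum>a<4*m. chi4 a) + (\<Sum>a\<in>{4*m, 4*m+1, 4*m+2, 4*m+3}. chi4 a)"
    by (simp only:) (rule sum.union_disjoint, auto)
  moreover have "(\<Sum>a\<in>{4*m, 4*m+1, 4*m+2, 4*m+3}. chi4 a) = 0"
    by (simp add: chi4_def mod_Suc)
  ultimately show ?case using Suc by simp
qed simp

lemma chi4_even: "even a \<Longrightarrow> chi4 a = 0"
proof -
  assume "even a"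
  hence "a mod 4 \<noteq> 1" "a mod 4 \<noteq> 3" by presburger+
  thus ?thesis by (simp add: chi4_def)
qed

lemma chi4_mod: "4 dvd q \<Longrightarrow> chi4 (n mod q) = chi4 n"
  by (simp add: chi4_def mod_mod_cancel)

text \<open>Pairing with \<open>chi4\<close> annihilates the constant c because \<open>chi4\<close>
  sums to 0 over the reduced residues, so one inequality covers both centrings, x / phi(q) and the
  average of Lambda. For q a power of 2 the reduced residues are the odd ones, exactly the support
  of \<open>chi4\<close>.\<close>

lemma variance_ge:
  fixes w :: "nat \<Rightarrow> real" and c :: real
  assumes q: "q = 2 ^ j" "j \<ge> 2" and T: "finite T"
  shows "(\<Sum>n\<in>T. chi4 n * w n)\<^sup>2 \<le>
           real q * (\<Sum>a\<in>{a. a < q \<and> coprime a q}. ((\<Sum>n\<in>{n\<in>T. n mod q = a}. w n) - c)\<^sup>2)"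
proof -
  let ?U = "{a. a < q \<and> coprime a q}"
  let ?d = "\<lambda>a. (\<Sum>n\<in>{n\<in>T. n mod q = a}. w n) - c"
  have q4: "4 dvd q" using q le_imp_power_dvd[of 2 j "2::nat"] by simp
  have q0: "q > 0" using q by simp
  have U: "?U = {a. a < q \<and> odd a}" using q by (auto simp: coprime_commute)
  have fU: "finite ?U" by auto
  have "(\<Sum>a\<in>?U. chi4 a) = (\<Sum>a<q. chi4 a)"
    unfolding U by (rule sum.mono_neutral_left) (auto simp: chi4_even)
  also have "\<dots> = 0" using q4 sum_chi4_lessThan by (auto elim!: dvdE)
  finally have s0: "(\<Sum>a\<in>?U. chi4 a) = 0" .
  have "(\<Sum>a\<in>?U. chi4 a * ?d a) = (\<Sum>a\<in>?U. \<Sum>n\<in>{n\<in>T. n mod q = a}. chi4 a * w n) - c * (\<Sum>a\<in>?U. chi4 a)"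
    by (simp add: right_diff_distrib sum_subtractf sum_distrib_left mult.commute)
  also have "\<dots> = (\<Sum>a\<in>?U. \<Sum>n\<in>{n\<in>T. n mod q = a}. chi4 n * w n)"
    unfolding s0 using chi4_mod[OF q4] by (auto intro!: sum.cong)
  also have "\<dots> = (\<Sum>a<q. \<Sum>n\<in>{n\<in>T. n mod q = a}. chi4 n * w n)"
  proof (rule sum.mono_neutral_left)
    show "\<forall>a\<in>{..<q} - ?U. (\<Sum>n\<in>{n\<in>T. n mod q = a}. chi4 n * w n) = 0"
    proof
      fix a assume "a \<in> {..<q} - ?U"
      hence "chi4 a = 0" unfolding U by (auto intro: chi4_even)
      thus "(\<Sum>n\<in>{n\<in>T. n mod q = a}. chi4 n * w n) = 0"
        using chi4_mod[OF q4] by (intro sum.neutral) auto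
    qed
  qed auto
  also have "\<dots> = (\<Sum>n\<in>T. chi4 n * w n)"
    using q0 T by (intro sum.group) auto
  finally have "(\<Sum>n\<in>T. chi4 n * w n)\<^sup>2 = (\<Sum>a\<in>?U. chi4 a * ?d a)\<^sup>2" by simp
  also have "\<dots> \<le> (\<Sum>a\<in>?U. (chi4 a)\<^sup>2) * (\<Sum>a\<in>?U. (?d a)\<^sup>2)"
    by (rule Cauchy_Schwarz_ineq_sum)
  also have "\<dots> \<le> real q * (\<Sum>a\<in>?U. (?d a)\<^sup>2)"
  proof (rule mult_right_mono)
    have "(\<Sum>a\<in>?U. (chi4 a)\<^sup>2) \<le> (\<Sum>a\<in>?U. 1)"
      by (intro sum_mono) (simp add: chi4_def)
    also have "\<dots> \<le> real q"
      using card_mono[of "{..<q}" ?U] by auto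
    finally show "(\<Sum>a\<in>?U. (chi4 a)\<^sup>2) \<le> real q" .
  qed (auto intro: sum_nonneg)
  finally show ?thesis .
qed

lemma G_ge:
  assumes "q = 2 ^ j" "j \<ge> 2"
  shows "(theta4 N)\<^sup>2 \<le> real q * G (real N) q"
proof -
  let ?T = "{p\<in>{1..N}. prime p}"
  have "{p. prime p \<and> real p \<le> real N \<and> p mod q = a} = {n\<in>?T. n mod q = a}" for a
    by (auto simp: prime_ge_Suc_0_nat)
  thus ?thesis using variance_ge[OF assms, of ?T "\<lambda>p. ln (real p)" "real N / real (totient q)"]
    by (simp add: theta4_def G_def)
qed

lemma V_Lambda_ge:
  assumes "q = 2 ^ j" "j \<ge> 2"
  shows "(psi4 N)\<^sup>2 \<le> real q * V_Lambda (real N) q"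
proof -
  have "{n. 1 \<le> n \<and> real n \<le> real N \<and> n mod q = a} = {n\<in>{1..N}. n mod q = a}" for a by auto
  thus ?thesis using variance_ge[OF assms, of "{1..N}" mangoldt
      "(1 / real (totient q)) * (\<Sum>n\<in>{n. 1 \<le> n \<and> real n \<le> real N \<and> coprime n q}. vonMangoldt n)"]
    by (simp add: psi4_def V_Lambda_def vonMangoldt_eq)
qed

theorem theorem1p1:
  shows "(\<exists>(q::nat \<Rightarrow> nat) (x::nat \<Rightarrow> real).
            (\<forall>j. 3 \<le> q j \<and> real (q j) < x j) \<and>
            filterlim q at_top sequentially \<and> filterlim x at_top sequentially \<and>
            filterlim (\<lambda>j. G (x j) (q j) / (x j * ln (real (q j)))) at_top sequentially)
       \<and> (\<exists>(q::nat \<Rightarrow> nat) (x::nat \<Rightarrow> real).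
            (\<forall>j. 3 \<le> q j \<and> real (q j) < x j) \<and>
            filterlim q at_top sequentially \<and> filterlim x at_top sequentially \<and>
            filterlim (\<lambda>j. V_Lambda (x j) (q j) / (x j * ln (real (q j)))) at_top sequentially)"
proof -
  define q where "q = (\<lambda>j::nat. 2 ^ (j + 2) :: nat)"
  \<comment> \<open>With |t| > D sqrt(N), the bound t^2 \<le> q F yields F \<ge> j N ln q, so the
    normalised variance is at least j.\<close>
  define D where "D = (\<lambda>j. sqrt (real j * real (q j) * ln (real (q j))))"
  have "\<exists>n>q j. \<bar>psi4 n\<bar> > D j * sqrt (real n) \<and> \<bar>theta4 n\<bar> > D j * sqrt (real n)" for j
    by (rule psi4_theta4_large)
  then obtain N where N: "\<And>j. N j > q j" "\<And>j. \<bar>psi4 (N j)\<bar> > D j * sqrt (real (N j))"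
      "\<And>j. \<bar>theta4 (N j)\<bar> > D j * sqrt (real (N j))" by metis
  have q_gt: "j < q j" "4 \<le> q j" for j
  proof -
    have "j < 2 ^ j" by simp
    also have "(2::nat) ^ j \<le> q j" by (simp add: q_def)
    finally show "j < q j" .
    have "(2::nat) ^ 2 \<le> q j" unfolding q_def by (intro power_increasing) auto
    thus "4 \<le> q j" by simp
  qed
  have q_lim: "filterlim q at_top sequentially"
    by (rule filterlim_at_top_mono[OF filterlim_ident]) (auto intro!: always_eventually less_imp_le q_gt)
  have x_lim: "filterlim (\<lambda>j. real (N j)) at_top sequentially"
    by (rule filterlim_at_top_mono[OF filterlim_real_sequentially])
       (use q_gt N(1) in \<open>auto intro!: always_eventually less_imp_le intro: less_trans\<close>)
  have large: "real j \<le> F / (real (N j) * ln (real (q j)))"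
    if "t\<^sup>2 \<le> real (q j) * F" "\<bar>t\<bar> > D j * sqrt (real (N j))" for t F j
  proof -
    have ln_pos: "ln (real (q j)) > 0" using q_gt(2)[of j] by (intro ln_gt_zero) auto
    have q0: "real (q j) > 0" using q_gt(2)[of j] by simp
    have N0: "real (N j) > 0" using N(1)[of j] by simp
    have D2: "(D j)\<^sup>2 = real j * real (q j) * ln (real (q j))"
      unfolding D_def using ln_pos by (intro real_sqrt_pow2) auto
    have "D j \<ge> 0" unfolding D_def using ln_pos by (intro real_sqrt_ge_zero) auto
    hence "(D j * sqrt (real (N j)))\<^sup>2 \<le> \<bar>t\<bar>\<^sup>2" using that(2) by (intro power_mono) auto
    hence "(D j)\<^sup>2 * real (N j) \<le> t\<^sup>2" by (simp add: power_mult_distrib)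
    also have "\<dots> \<le> real (q j) * F" by fact
    finally have "real (q j) * (real j * (real (N j) * ln (real (q j)))) \<le> real (q j) * F"
      unfolding D2 by (simp add: mult_ac)
    hence "real j * (real (N j) * ln (real (q j))) \<le> F" using q0 by (simp only: mult_le_cancel_left_pos)
    thus ?thesis using N0 ln_pos by (simp add: pos_le_divide_eq)
  qed
  have G_lim: "filterlim (\<lambda>j. G (real (N j)) (q j) / (real (N j) * ln (real (q j)))) at_top sequentially"
    by (rule filterlim_at_top_mono[OF filterlim_real_sequentially])
       (auto intro!: always_eventually large[OF G_ge[OF q_def[THEN fun_cong]] N(3)])
  have V_lim: "filterlim (\<lambda>j. V_Lambda (real (N j)) (q j) / (real (N j) * ln (real (q j)))) at_top sequentially"
    by (rule filterlim_at_top_mono[OF filterlim_real_sequentially])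
       (auto intro!: always_eventually large[OF V_Lambda_ge[OF q_def[THEN fun_cong]] N(2)])
  have basic: "\<forall>j. 3 \<le> q j \<and> real (q j) < real (N j)"
    using q_gt(2) N(1) by (auto intro: order_trans[of 3 4])
  show ?thesis
    by (intro conjI exI[of _ q] exI[of _ "\<lambda>j. real (N j)"] basic q_lim x_lim G_lim V_lim)
qed

end
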